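(* There exists an elliptic curve $E$ over $\mathbb{Q}$ with torsion group $E(\mathbb{Q})_{\rm tors}\cong \mathbb{Z}/2\mathbb{Z}\times\mathbb{Z}/2\mathbb{Z}$ whose Mordell–Weil rank over $\mathbb{Q}$ is equal to $7$. *)

theory Defs
  imports "HOL-Algebra.Elementary_Groups" "HOL-Algebra.Free_Abelian_Groups"
begin

text \<open>
  An elliptic curve over a field is given by a general Weierstrass equation
  \<open>y\<^sup>2 + a1 x y + a3 y = x\<^sup>3 + a2 x\<^sup>2 + a4 x + a6\<close>
  with non-vanishing discriminant.
\<close>

record 'a weierstrass =
  a1 :: 'a
  a2 :: 'a
  a3 :: 'a
  a4 :: 'a
  a6 :: 'a

definition discriminant :: "'a::field weierstrass \<Rightarrow> 'a" where
  "discriminant E =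
    (let b2 = (a1 E)\<^sup>2 + 4 * a2 E;
         b4 = 2 * a4 E + a1 E * a3 E;
         b6 = (a3 E)\<^sup>2 + 4 * a6 E;
         b8 = (a1 E)\<^sup>2 * a6 E + 4 * a2 E * a6 E - a1 E * a3 E * a4 E
                + a2 E * (a3 E)\<^sup>2 - (a4 E)\<^sup>2
     in - b2\<^sup>2 * b8 - 8 * b4 ^ 3 - 27 * b6\<^sup>2 + 9 * b2 * b4 * b6)"

definition elliptic_curve :: "'a::field weierstrass \<Rightarrow> bool" where
  "elliptic_curve E \<longleftrightarrow> discriminant E \<noteq> 0"

text \<open>
  Points of the projective closure: the line at infinity meets a Weierstrass cubic
  in the single point \<open>[0 : 1 : 0]\<close>, represented by \<open>Infinity\<close>.
\<close>

datatype 'a point = Infinity | Affine 'a 'a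

fun on_curve :: "'a::field weierstrass \<Rightarrow> 'a point \<Rightarrow> bool" where
  "on_curve E Infinity \<longleftrightarrow> True"
| "on_curve E (Affine x y) \<longleftrightarrow>
     y\<^sup>2 + a1 E * x * y + a3 E * y = x ^ 3 + a2 E * x\<^sup>2 + a4 E * x + a6 E"

text \<open>
  The chord-tangent law. In the \<open>else\<close> branch \<open>l\<close> is the slope of the line through the
  two points (the tangent line if they coincide) and \<open>n\<close> its intercept; two points on the
  curve with the same abscissa that are not opposite to each other are equal.
\<close>

fun point_add :: "'a::field weierstrass \<Rightarrow> 'a point \<Rightarrow> 'a point \<Rightarrow> 'a point" where
  "point_add E Infinity Q = Q"
| "point_add E (Affine x1 y1) Infinity = Affine x1 y1"
| "point_add E (Affine x1 y1) (Affine x2 y2) =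
     (if x1 = x2 \<and> y1 + y2 + a1 E * x2 + a3 E = 0 then Infinity
      else
        let l = (if x1 = x2
                 then (3 * x1\<^sup>2 + 2 * a2 E * x1 + a4 E - a1 E * y1)
                        / (2 * y1 + a1 E * x1 + a3 E)
                 else (y2 - y1) / (x2 - x1));
            n = y1 - l * x1;
            x3 = l\<^sup>2 + a1 E * l - a2 E - x1 - x2
        in Affine x3 (- (l + a1 E) * x3 - n - a3 E))"

definition point_group :: "'a::field weierstrass \<Rightarrow> 'a point monoid" where
  "point_group E = \<lparr>carrier = {P. on_curve E P}, monoid.mult = point_add E, one = Infinity\<rparr>"

text \<open>The torsion part of a commutative group, with the inherited operations.\<close>

definition torsion_part :: "('a, 'b) monoid_scheme \<Rightarrow> ('a, 'b) monoid_scheme" where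
  "torsion_part G =
     G\<lparr>carrier := {x \<in> carrier G. \<exists>n::nat. n > 0 \<and> x [^]\<^bsub>G\<^esub> n = \<one>\<^bsub>G\<^esub>}\<rparr>"

text \<open>
  By the Mordell--Weil theorem, for an elliptic curve \<open>E\<close> over the rationals there is a
  unique \<open>r\<close> such that \<open>E(\<rat>)\<close> is isomorphic to \<open>E(\<rat>)\<^sub>t\<^sub>o\<^sub>r\<^sub>s \<times> \<int>\<^sup>r\<close>; this \<open>r\<close> is the rank. It is
  stated as a relation, so that no default value is involved.
\<close>

definition has_mordell_weil_rank :: "rat weierstrass \<Rightarrow> nat \<Rightarrow> bool" where
  "has_mordell_weil_rank E r \<longleftrightarrow>
     point_group E \<cong> torsion_part (point_group E) \<times>\<times> free_Abelian_group {..<r}"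

end

theory Submission
  imports Defs "HOL-Computational_Algebra.Polynomial" "HOL-Computational_Algebra.Squarefree"
    "HOL-Computational_Algebra.Nth_Powers" "HOL-Number_Theory.Residues"
begin

text \<open>
  The curve is \<open>y\<^sup>2 = x (x - n) (x + n)\<close> for the congruent number
  \<open>n = 797507543735 = 5 \<cdot> 7 \<cdot> 17 \<cdot> 97 \<cdot> 173 \<cdot> 79873\<close> of Rogers.
  Doubling a rational point that is not of order two produces an even denominator, and every further
  doubling makes the 2-adic valuation of the denominator grow, so the torsion is the full 2-torsion.
  Finite generation follows from a descent on the naive height. For the rank,
  \<open>P \<mapsto> (x, x - n)\<close> modulo squares has kernel \<open>2 E(\<rat>)\<close>. The image is cut down by congruences at the
  primes 5, 7, 17 and 173: nine parities of valuations of \<open>x\<close> and \<open>x - n\<close> already determine the class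
  of a point modulo \<open>2 E(\<rat>)\<close>. Two points of order two and seven explicit points of infinite order
  realise all values of these nine parities, so \<open>E(\<rat>) / 2 E(\<rat>)\<close> has order \<open>2\<^sup>9\<close>
  and the rank is \<open>9 - 2\<close>.
\<close>

section \<open>The group law\<close>

text \<open>Modulo squares the pair \<open>(x, x - n)\<close> has 15 bits of freedom a priori: the
  sign and six primes for \<open>x\<close>, the same and the prime 2 for \<open>x - n\<close>. The
  nine recorded parities leave six of them unseen: the sign and 5, 7, 173 in \<open>x\<close>, the
  sign and 5 in \<open>x - n\<close>. For this curve residue symbols alone fix these six; even the
  signs are settled at 7, where -1 is not a square, instead of over the reals. The local bound then
  coincides with the number of classes of known points. The parities serve twice: points realising
  all their values are also the finite set of coset representatives that the height descent
  requires, so finite generation is obtained with rational arithmetic only. Among the group axioms,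
  associativity is the hard one, because \<open>point_add\<close> is a formula with cases. It is
  derived from factorizations of \<open>f - L^2\<close> in the polynomial ring, where coincident
  points are repeated roots; only pairs of opposite points have to be treated apart.\<close>

text \<open>Three points are the intersection, counted with multiplicity, of the curve \<open>y\<^sup>2 = f x\<close> with the
  graph of \<open>L\<close>; tangent lines need no separate treatment.\<close>

definition tri :: "'a::field poly \<Rightarrow> 'a \<Rightarrow> 'a \<Rightarrow> 'a \<Rightarrow> 'a \<Rightarrow> 'a \<Rightarrow> 'a \<Rightarrow> bool" where
  "tri f x1 y1 x2 y2 x3 y3 \<longleftrightarrow>
    (\<exists>L. degree L \<le> 1 \<and> poly L x1 = y1 \<and> poly L x2 = y2 \<and> poly L x3 = y3 \<and>
      f - L\<^sup>2 = [:-x1, 1:] * [:-x2, 1:] * [:-x3, 1:])"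

lemma tri_swap12: "tri f x1 y1 x2 y2 x3 y3 \<Longrightarrow> tri f x2 y2 x1 y1 x3 y3"
  unfolding tri_def mult.commute[of "[:-x2, 1:]" "[:-x1, 1:]"] by blast

lemma tri_swap23: "tri f x1 y1 x2 y2 x3 y3 \<Longrightarrow> tri f x1 y1 x3 y3 x2 y2"
  unfolding tri_def mult.assoc mult.commute[of "[:-x3, 1:]" "[:-x2, 1:]"] by blast

lemma tri_neg:
  assumes "tri f x1 y1 x2 y2 x3 y3"
  shows "tri f x1 (-y1) x2 (-y2) x3 (-y3)"
proof -
  from assms obtain L where "degree L \<le> 1" "poly L x1 = y1" "poly L x2 = y2" "poly L x3 = y3"
      "f - L\<^sup>2 = [:-x1, 1:] * [:-x2, 1:] * [:-x3, 1:]"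
    unfolding tri_def by blast
  then show ?thesis unfolding tri_def by (intro exI[of _ "-L"]) auto
qed

lemma poly_root_factor:
  fixes p :: "'a::field poly"
  shows "poly p a = 0 \<Longrightarrow> \<exists>q. p = [:-a, 1:] * q"
  by (metis dvdE poly_eq_0_iff_dvd)

lemma degree_le_1_ex:
  fixes L :: "'a::zero poly"
  assumes "degree L \<le> 1"
  shows "\<exists>c l. L = [:c, l:]"
proof -
  obtain c M where M: "L = pCons c M" by (cases L)
  have "degree M = 0" using assms M by (cases "M = 0") auto
  then obtain l where "M = [:l:]" by (metis degree_eq_zeroE)
  then show ?thesis using M by blast
qed

lemma quad_diff_zero:
  fixes D :: "'a::field poly"
  assumes "degree D \<le> 1" "poly D a = 0" "poly D b = 0" "a \<noteq> b"
  shows "D = 0"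
proof -
  obtain c l where D: "D = [:c, l:]" using degree_le_1_ex assms(1) by blast
  have "l * (a - b) = 0"
  proof -
    have "l * (a - b) = poly D a - poly D b" by (simp add: D algebra_simps)
    then show ?thesis using assms by simp
  qed
  then show ?thesis using assms D by auto
qed

text \<open>The tangent counterpart of \<open>quad_diff_zero\<close>: where two abscissas coincide,
  two distinct zeros are replaced by one double zero.\<close>

lemma double_root_zero:
  fixes D :: "'a::field poly"
  assumes "degree D \<le> 1" "D = [:-a, 1:] * ([:-a, 1:] * M)"
  shows "D = 0"
proof (rule ccontr)
  assume "D \<noteq> 0"
  hence "M \<noteq> 0" using assms(2) by auto
  define X where "X = [:-a, 1:]"
  have X: "X \<noteq> 0" "degree X = 1" by (simp_all add: X_def)
  have "degree D = degree X + (degree X + degree M)"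
    unfolding assms(2) X_def[symmetric] using X(1) \<open>M \<noteq> 0\<close> by (simp add: degree_mult_eq)
  thus False using X assms(1) by simp
qed

text \<open>If \<open>L1, L2, L3\<close> are the three given lines and \<open>G\<close> is the sum of the slopes of \<open>L1\<close> and \<open>L2\<close>, then
  \<open>L1 L2 / (x - x4)\<close> becomes \<open>q - G y\<close> on the curve for a quadratic \<open>q\<close>; dividing by \<open>L3\<close> in the same way
  leaves the line \<open>L4\<close> through the remaining three points.\<close>

lemma tri_assoc_aux:
  fixes f :: "'a::field poly"
  assumes t1: "tri f x1 y1 x2 y2 x4 (-y4)"
    and t2: "tri f x4 y4 x3 y3 x6 (-y6)"
    and t3: "tri f x2 y2 x3 y3 x5 (-y5)"
    and n1: "\<not> (x1 = x3 \<and> y3 = - y1)"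
    and n2: "\<not> (x2 = x3 \<and> y3 = - y2)"
  shows "tri f x1 y1 x5 y5 x6 (-y6)"
proof -
  obtain L1 where L1: "degree L1 \<le> 1" "poly L1 x1 = y1" "poly L1 x2 = y2" "poly L1 x4 = -y4"
    and f1: "f - L1\<^sup>2 = [:-x1, 1:] * [:-x2, 1:] * [:-x4, 1:]" using t1 unfolding tri_def by blast
  obtain L2 where L2: "degree L2 \<le> 1" "poly L2 x4 = y4" "poly L2 x3 = y3" "poly L2 x6 = -y6"
    and f2: "f - L2\<^sup>2 = [:-x4, 1:] * [:-x3, 1:] * [:-x6, 1:]" using t2 unfolding tri_def by blast
  obtain L3 where L3: "degree L3 \<le> 1" "poly L3 x2 = y2" "poly L3 x3 = y3" "poly L3 x5 = -y5"
    and f3: "f - L3\<^sup>2 = [:-x2, 1:] * [:-x3, 1:] * [:-x5, 1:]" using t3 unfolding tri_def by blast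
  define X where "X = (\<lambda>a::'a. [:-a, 1:])"
  have X0: "X a \<noteq> 0" for a by (simp add: X_def)
  have Xp: "poly (X a) b = b - a" for a b by (simp add: X_def)
  note f1 = f1[folded X_def[THEN fun_cong, simplified]]
  note f2 = f2[folded X_def[THEN fun_cong, simplified]]
  note f3 = f3[folded X_def[THEN fun_cong, simplified]]
  obtain c l where cl: "L1 = [:c, l:]" using degree_le_1_ex L1(1) by blast
  obtain d m where dm: "L2 = [:d, m:]" using degree_le_1_ex L2(1) by blast
  obtain e n where en: "L3 = [:e, n:]" using degree_le_1_ex L3(1) by blast
  define g where "g = l + m"
  define G where "G = [:g:]"
  have Gp: "poly G a = g" for a by (simp add: G_def)
  \<comment> \<open>The point with abscissa \<open>x4\<close> has ordinate \<open>-y4\<close> on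
    \<open>L1\<close> and \<open>y4\<close> on \<open>L2\<close>, so \<open>L1 + L2\<close> vanishes
    there.\<close>
  have s: "(c + d) + (l + m) * x4 = 0"
  proof -
    have "(c + d) + (l + m) * x4 = poly L1 x4 + poly L2 x4" by (simp add: cl dm algebra_simps)
    then show ?thesis using L1 L2 by simp
  qed
  have GX4: "L1 + L2 = G * X x4"
    unfolding cl dm G_def X_def using s by (simp add: g_def algebra_simps eq_neg_iff_add_eq_0)
  \<comment> \<open>On the curve \<open>(y - L1) * (y - L2) = X x4 * (q - G * y)\<close>, because
    \<open>q * X x4 = f + L1 * L2\<close>. Expanding \<open>f\<close> through \<open>L2\<close>
    instead of \<open>L1\<close> gives the second form \<open>qA\<close>.\<close>
  define q where "q = G * L1 + X x1 * X x2"
  have "X x4 * (G * L1 + X x1 * X x2 - (G * L2 + X x3 * X x6)) = 0"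
    using f1 f2 GX4 by Groebner_Basis.algebra
  hence qA: "q = G * L2 + X x3 * X x6" using X0 by (simp add: q_def)
  \<comment> \<open>The norm of the function \<open>q - G * y\<close>; its four roots are the
    abscissas of the points left on the two lines.\<close>
  have nrm: "q\<^sup>2 - G\<^sup>2 * f = X x1 * X x2 * (X x3 * X x6)"
  proof -
    have "G * L1 + X x1 * X x2 = G * L2 + X x3 * X x6" using qA q_def by simp
    with f1 GX4 show ?thesis unfolding q_def by Groebner_Basis.algebra
  qed
  have qx1: "poly q x1 = g * y1" and qx2: "poly q x2 = g * y2"
    by (simp_all add: q_def Gp Xp L1)
  have qx3: "poly q x3 = g * y3" and qx6: "poly q x6 = g * (-y6)"
    by (simp_all add: qA Gp Xp L2)
  \<comment> \<open>If the slopes cancel, then \<open>L2 = - L1\<close> and \<open>x3\<close> is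
    \<open>x1\<close> or \<open>x2\<close>, which makes the third point opposite to the first or the
    second.\<close>
  have g0: "g \<noteq> 0"
  proof
    assume "g = 0"
    hence "G = 0" by (simp add: G_def)
    hence "poly (X x1 * X x2) x3 = poly (X x3 * X x6) x3" using qA q_def by simp
    hence "x3 = x1 \<or> x3 = x2" by (simp add: Xp)
    moreover have "L2 = - L1" using GX4 \<open>G = 0\<close> by (simp add: eq_neg_iff_add_eq_0 add.commute)
    hence "y3 = - poly L1 x3" using L2 by simp
    ultimately show False using n1 n2 L1 by auto
  qed
  \<comment> \<open>\<open>q - G * y\<close> vanishes at the second and third points, where
    \<open>y = L3\<close>. As \<open>q - G * L3\<close> is a monic quadratic, it has to be
    \<open>X x2 * X x3\<close>.\<close>
  have qB: "q = G * L3 + X x2 * X x3"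
  proof -
    define D where "D = q - G * L3 - X x2 * X x3"
    have Deq: "D = [: g * c - g * e + x1 * x2 - x2 * x3, g * l - g * n - x1 + x3 :]"
      by (simp add: D_def q_def G_def X_def cl en algebra_simps)
    hence dD: "degree D \<le> 1" by simp
    have D2: "poly D x2 = 0" and D3: "poly D x3 = 0"
      by (simp_all add: D_def qx2 qx3 Gp L3 Xp)
    have "D = 0"
    proof (cases "x2 = x3")
      case False
      show ?thesis using quad_diff_zero[OF dD D2 D3 False] .
    next
      \<comment> \<open>For equal points one zero of \<open>D\<close> is immediate. The second comes
        from comparing the norms of \<open>q - G * y\<close> and \<open>y - L3\<close>: after
        division by \<open>X x2\<close> twice, evaluation at \<open>x2\<close> leaves
        \<open>poly K x2 * 2 * g * y2 = 0\<close>.\<close>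
      case True
      have y23: "y2 = y3" using L3 True by simp
      have y2: "y2 + y2 \<noteq> 0" using n2 True y23 by (metis eq_neg_iff_add_eq_0)
      obtain K where K: "D = X x2 * K" using poly_root_factor[OF D2] X_def by metis
      have "(K + X x2) * (q + G * L3) = X x2 * (G\<^sup>2 * X x5 + X x1 * X x6)"
      proof -
        have "q - G * L3 = X x2 * (K + X x2)" using K True by (simp add: D_def algebra_simps)
        hence "X x2 * ((K + X x2) * (q + G * L3)) = X x2 * (X x2 * (G\<^sup>2 * X x5 + X x1 * X x6))"
        proof -
          have "q\<^sup>2 - G\<^sup>2 * f = X x1 * X x2 * (X x2 * X x6)" "f - L3\<^sup>2 = X x2 * X x2 * X x5"
            using nrm f3 True by simp_all
          with \<open>q - G * L3 = X x2 * (K + X x2)\<close> show ?thesis by Groebner_Basis.algebra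
        qed
        thus ?thesis using X0 by simp
      qed
      hence "poly ((K + X x2) * (q + G * L3)) x2 = poly (X x2 * (G\<^sup>2 * X x5 + X x1 * X x6)) x2" by simp
      hence "poly K x2 * (g * (y2 + y2)) = 0" by (simp add: Xp qx2 Gp L3 algebra_simps)
      hence "poly K x2 = 0" using g0 y2 by simp
      then obtain M where "K = X x2 * M" using poly_root_factor X_def by metis
      hence "D = X x2 * X x2 * M" using K by simp
      show ?thesis using double_root_zero[OF dD] \<open>D = X x2 * X x2 * M\<close> X_def by (simp only: mult.assoc)
    qed
    thus ?thesis unfolding D_def by Groebner_Basis.algebra
  qed
  have I: "X x2 * X x3 + 2 * G * L3 - G\<^sup>2 * X x5 = X x1 * X x6"
  proof -
    have "(X x2 * X x3) * (X x2 * X x3 + 2 * G * L3 - G\<^sup>2 * X x5) = (X x2 * X x3) * (X x1 * X x6)"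
      using nrm f3 qB by Groebner_Basis.algebra
    thus ?thesis using X0 by simp
  qed
  \<comment> \<open>The mirror image of \<open>L1 + L2 = G * X x4\<close>: the pairs
    \<open>L1, L2\<close> and \<open>L3, L4\<close> have the same slope sum.\<close>
  define L4 where "L4 = G * X x5 - L3"
  have "degree L4 \<le> 1" by (simp add: L4_def en G_def X_def)
  moreover have f4: "f - L4\<^sup>2 = X x1 * X x5 * X x6" unfolding L4_def using I f3 by Groebner_Basis.algebra
  moreover have L4q: "q - G * L4 = X x1 * X x6" unfolding L4_def using I qB by Groebner_Basis.algebra
  have "poly L4 x5 = y5" by (simp add: L4_def Xp L3)
  moreover have "poly L4 x1 = y1"
  proof -
    have "poly (q - G * L4) x1 = 0" unfolding L4q by (simp add: Xp)
    thus ?thesis using g0 by (simp add: qx1 Gp)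
  qed
  moreover have "poly L4 x6 = - y6"
  proof -
    have "poly (q - G * L4) x6 = 0" unfolding L4q by (simp add: Xp)
    hence "g * (- y6) = g * poly L4 x6" by (simp only: poly_diff poly_mult qx6 Gp) simp
    thus ?thesis using g0 by (metis mult_left_cancel)
  qed
  ultimately show ?thesis unfolding tri_def X_def by blast
qed

text \<open>Both lines interpolate the first two points, or have the same tangency there, so they
  coincide and the third root is what remains after cancelling two linear factors. The excluded case
  is that of a vertical line.\<close>

lemma tri_unique:
  fixes f :: "'a::field_char_0 poly"
  assumes t: "tri f x1 y1 x2 y2 x3 y3" and t': "tri f x1 y1 x2 y2 x3' y3'"
    and n: "\<not> (x1 = x2 \<and> y1 + y2 = 0)"
  shows "x3 = x3' \<and> y3 = y3'"
proof -
  obtain L where L: "degree L \<le> 1" "poly L x1 = y1" "poly L x2 = y2" "poly L x3 = y3"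
    and f: "f - L\<^sup>2 = [:-x1, 1:] * [:-x2, 1:] * [:-x3, 1:]" using t unfolding tri_def by blast
  obtain M where M: "degree M \<le> 1" "poly M x1 = y1" "poly M x2 = y2" "poly M x3' = y3'"
    and f': "f - M\<^sup>2 = [:-x1, 1:] * [:-x2, 1:] * [:-x3', 1:]" using t' unfolding tri_def by blast
  have "L - M = 0"
  proof (cases "x1 = x2")
    case False
    have "degree (L - M) \<le> 1" using L(1) M(1) degree_diff_le by blast
    then show ?thesis using quad_diff_zero[of "L - M" x1 x2] False L M by simp
  next
    case True
    define X where "X = [:-x1, 1:]"
    have "poly (L - M) x1 = 0" using L M by simp
    then obtain K where K: "L - M = X * K" using poly_root_factor X_def by blast
    have "X * (X * ([:-x3', 1:] - [:-x3, 1:])) = (L - M) * (L + M)"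
    proof -
      have "f - L\<^sup>2 = X * X * [:-x3, 1:]" "f - M\<^sup>2 = X * X * [:-x3', 1:]"
        using f f' True X_def by simp_all
      thus ?thesis by Groebner_Basis.algebra
    qed
    hence "X * (X * ([:-x3', 1:] - [:-x3, 1:])) = X * (K * (L + M))" by (simp only: K mult.assoc)
    hence "X * ([:-x3', 1:] - [:-x3, 1:]) = K * (L + M)"
      by (subst (asm) mult_left_cancel) (simp_all add: X_def)
    hence "poly (X * ([:-x3', 1:] - [:-x3, 1:])) x1 = poly (K * (L + M)) x1" by simp
    hence "poly K x1 * (y1 + y1) = 0" by (simp add: X_def L M)
    moreover have "y1 + y1 \<noteq> 0" using n L True by auto
    ultimately have "poly K x1 = 0" by simp
    then obtain N where "K = X * N" using poly_root_factor X_def by blast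
    hence LM: "L - M = X * (X * N)" using K by simp
    have "degree (L - M) \<le> 1" using L(1) M(1) degree_diff_le by blast
    thus ?thesis using double_root_zero LM X_def by blast
  qed
  hence LM: "L = M" by simp
  hence "[:-x1, 1:] * [:-x2, 1:] * [:-x3, 1:] = [:-x1, 1:] * [:-x2, 1:] * [:-x3', 1:]" using f f' by metis
  hence "[:-x3, 1:] = [:-x3', 1:]" by (subst (asm) mult_left_cancel) simp_all
  thus ?thesis using L M LM by auto
qed

section \<open>The chord-tangent group of a cubic with three distinct rational roots\<close>

locale split_cubic =
  fixes e1 e2 e3 :: "'a::field_char_0"
  assumes distinct: "e1 \<noteq> e2" "e1 \<noteq> e3" "e2 \<noteq> e3"
begin

definition E :: "'a weierstrass" where
  "E = \<lparr>a1 = 0, a2 = - (e1 + e2 + e3), a3 = 0, a4 = e1 * e2 + e1 * e3 + e2 * e3, a6 = - (e1 * e2 * e3)\<rparr>"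

lemma E_simps [simp]:
  "a1 E = 0" "a2 E = - (e1 + e2 + e3)" "a3 E = 0" "a4 E = e1 * e2 + e1 * e3 + e2 * e3"
  "a6 E = - (e1 * e2 * e3)"
  by (simp_all add: E_def)

definition f :: "'a poly" where "f = [:-e1, 1:] * [:-e2, 1:] * [:-e3, 1:]"

lemma poly_f: "poly f x = (x - e1) * (x - e2) * (x - e3)"
  by (simp add: f_def algebra_simps)

lemma on_curve_iff: "on_curve E (Affine x y) \<longleftrightarrow> y\<^sup>2 = (x - e1) * (x - e2) * (x - e3)"
  by (simp add: algebra_simps power2_eq_square power3_eq_cube)

lemma on_curve_poly: "on_curve E (Affine x y) \<longleftrightarrow> y\<^sup>2 = poly f x"
  unfolding on_curve_iff poly_f ..

fun neg :: "'a point \<Rightarrow> 'a point" where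
  "neg Infinity = Infinity"
| "neg (Affine x y) = Affine x (- y)"

lemma tri_on_curve: "tri f x1 y1 x2 y2 x3 y3 \<Longrightarrow> on_curve E (Affine x3 y3)"
proof -
  assume "tri f x1 y1 x2 y2 x3 y3"
  then obtain L where L: "poly L x3 = y3" "f - L\<^sup>2 = [:-x1, 1:] * [:-x2, 1:] * [:-x3, 1:]"
    unfolding tri_def by blast
  have "poly (f - L\<^sup>2) x3 = 0" unfolding L by simp
  thus ?thesis unfolding on_curve_poly using L(1) by simp
qed

text \<open>The bridge from the formulas of \<open>point_add\<close> to polynomial factorizations:
  \<open>x3\<close> is chosen to match the quadratic coefficient, so the difference of the two sides
  is linear, and it vanishes at both given abscissas, twice in the tangent case.\<close>

lemma add_tri:
  assumes on: "on_curve E (Affine x1 y1)" "on_curve E (Affine x2 y2)"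
    and n: "\<not> (x1 = x2 \<and> y1 + y2 = 0)"
  shows "\<exists>x3 y3. point_add E (Affine x1 y1) (Affine x2 y2) = Affine x3 y3 \<and> tri f x1 y1 x2 y2 x3 (- y3)"
proof -
  define A B C where "A = - (e1 + e2 + e3)" and "B = e1 * e2 + e1 * e3 + e2 * e3"
    and "C = - (e1 * e2 * e3)"
  have f: "f = [:C, B, A, 1:]" by (simp add: f_def A_def B_def C_def algebra_simps)
  define l where "l = (if x1 = x2 then (3 * x1\<^sup>2 + 2 * A * x1 + B) / (2 * y1) else (y2 - y1) / (x2 - x1))"
  define c where "c = y1 - l * x1"
  define x3 where "x3 = l\<^sup>2 - A - x1 - x2"
  define y3 where "y3 = - l * x3 - c"
  have "point_add E (Affine x1 y1) (Affine x2 y2) = Affine x3 y3"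
    using n by (simp add: Let_def l_def c_def x3_def y3_def A_def B_def)
  moreover have "tri f x1 y1 x2 y2 x3 (- y3)"
  proof -
    define L where "L = [:c, l:]"
    have L1: "poly L x1 = y1" by (simp add: L_def c_def)
    have L2: "poly L x2 = y2"
    proof (cases "x1 = x2")
      case True
      have "y1\<^sup>2 = y2\<^sup>2" using on True by (simp only: on_curve_poly)
      hence "y1 = y2" using n True by (metis power2_eq_iff add.left_inverse)
      then show ?thesis using True L1 by simp
    next
      case False
      hence "l * (x2 - x1) = y2 - y1" by (simp add: l_def)
      then show ?thesis by (simp add: L_def c_def algebra_simps)
    qed
    have L3: "poly L x3 = - y3" by (simp add: L_def y3_def)
    define d0 where "d0 = C - c\<^sup>2 + x1 * x2 * x3"
    define d1 where "d1 = B - 2 * l * c - (x1 * x2 + x1 * x3 + x2 * x3)"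
    have D: "f - L\<^sup>2 - [:-x1, 1:] * [:-x2, 1:] * [:-x3, 1:] = [:d0, d1:]"
      by (simp add: f L_def d0_def d1_def x3_def power2_eq_square algebra_simps)
    have r: "poly [:d0, d1:] a = 0" if "poly f a = (poly L a)\<^sup>2" "a = x1 \<or> a = x2" for a
      unfolding D[symmetric] poly_diff poly_mult poly_power using that by auto
    have r1: "poly [:d0, d1:] x1 = 0" by (rule r) (use on L1 in \<open>auto simp only: on_curve_poly\<close>)
    have r2: "poly [:d0, d1:] x2 = 0" by (rule r) (use on L2 in \<open>auto simp only: on_curve_poly\<close>)
    have "[:d0, d1:] = 0"
    proof (cases "x1 = x2")
      case False
      then show ?thesis using quad_diff_zero[OF _ r1 r2] by simp
    next
      case True
      have "y1 \<noteq> 0"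
        using True n L1 L2 by auto
      hence "l * (2 * y1) = 3 * x1\<^sup>2 + 2 * A * x1 + B" using True by (simp add: l_def)
      moreover have "y1 = l * x1 + c" by (simp add: c_def)
      \<comment> \<open>\<open>d1\<close> equals \<open>f'(x1) - 2 * l * y1\<close>, so its
        vanishing is the equation that defines the tangent slope.\<close>
      ultimately have "d1 = 0" using True unfolding d1_def x3_def by Groebner_Basis.algebra
      then show ?thesis using r1 by simp
    qed
    hence "f - L\<^sup>2 = [:-x1, 1:] * [:-x2, 1:] * [:-x3, 1:]" using D by simp
    moreover have "degree L \<le> 1" by (simp add: L_def)
    ultimately show ?thesis unfolding tri_def using L1 L2 L3 by blast
  qed
  ultimately show ?thesis by blast
qed

text \<open>Together with \<open>add_tri\<close> this turns statements about
  \<open>point_add\<close> into statements about \<open>tri\<close>, which is symmetric in its three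
  points.\<close>

lemma tri_add:
  assumes t: "tri f x1 y1 x2 y2 x3 y3" and n: "\<not> (x1 = x2 \<and> y1 + y2 = 0)"
  shows "point_add E (Affine x1 y1) (Affine x2 y2) = Affine x3 (- y3)"
proof -
  have "on_curve E (Affine x2 y2)" using t tri_swap23 tri_on_curve by blast
  moreover have "on_curve E (Affine x1 y1)" using t tri_swap12 tri_swap23 tri_on_curve by blast
  ultimately obtain x y where xy: "point_add E (Affine x1 y1) (Affine x2 y2) = Affine x y"
      "tri f x1 y1 x2 y2 x (- y)" using add_tri n by blast
  have "x = x3 \<and> - y = y3" using tri_unique[OF xy(2) t n] .
  thus ?thesis using xy by auto
qed

lemma add_Infinity [simp]: "point_add E P Infinity = P"
  by (cases P) auto

lemma add_neg: "point_add E P (neg P) = Infinity" "point_add E (neg P) P = Infinity"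
  by (cases P; simp)+

lemma on_curve_neg: "on_curve E P \<Longrightarrow> on_curve E (neg P)"
  by (cases P) (simp_all del: on_curve.simps(2) add: on_curve_iff)

lemma neg_neg [simp]: "neg (neg P) = P"
  by (cases P) auto

lemma add_closed:
  assumes "on_curve E P" "on_curve E Q"
  shows "on_curve E (point_add E P Q)"
proof (cases P)
  case (Affine x1 y1)
  note P = this
  show ?thesis
  proof (cases Q)
    case (Affine x2 y2)
    show ?thesis
    proof (cases "x1 = x2 \<and> y1 + y2 = 0")
      case True
      then show ?thesis by (simp add: P Affine)
    next
      case False
      then obtain x y where "point_add E P Q = Affine x y" "tri f x1 y1 x2 y2 x (- y)"
        using add_tri assms P Affine by blast
      then show ?thesis using tri_on_curve on_curve_neg[of "Affine x (- y)"] by fastforce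
    qed
  qed (use assms in simp)
qed (use assms in simp)

lemma add_commute:
  assumes "on_curve E P" "on_curve E Q"
  shows "point_add E P Q = point_add E Q P"
proof (cases P)
  case (Affine x1 y1)
  note P = this
  show ?thesis
  proof (cases Q)
    case (Affine x2 y2)
    show ?thesis
    proof (cases "x1 = x2 \<and> y1 + y2 = 0")
      case True
      then show ?thesis by (simp add: P Affine add.commute)
    next
      case False
      then obtain x y where xy: "point_add E P Q = Affine x y" "tri f x1 y1 x2 y2 x (- y)"
        using add_tri assms P Affine by blast
      have "point_add E (Affine x2 y2) (Affine x1 y1) = Affine x (- (- y))"
        by (rule tri_add) (use xy False tri_swap12 in \<open>auto simp: add.commute\<close>)
      then show ?thesis using P Affine xy by simp
    qed
  qed simp
qed simp

text \<open>Smoothness enters here. A graph through \<open>(x, y)\<close> and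
  \<open>(x, - y)\<close> forces \<open>y = 0\<close>; since \<open>f - L^2\<close> and
  \<open>L^2\<close> both have a double zero at \<open>x\<close>, so has \<open>f\<close>.\<close>

lemma no_tri_tangent:
  assumes t: "tri f x y x2 y2 x (- y)"
  shows False
proof -
  obtain L where L: "poly L x = y" "poly L x = - y" and f': "f - L\<^sup>2 = [:-x, 1:] * [:-x2, 1:] * [:-x, 1:]"
    using t unfolding tri_def by blast
  have L0: "poly L x = 0" using L by (simp add: equal_neg_zero)
  have "poly (f - L\<^sup>2) x = 0" unfolding f' by simp
  hence "poly f x = 0" using L0 by simp
  have "poly (pderiv (f - L\<^sup>2)) x = 0" unfolding f' by (simp add: pderiv_mult del: mult_pCons_left mult_pCons_right)
  moreover have "poly (pderiv (L\<^sup>2)) x = 0" using L0 by (simp add: power2_eq_square pderiv_mult)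
  ultimately have "poly (pderiv f) x = 0" by (simp add: pderiv_diff)
  hence "(x - e1) * (x - e2) + (x - e1) * (x - e3) + (x - e2) * (x - e3) = 0"
    by (simp add: f_def pderiv_mult pderiv_pCons algebra_simps)
  moreover have "x = e1 \<or> x = e2 \<or> x = e3" using \<open>poly f x = 0\<close> by (simp add: poly_f)
  ultimately show False using distinct by auto
qed

text \<open>Negating a collinear triple and permuting it gives the triple of \<open>neg Q\<close>,
  \<open>Q + R\<close> and \<open>neg R\<close>. By \<open>no_tri_tangent\<close>,
  \<open>Q + R\<close> differs from \<open>Q\<close>, so this triple really computes a sum.\<close>

lemma add_cancel:
  assumes "on_curve E Q" "on_curve E R"
  shows "point_add E (neg Q) (point_add E Q R) = R"
proof (cases Q)
  case (Affine x2 y2)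
  note Q = this
  show ?thesis
  proof (cases R)
    case Infinity
    then show ?thesis by (simp add: add_neg)
  next
    case (Affine x3 y3)
    show ?thesis
    proof (cases "x2 = x3 \<and> y2 + y3 = 0")
      case True
      then show ?thesis using Q Affine by (simp add: add_eq_0_iff)
    next
      case False
      then obtain x5 y5 where U: "point_add E Q R = Affine x5 y5" and t: "tri f x2 y2 x3 y3 x5 (- y5)"
        using add_tri assms Q Affine by blast
      have t': "tri f x2 (- y2) x5 y5 x3 (- y3)" using tri_swap23[OF tri_neg[OF t]] by simp
      have "\<not> (x2 = x5 \<and> - y2 + y5 = 0)" using no_tri_tangent t by auto
      from tri_add[OF t' this] show ?thesis using U Q Affine by simp
    qed
  qed
qed simp

lemma add_assoc:
  assumes on: "on_curve E P" "on_curve E Q" "on_curve E R"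
  shows "point_add E (point_add E P Q) R = point_add E P (point_add E Q R)"
proof -
  \<comment> \<open>Beyond points at infinity, the separated cases are the pairs of opposite points:
    \<open>P, Q\<close> and \<open>Q, R\<close> have no affine sum, and \<open>P, R\<close> would
    allow the slope sum in \<open>tri_assoc_aux\<close> to vanish. They reduce to
    \<open>add_cancel\<close> and commutativity.\<close>
  consider "P = Infinity" | "Q = Infinity" | "R = Infinity" | "P = neg Q" | "R = neg Q" | "R = neg P" |
    x1 y1 x2 y2 x3 y3 where "P = Affine x1 y1" "Q = Affine x2 y2" "R = Affine x3 y3"
      "P \<noteq> neg Q" "R \<noteq> neg Q" "R \<noteq> neg P" by (metis point.exhaust)
  then show ?thesis
  proof cases
    case 4
    then show ?thesis using add_cancel on add_neg by simp
  next
    case 5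
    have "point_add E (point_add E P Q) R = point_add E R (point_add E Q P)"
      using add_commute add_closed on by metis
    also have "\<dots> = P" using add_cancel on 5 by simp
    finally show ?thesis using 5 add_neg by simp
  next
    case 6
    have "point_add E (point_add E P Q) R = point_add E R (point_add E P Q)"
      using add_commute add_closed on by metis
    also have "\<dots> = Q" using add_cancel on 6 by simp
    also have "Q = point_add E (neg R) (point_add E R Q)" using add_cancel on by simp
    also have "\<dots> = point_add E P (point_add E Q R)" using 6 add_commute on by simp
    finally show ?thesis .
  next
    case 7
    have n12: "\<not> (x1 = x2 \<and> y1 + y2 = 0)" and n23: "\<not> (x2 = x3 \<and> y2 + y3 = 0)"
      and n13: "\<not> (x1 = x3 \<and> y3 = - y1)" and n23': "\<not> (x2 = x3 \<and> y3 = - y2)"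
      using 7 by (auto simp: add_eq_0_iff)
    obtain x4 y4 where S: "point_add E P Q = Affine x4 y4" and tS: "tri f x1 y1 x2 y2 x4 (- y4)"
      using add_tri on n12 7(1,2) by blast
    obtain x5 y5 where U: "point_add E Q R = Affine x5 y5" and tU: "tri f x2 y2 x3 y3 x5 (- y5)"
      using add_tri on n23 7(2,3) by blast
    have onS: "on_curve E (Affine x4 y4)" using add_closed on S by metis
    show ?thesis
    proof (cases "x4 = x3 \<and> y4 + y3 = 0")
      \<comment> \<open>Here \<open>P + Q = - R\<close>, so the three points are collinear and
        \<open>Q + R = - P\<close> follows by permuting the triple. The case
        \<open>Q + R = - P\<close> below is symmetric.\<close>
      case True
      hence "- y4 = y3" by (metis minus_unique)
      hence "tri f x1 y1 x2 y2 x3 y3" using tS True by simp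
      hence "tri f x2 y2 x3 y3 x1 y1" using tri_swap12 tri_swap23 by blast
      hence "point_add E Q R = Affine x1 (- y1)" using tri_add n23 7 by simp
      then show ?thesis using S True 7(1,3) by simp
    next
      case nS: False
      show ?thesis
      proof (cases "x1 = x5 \<and> y1 + y5 = 0")
        case True
        hence "- y5 = y1" by (metis minus_unique add.commute)
        hence "tri f x2 y2 x3 y3 x1 y1" using tU True by simp
        hence "tri f x1 y1 x2 y2 x3 y3" using tri_swap12 tri_swap23 by blast
        hence "point_add E P Q = Affine x3 (- y3)" using tri_add n12 7 by simp
        then show ?thesis using U True 7(1,3) by simp
      next
        case nU: False
        obtain x6 y6 where T: "point_add E (Affine x4 y4) R = Affine x6 y6"
          and tT: "tri f x4 y4 x3 y3 x6 (- y6)"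
          using add_tri[OF onS _ nS] on 7(3) by blast
        have "tri f x1 y1 x5 y5 x6 (- y6)" using tri_assoc_aux[OF tS tT tU n13 n23'] .
        from tri_add[OF this nU] show ?thesis using S U T 7(1) by simp
      qed
    qed
  qed auto
qed

lemma carrier_point_group [simp]: "P \<in> carrier (point_group E) \<longleftrightarrow> on_curve E P"
  and mult_point_group [simp]: "P \<otimes>\<^bsub>point_group E\<^esub> Q = point_add E P Q"
  and one_point_group [simp]: "\<one>\<^bsub>point_group E\<^esub> = Infinity"
  by (simp_all add: point_group_def)

lemma comm_group_point_group: "comm_group (point_group E)"
proof (rule comm_groupI)
  fix P assume "P \<in> carrier (point_group E)"
  thus "\<exists>Q\<in>carrier (point_group E). Q \<otimes>\<^bsub>point_group E\<^esub> P = \<one>\<^bsub>point_group E\<^esub>"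
    by (intro bexI[of _ "neg P"]) (simp_all add: add_neg on_curve_neg)
qed (simp_all add: add_closed add_assoc, auto intro: add_commute)

end

section \<open>Two-descent\<close>

context split_cubic
begin

text \<open>The class of \<open>x - r\<close> modulo squares; where it vanishes, the product of the other two factors of
  \<open>f\<close> takes its place.\<close>

definition delta :: "'a \<Rightarrow> 'a \<Rightarrow> 'a" where
  "delta r x = (if x = r then poly (pderiv f) r else x - r)"

lemma pderiv_f: "poly (pderiv f) x = (x - e1) * (x - e2) + (x - e1) * (x - e3) + (x - e2) * (x - e3)"
  by (simp add: f_def pderiv_mult pderiv_pCons algebra_simps)

lemma pderiv_f_root:
  assumes "r \<in> {e1, e2, e3}"
  shows "poly f r = 0" "poly (pderiv f) r \<noteq> 0"
  using assms distinct by (auto simp: poly_f pderiv_f)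

lemma delta_nonzero: "r \<in> {e1, e2, e3} \<Longrightarrow> delta r x \<noteq> 0"
  using pderiv_f_root by (auto simp: delta_def)

text \<open>This justifies the value of \<open>delta\<close> at a root. The line vanishes at
  \<open>r\<close>, so \<open>f = (X - r) * g\<close> and \<open>L\<close> share a factor; dividing
  it out and evaluating at \<open>r\<close> gives \<open>(x1 - r) * (x2 - r) = g(r)\<close>, and
  \<open>g(r)\<close> is the derivative of \<open>f\<close> at \<open>r\<close>.\<close>

lemma tri_delta_root:
  assumes r: "r \<in> {e1, e2, e3}" and t: "tri f x1 y1 x2 y2 r y3"
  shows "delta r x1 * delta r x2 * delta r r = (poly (pderiv f) r)\<^sup>2"
proof -
  obtain L where f': "f - L\<^sup>2 = [:-x1, 1:] * [:-x2, 1:] * [:-r, 1:]"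
    using t unfolding tri_def by blast
  obtain g where g: "f = [:-r, 1:] * g" using poly_root_factor pderiv_f_root(1)[OF r] by blast
  have d: "poly (pderiv f) r = poly g r"
    unfolding g by (simp add: pderiv_mult pderiv_pCons del: mult_pCons_left)
  have "poly (f - L\<^sup>2) r = 0" unfolding f' by simp
  hence "poly L r = 0" using pderiv_f_root(1)[OF r] by simp
  then obtain K where K: "L = [:-r, 1:] * K" using poly_root_factor by blast
  define X where "X = [:-r, 1:]"
  have "X * (g - X * K\<^sup>2) = X * ([:-x1, 1:] * [:-x2, 1:])"
    using f' unfolding g K X_def[symmetric] by Groebner_Basis.algebra
  hence "g - X * K\<^sup>2 = [:-x1, 1:] * [:-x2, 1:]"
    by (subst (asm) mult_left_cancel) (simp_all add: X_def)
  hence "poly (g - X * K\<^sup>2) r = poly ([:-x1, 1:] * [:-x2, 1:]) r" by (rule arg_cong)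
  hence gr: "poly g r = (x1 - r) * (x2 - r)" by (simp add: X_def algebra_simps)
  hence "x1 \<noteq> r" "x2 \<noteq> r" using pderiv_f_root(2)[OF r] d by auto
  thus ?thesis by (simp add: delta_def d gr power2_eq_square)
qed

text \<open>If no abscissa equals \<open>r\<close>, evaluating the factorization of
  \<open>f - L^2\<close> at \<open>r\<close> exhibits the product as \<open>(poly L r)^2\<close>;
  otherwise a permutation reduces to \<open>tri_delta_root\<close>.\<close>

lemma tri_delta:
  assumes r: "r \<in> {e1, e2, e3}" and t: "tri f x1 y1 x2 y2 x3 y3"
  shows "\<exists>s. delta r x1 * delta r x2 * delta r x3 = s\<^sup>2"
proof -
  consider "x1 = r" | "x2 = r" | "x3 = r" | "x1 \<noteq> r" "x2 \<noteq> r" "x3 \<noteq> r" by blast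
  then show ?thesis
  proof cases
    case 1
    have "tri f x3 y3 x2 y2 r y1" using t 1 tri_swap12 tri_swap23 by blast
    from tri_delta_root[OF r this] show ?thesis using 1 by (metis mult.commute mult.assoc)
  next
    case 2
    have "tri f x1 y1 x3 y3 r y2" using t 2 tri_swap23 by blast
    from tri_delta_root[OF r this] show ?thesis using 2 by (metis mult.commute mult.assoc)
  next
    case 3
    then show ?thesis using tri_delta_root[OF r] t by blast
  next
    case 4
    obtain L where f': "f - L\<^sup>2 = [:-x1, 1:] * [:-x2, 1:] * [:-x3, 1:]"
      using t unfolding tri_def by blast
    have "poly (f - L\<^sup>2) r = poly ([:-x1, 1:] * [:-x2, 1:] * [:-x3, 1:]) r" by (simp only: f')
    hence "- (poly L r)\<^sup>2 = (r - x1) * (r - x2) * (r - x3)"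
      using pderiv_f_root(1)[OF r] by (simp only: poly_diff poly_mult poly_power) simp
    hence "(x1 - r) * (x2 - r) * (x3 - r) = (poly L r)\<^sup>2" by Groebner_Basis.algebra
    then show ?thesis using 4 unfolding delta_def by auto
  qed
qed

fun delta_point :: "'a \<Rightarrow> 'a point \<Rightarrow> 'a" where
  "delta_point r Infinity = 1"
| "delta_point r (Affine x y) = delta r x"

lemma delta_point_nonzero: "r \<in> {e1, e2, e3} \<Longrightarrow> delta_point r P \<noteq> 0"
  by (cases P) (simp_all add: delta_nonzero)

text \<open>The homomorphism property modulo squares, phrased through a product of three classes so
  that the quotient group never has to be formed.\<close>

lemma delta_point_add:
  assumes r: "r \<in> {e1, e2, e3}" and on: "on_curve E P" "on_curve E Q"
  shows "\<exists>s. delta_point r P * delta_point r Q * delta_point r (point_add E P Q) = s\<^sup>2"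
proof (cases "P = Infinity \<or> Q = Infinity")
  case True
  then show ?thesis by (auto simp: power2_eq_square)
next
  case False
  then obtain x1 y1 x2 y2 where PQ: "P = Affine x1 y1" "Q = Affine x2 y2" by (metis point.exhaust)
  show ?thesis
  proof (cases "x1 = x2 \<and> y1 + y2 = 0")
    case True
    then show ?thesis using PQ by (auto simp: power2_eq_square)
  next
    case False
    then obtain x y where "point_add E P Q = Affine x y" "tri f x1 y1 x2 y2 x (- y)"
      using add_tri on PQ by blast
    then show ?thesis using tri_delta[OF r] PQ by (metis delta_point.simps(2))
  qed
qed

text \<open>If \<open>\<sigma>1, \<sigma>2, \<sigma>3\<close> are the elementary symmetric functions of \<open>s1, s2, s3\<close> and \<open>z = X - x\<close>, then
  \<open>(z + s1\<^sup>2) (z + s2\<^sup>2) (z + s3\<^sup>2) = z (z - \<sigma>2)\<^sup>2 + (\<sigma>3 - \<sigma>1 z)\<^sup>2\<close>, which exhibits a line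
  tangent at \<open>z = \<sigma>2\<close>.\<close>

lemma halving_aux:
  assumes "x - e1 = s1\<^sup>2" "x - e2 = s2\<^sup>2" "x - e3 = s3\<^sup>2" "s1 * s2 * s3 = - y"
  shows "\<exists>R. on_curve E R \<and> point_add E R R = Affine x y"
proof -
  define t1 t2 t3 where "t1 = s1 + s2 + s3" and "t2 = s1 * s2 + s1 * s3 + s2 * s3" and "t3 = s1 * s2 * s3"
  define u v where "u = x + t2" and "v = t3 - t1 * t2"
  define L where "L = [:t3 + t1 * x, - t1:]"
  have e: "e1 = x - s1\<^sup>2" "e2 = x - s2\<^sup>2" "e3 = x - s3\<^sup>2" using assms by (simp_all add: algebra_simps)
  have "t3 = - y" using assms(4) by (simp add: t3_def)
  hence L: "poly L u = v" "poly L x = - y" "degree L \<le> 1"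
    by (simp_all add: L_def u_def v_def algebra_simps)
  have "f - L\<^sup>2 = [:-u, 1:] * [:-u, 1:] * [:-x, 1:]"
    unfolding f_def unfolding e L_def u_def t1_def t2_def t3_def
    by (simp add: power2_eq_square algebra_simps)
  hence t: "tri f u v u v x (- y)" unfolding tri_def using L by blast
  have v: "v = - ((s1 + s2) * (s1 + s3) * (s2 + s3))"
    by (simp add: v_def t1_def t2_def t3_def algebra_simps)
  have "s1 + s2 \<noteq> 0" "s1 + s3 \<noteq> 0" "s2 + s3 \<noteq> 0"
    using distinct e by (auto simp: add_eq_0_iff)
  hence "v \<noteq> 0" by (simp add: v)
  hence "\<not> (u = u \<and> v + v = 0)" by simp
  from tri_add[OF t this] have "point_add E (Affine u v) (Affine u v) = Affine x y" by simp
  moreover have "on_curve E (Affine u v)" using t tri_swap23 tri_on_curve by blast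
  ultimately show ?thesis by blast
qed

text \<open>The product of the three roots is determined up to sign by the curve equation; flipping
  the sign of \<open>s1\<close> arranges the value \<open>- y\<close>.\<close>

lemma halving:
  assumes "on_curve E (Affine x y)" "x - e1 = s1\<^sup>2" "x - e2 = s2\<^sup>2" "x - e3 = s3\<^sup>2"
  shows "\<exists>R. on_curve E R \<and> point_add E R R = Affine x y"
proof -
  have "y\<^sup>2 = (s1 * s2 * s3)\<^sup>2"
    using assms by (simp only: on_curve_iff) (simp add: power_mult_distrib)
  hence "s1 * s2 * s3 = - y \<or> (- s1) * s2 * s3 = - y" by (auto simp: power2_eq_iff)
  then show ?thesis using halving_aux[of x s1 s2 s3 y] halving_aux[of x "- s1" s2 s3 y] assms by auto
qed

text \<open>The curve equation makes the third factor a square once two classes are trivial. At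
  \<open>x = e1\<close> or \<open>x = e2\<close> one factor is 0, itself a square, and the
  derivative value of \<open>delta\<close> supplies the missing one.\<close>

lemma delta_squares_imp_double:
  assumes on: "on_curve E P" and s: "delta_point e1 P = s1\<^sup>2" "delta_point e2 P = s2\<^sup>2"
  shows "\<exists>R. on_curve E R \<and> P = point_add E R R"
proof (cases P)
  case Infinity
  then show ?thesis by (intro exI[of _ Infinity]) simp
next
  case (Affine x y)
  have y2: "y\<^sup>2 = (x - e1) * (x - e2) * (x - e3)" using on Affine on_curve_iff by blast
  have s1: "delta e1 x = s1\<^sup>2" and s2: "delta e2 x = s2\<^sup>2" using s Affine by simp_all
  have nz: "s1 \<noteq> 0" "s2 \<noteq> 0" using s1 s2 delta_nonzero[of e1 x] delta_nonzero[of e2 x] by auto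
  have "\<exists>u1 u2 u3. x - e1 = u1\<^sup>2 \<and> x - e2 = u2\<^sup>2 \<and> x - e3 = u3\<^sup>2"
  proof -
    consider "x = e1" | "x = e2" | "x \<noteq> e1" "x \<noteq> e2" by blast
    then show ?thesis
    proof cases
      case 1
      have "x - e2 = s2\<^sup>2" using s2 1 distinct by (simp add: delta_def)
      moreover have "(x - e2) * (x - e3) = s1\<^sup>2" using s1 1 by (simp add: delta_def pderiv_f)
      ultimately have "x - e3 = (s1 / s2)\<^sup>2" using nz by (simp add: field_simps)
      with \<open>x - e2 = s2\<^sup>2\<close> 1 show ?thesis by (metis diff_self zero_power2)
    next
      case 2
      have "x - e1 = s1\<^sup>2" using s1 2 distinct by (simp add: delta_def)
      moreover have "(x - e1) * (x - e3) = s2\<^sup>2" using s2 2 by (simp add: delta_def pderiv_f)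
      ultimately have "x - e3 = (s2 / s1)\<^sup>2" using nz by (simp add: field_simps)
      with \<open>x - e1 = s1\<^sup>2\<close> 2 show ?thesis by (metis diff_self zero_power2)
    next
      case 3
      have "x - e1 = s1\<^sup>2" "x - e2 = s2\<^sup>2" using s1 s2 3 by (simp_all add: delta_def)
      moreover have "x - e3 = (y / (s1 * s2))\<^sup>2"
        using y2 nz unfolding \<open>x - e1 = s1\<^sup>2\<close> \<open>x - e2 = s2\<^sup>2\<close> by (simp add: power_divide power_mult_distrib)
      ultimately show ?thesis by blast
    qed
  qed
  then show ?thesis using halving on Affine by metis
qed

text \<open>Shifting the duplication formula by each root makes every numerator a perfect square;
  these squares control both the heights and the 2-adic denominators.\<close>

lemma double_x:
  assumes on: "on_curve E (Affine x y)" and y: "y \<noteq> 0"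
  shows "\<exists>X Y. point_add E (Affine x y) (Affine x y) = Affine X Y \<and>
    (X - e1) * (4 * y\<^sup>2) = ((x - e1)\<^sup>2 - (e1 - e2) * (e1 - e3))\<^sup>2 \<and>
    (X - e2) * (4 * y\<^sup>2) = ((x - e2)\<^sup>2 - (e2 - e1) * (e2 - e3))\<^sup>2 \<and>
    (X - e3) * (4 * y\<^sup>2) = ((x - e3)\<^sup>2 - (e3 - e1) * (e3 - e2))\<^sup>2"
proof -
  define l where "l = (3 * x\<^sup>2 + 2 * (- (e1 + e2 + e3)) * x + (e1 * e2 + e1 * e3 + e2 * e3)) / (2 * y)"
  define X where "X = l\<^sup>2 + (e1 + e2 + e3) - x - x"
  have y2: "y\<^sup>2 = (x - e1) * (x - e2) * (x - e3)" using on on_curve_iff by blast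
  have l: "l * (2 * y) = 3 * x\<^sup>2 + 2 * (- (e1 + e2 + e3)) * x + (e1 * e2 + e1 * e3 + e2 * e3)"
    using y by (simp add: l_def)
  have "\<exists>Y. point_add E (Affine x y) (Affine x y) = Affine X Y"
    using y by (simp add: Let_def X_def l_def)
  moreover have "(X - e1) * (4 * y\<^sup>2) = ((x - e1)\<^sup>2 - (e1 - e2) * (e1 - e3))\<^sup>2"
    "(X - e2) * (4 * y\<^sup>2) = ((x - e2)\<^sup>2 - (e2 - e1) * (e2 - e3))\<^sup>2"
    "(X - e3) * (4 * y\<^sup>2) = ((x - e3)\<^sup>2 - (e3 - e1) * (e3 - e2))\<^sup>2"
    using l y2 unfolding X_def by Groebner_Basis.algebra+
  ultimately show ?thesis by blast
qed

text \<open>Both curve equations have been used to remove the cubic terms, so that for a fixed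
  second point the right-hand side is quadratic in \<open>x\<close> apart from the term in
  \<open>y\<close>. This yields a bound quadratic in the height.\<close>

lemma add_x:
  assumes on: "on_curve E (Affine x y)" "on_curve E (Affine x0 y0)" and x: "x \<noteq> x0"
  shows "\<exists>X Y. point_add E (Affine x y) (Affine x0 y0) = Affine X Y \<and>
    X * (x - x0)\<^sup>2 = x\<^sup>2 * x0 + x * x0\<^sup>2 - 2 * (e1 + e2 + e3) * x * x0
      + (e1 * e2 + e1 * e3 + e2 * e3) * (x + x0) - 2 * (e1 * e2 * e3) - 2 * y * y0"
proof -
  define l where "l = (y0 - y) / (x0 - x)"
  define X where "X = l\<^sup>2 + (e1 + e2 + e3) - x - x0"
  have y2: "y\<^sup>2 = (x - e1) * (x - e2) * (x - e3)" "y0\<^sup>2 = (x0 - e1) * (x0 - e2) * (x0 - e3)"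
    using on on_curve_iff by blast+
  have l: "l * (x0 - x) = y0 - y" using x by (simp add: l_def)
  have "\<exists>Y. point_add E (Affine x y) (Affine x0 y0) = Affine X Y"
    using x by (simp add: Let_def X_def l_def)
  moreover have "X * (x - x0)\<^sup>2 = x\<^sup>2 * x0 + x * x0\<^sup>2 - 2 * (e1 + e2 + e3) * x * x0
      + (e1 * e2 + e1 * e3 + e2 * e3) * (x + x0) - 2 * (e1 * e2 * e3) - 2 * y * y0"
    using l y2 unfolding X_def by Groebner_Basis.algebra
  ultimately show ?thesis by blast
qed

end

section \<open>Heights\<close>

text \<open>The exponential naive height: without logarithms the descent inequalities remain
  polynomial inequalities between integers.\<close>

definition rat_height :: "rat \<Rightarrow> int" where
  "rat_height x = max \<bar>fst (quotient_of x)\<bar> (snd (quotient_of x))"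

lemma rat_quotient:
  fixes x :: rat
  obtains p q where "x = of_int p / of_int q" "q > 0" "coprime p q" "rat_height x = max \<bar>p\<bar> q"
proof -
  obtain p q where pq: "quotient_of x = (p, q)" by fastforce
  show ?thesis
    using that[of p q] quotient_of_div[OF pq] quotient_of_denom_pos[OF pq] quotient_of_coprime[OF pq] pq
    by (simp add: rat_height_def)
qed

lemma rat_height_pos: "rat_height x \<ge> 1"
  by (rule rat_quotient[of x]) auto

text \<open>Passing to lowest terms divides numerator and denominator by a common nonzero integer,
  so any representation bounds the height.\<close>

lemma rat_height_le:
  assumes "x = of_int N / of_int D" "D \<noteq> 0" "\<bar>N\<bar> \<le> B" "\<bar>D\<bar> \<le> B"
  shows "rat_height x \<le> B"
proof -
  obtain p q where pq: "x = of_int p / of_int q" "q > 0" "coprime p q" "rat_height x = max \<bar>p\<bar> q"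
    by (rule rat_quotient)
  have "of_int (p * D) = (of_int (N * q) :: rat)"
    using pq assms by (simp add: field_simps)
  hence eq: "p * D = N * q" by (simp only: of_int_eq_iff)
  hence "q dvd p * D" by simp
  hence "q dvd D" using pq(3) by (simp add: coprime_commute coprime_dvd_mult_right_iff)
  then obtain t where t: "D = q * t" by blast
  hence N: "N = p * t" using eq pq(2) by simp
  have "t \<noteq> 0" using t assms(2) by auto
  hence "1 \<le> \<bar>t\<bar>" by simp
  hence "\<bar>p\<bar> \<le> \<bar>p\<bar> * \<bar>t\<bar>" "q \<le> q * \<bar>t\<bar>" using pq(2) by (simp_all add: mult_le_cancel_left1)
  moreover have "\<bar>N\<bar> = \<bar>p\<bar> * \<bar>t\<bar>" "\<bar>D\<bar> = q * \<bar>t\<bar>" using t N pq(2) by (simp_all add: abs_mult)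
  ultimately show ?thesis unfolding pq(4) using assms(3,4) by (intro max.boundedI) linarith+
qed

lemma finite_rat_height: "finite {x. rat_height x \<le> B}"
proof (rule finite_subset)
  show "{x. rat_height x \<le> B} \<subseteq> (\<lambda>(p, q). of_int p / of_int q) ` ({-B..B} \<times> {-B..B})"
  proof
    fix x assume "x \<in> {x. rat_height x \<le> B}"
    moreover obtain p q where "x = of_int p / of_int q" "q > 0" "rat_height x = max \<bar>p\<bar> q"
      by (rule rat_quotient)
    ultimately show "x \<in> (\<lambda>(p, q). of_int p / of_int q) ` ({-B..B} \<times> {-B..B})"
      by (intro image_eqI[of _ _ "(p, q)"]) auto
  qed
qed simp

lemma rat_square_int:
  fixes t :: rat
  assumes "t\<^sup>2 = of_int W"
  obtains Y where "t = of_int Y" "Y\<^sup>2 = W"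
proof -
  obtain p q where pq: "t = of_int p / of_int q" "q > 0" "coprime p q" by (rule rat_quotient)
  have "of_int (p\<^sup>2) = (of_int (W * q\<^sup>2) :: rat)"
    using assms pq by (simp add: power_divide field_simps)
  hence eq: "p\<^sup>2 = W * q\<^sup>2" by (simp only: of_int_eq_iff)
  hence "q\<^sup>2 dvd p\<^sup>2" by simp
  moreover have "coprime (p\<^sup>2) (q\<^sup>2)" using pq(3) by simp
  ultimately have "is_unit (q\<^sup>2)" by (metis coprime_common_divisor dvd_refl)
  hence "q = 1" using pq(2) by (auto simp: is_unit_power_iff power2_eq_1_iff)
  thus ?thesis using that[of p] pq eq by simp
qed

section \<open>Height inequalities for doubling and for adding a fixed point\<close>

locale integral_cubic =
  fixes c1 c2 c3 :: int
  assumes distinct_c: "c1 \<noteq> c2" "c1 \<noteq> c3" "c2 \<noteq> c3"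

sublocale integral_cubic \<subseteq> split_cubic "of_int c1 :: rat" "of_int c2" "of_int c3"
  by unfold_locales (use distinct_c in simp_all)

context integral_cubic
begin

fun height :: "rat point \<Rightarrow> int" where
  "height Infinity = 1"
| "height (Affine x y) = rat_height x"

lemma height_pos: "height P \<ge> 1"
  by (cases P) (simp_all add: rat_height_pos)

lemma finite_height: "finite {P. on_curve E P \<and> height P \<le> B}"
proof -
  have fin: "finite {y::rat. y\<^sup>2 = k}" for k
  proof (cases "\<exists>y. y\<^sup>2 = k")
    case True
    then obtain y where "y\<^sup>2 = k" by blast
    hence "{y. y\<^sup>2 = k} \<subseteq> {y, - y}" by (auto simp: power2_eq_iff)
    thus ?thesis using finite_subset by blast
  qed simp
  have "{P. on_curve E P \<and> height P \<le> B} \<subseteq>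
     insert Infinity (\<Union>x\<in>{x. rat_height x \<le> B}. Affine x ` {y. y\<^sup>2 = poly f x})"
  proof
    fix P assume P: "P \<in> {P. on_curve E P \<and> height P \<le> B}"
    show "P \<in> insert Infinity (\<Union>x\<in>{x. rat_height x \<le> B}. Affine x ` {y. y\<^sup>2 = poly f x})"
      using P on_curve_poly by (cases P) auto
  qed
  thus ?thesis by (rule finite_subset) (use fin finite_rat_height in blast)
qed

text \<open>The three squares in the duplication formula span the quadratic forms in \<open>p, q\<close> up to
  the denominator \<open>2 (c1 - c2) (c1 - c3) (c2 - c3)\<close>.\<close>

lemma duplication_forms:
  fixes p q :: int
  defines "N1 \<equiv> (p - c1 * q)\<^sup>2 - (c1 - c2) * (c1 - c3) * q\<^sup>2"
    and "N2 \<equiv> (p - c2 * q)\<^sup>2 - (c2 - c1) * (c2 - c3) * q\<^sup>2"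
    and "N3 \<equiv> (p - c3 * q)\<^sup>2 - (c3 - c1) * (c3 - c2) * q\<^sup>2"
    and "D \<equiv> 2 * (c1 - c2) * (c1 - c3) * (c2 - c3)"
    and "k \<equiv> c1 * c2 + c1 * c3 - c2 * c3"
    and "\<alpha>1 \<equiv> c3 - c2" and "\<alpha>2 \<equiv> c1 - c3" and "\<alpha>3 \<equiv> c2 - c1"
    and "\<gamma>1 \<equiv> c3 * (c3 - c2) - (c1 - c3) * (c2 - c3)"
    and "\<gamma>2 \<equiv> c3 * (c1 - c3) + (c1 - c3) * (c2 - c3)" and "\<gamma>3 \<equiv> c3 * (c2 - c1)"
  shows "D * q\<^sup>2 = \<alpha>1 * N1 + \<alpha>2 * N2 + \<alpha>3 * N3"
    and "D * p\<^sup>2 = (D + 2 * c1 * \<gamma>1 - k * \<alpha>1) * N1 + (2 * c1 * \<gamma>2 - k * \<alpha>2) * N2 + (2 * c1 * \<gamma>3 - k * \<alpha>3) * N3"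
  unfolding assms by Groebner_Basis.algebra+

lemma sum3_square_le: "(a + b + c)\<^sup>2 \<le> 3 * (a\<^sup>2 + b\<^sup>2 + (c::int)\<^sup>2)"
proof -
  have "0 \<le> (a - b)\<^sup>2 + (a - c)\<^sup>2 + (b - c)\<^sup>2" by simp
  thus ?thesis by (simp add: power2_eq_square algebra_simps)
qed

text \<open>Squares are used because only the squares of the duplication forms are known to be
  small. The factor \<open>D^2\<close> that bounds the cancellation drops out against the
  denominator \<open>D\<close> of the linear combination.\<close>

lemma combination_bound:
  fixes D :: int
  assumes "D * u = m1 * N1 + m2 * N2 + m3 * N3"
    and "N1\<^sup>2 \<le> D\<^sup>2 * (k1 * h)" "N2\<^sup>2 \<le> D\<^sup>2 * (k2 * h)" "N3\<^sup>2 \<le> D\<^sup>2 * (k3 * h)" "D \<noteq> 0"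
  shows "u\<^sup>2 \<le> 3 * (m1\<^sup>2 * k1 + m2\<^sup>2 * k2 + m3\<^sup>2 * k3) * h"
proof -
  have "D\<^sup>2 * u\<^sup>2 = (m1 * N1 + m2 * N2 + m3 * N3)\<^sup>2" using assms(1) by (metis power_mult_distrib)
  also have "\<dots> \<le> 3 * ((m1 * N1)\<^sup>2 + (m2 * N2)\<^sup>2 + (m3 * N3)\<^sup>2)" by (rule sum3_square_le)
  also have "\<dots> = 3 * (m1\<^sup>2 * N1\<^sup>2 + m2\<^sup>2 * N2\<^sup>2 + m3\<^sup>2 * N3\<^sup>2)" by (simp add: power_mult_distrib)
  also have "\<dots> \<le> 3 * (m1\<^sup>2 * (D\<^sup>2 * (k1 * h)) + m2\<^sup>2 * (D\<^sup>2 * (k2 * h)) + m3\<^sup>2 * (D\<^sup>2 * (k3 * h)))"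
    using assms(2-4) by (intro mult_left_mono add_mono) auto
  also have "\<dots> = D\<^sup>2 * (3 * (m1\<^sup>2 * k1 + m2\<^sup>2 * k2 + m3\<^sup>2 * k3) * h)" by (simp add: algebra_simps)
  finally show ?thesis using assms(5) by (simp add: mult_le_cancel_left)
qed

text \<open>\<open>double_x\<close> multiplied by \<open>q^4\<close>: the factor
  \<open>4 * q * (p - c1 * q) * (p - c2 * q) * (p - c3 * q)\<close> is
  \<open>4 * y^2 * q^4\<close>.\<close>

lemma double_int:
  assumes on: "on_curve E (Affine x y)" and y: "y \<noteq> 0"
    and x: "x = of_int p / of_int q" "q \<noteq> 0"
  shows "\<exists>r s Y. s > 0 \<and> coprime r s \<and> rat_height (of_int r / of_int s) = max \<bar>r\<bar> s \<and>
    point_add E (Affine x y) (Affine x y) = Affine (of_int r / of_int s) Y \<and>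
    4 * q * (p - c1 * q) * (p - c2 * q) * (p - c3 * q) \<noteq> 0 \<and>
    (r - c1 * s) * (4 * q * (p - c1 * q) * (p - c2 * q) * (p - c3 * q)) =
      ((p - c1 * q)\<^sup>2 - (c1 - c2) * (c1 - c3) * q\<^sup>2)\<^sup>2 * s \<and>
    (r - c2 * s) * (4 * q * (p - c1 * q) * (p - c2 * q) * (p - c3 * q)) =
      ((p - c2 * q)\<^sup>2 - (c2 - c1) * (c2 - c3) * q\<^sup>2)\<^sup>2 * s \<and>
    (r - c3 * s) * (4 * q * (p - c1 * q) * (p - c2 * q) * (p - c3 * q)) =
      ((p - c3 * q)\<^sup>2 - (c3 - c1) * (c3 - c2) * q\<^sup>2)\<^sup>2 * s"
proof -
  obtain X Y where XY: "point_add E (Affine x y) (Affine x y) = Affine X Y"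
    and eqs: "(X - of_int c1) * (4 * y\<^sup>2) = ((x - of_int c1)\<^sup>2 - (of_int c1 - of_int c2) * (of_int c1 - of_int c3))\<^sup>2"
      "(X - of_int c2) * (4 * y\<^sup>2) = ((x - of_int c2)\<^sup>2 - (of_int c2 - of_int c1) * (of_int c2 - of_int c3))\<^sup>2"
      "(X - of_int c3) * (4 * y\<^sup>2) = ((x - of_int c3)\<^sup>2 - (of_int c3 - of_int c1) * (of_int c3 - of_int c2))\<^sup>2"
    using double_x[OF on y] by blast
  obtain r s where rs: "X = of_int r / of_int s" "s > 0" "coprime r s" "rat_height X = max \<bar>r\<bar> s"
    by (rule rat_quotient)
  define M where "M = 4 * q * (p - c1 * q) * (p - c2 * q) * (p - c3 * q)"
  define P Q R S :: rat where "P = of_int p" and "Q = of_int q" and "R = of_int r" and "S = of_int s"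
  have Q: "Q \<noteq> 0" "x * Q = P" using x by (simp_all add: P_def Q_def)
  have S: "S \<noteq> 0" "X * S = R" using rs by (simp_all add: R_def S_def)
  have y2: "y\<^sup>2 = (x - of_int c1) * (x - of_int c2) * (x - of_int c3)" using on on_curve_iff by blast
  have xc: "of_int (p - c * q) = Q * (x - of_int c)" for c
    using Q by (simp add: P_def Q_def algebra_simps)
  have Xc: "of_int (r - c * s) = S * (X - of_int c)" for c
    using S by (simp add: R_def S_def algebra_simps)
  have M: "of_int M = 4 * y\<^sup>2 * Q ^ 4"
    unfolding M_def of_int_mult xc y2 by (simp add: Q_def[symmetric] power4_eq_xxxx)
  have "of_int M \<noteq> (0::rat)" unfolding M using y Q by simp
  hence M0: "M \<noteq> 0" by simp
  have N: "of_int ((p - c * q)\<^sup>2 - (c - d) * (c - e) * q\<^sup>2) =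
     Q\<^sup>2 * ((x - of_int c)\<^sup>2 - (of_int c - of_int d) * (of_int c - of_int e))" for c d e
    unfolding of_int_diff[of "_\<^sup>2"] of_int_power xc of_int_mult
    by (simp add: Q_def[symmetric] power2_eq_square algebra_simps)
  have eq: "(r - c * s) * M = ((p - c * q)\<^sup>2 - (c - d) * (c - e) * q\<^sup>2)\<^sup>2 * s"
    if "(X - of_int c) * (4 * y\<^sup>2) = ((x - of_int c)\<^sup>2 - (of_int c - of_int d) * (of_int c - of_int e))\<^sup>2" for c d e
  proof -
    have "of_int ((r - c * s) * M) = S * Q ^ 4 * ((X - of_int c) * (4 * y\<^sup>2))"
      unfolding of_int_mult[of _ M] Xc M by simp
    also have "\<dots> = of_int (((p - c * q)\<^sup>2 - (c - d) * (c - e) * q\<^sup>2)\<^sup>2 * s)"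
      unfolding that of_int_mult[of _ s] of_int_power[of _ 2] N S_def
      by (simp add: power_mult_distrib flip: power_mult)
    finally show ?thesis by (simp only: of_int_eq_iff)
  qed
  show ?thesis
    using rs XY M0 eq[OF eqs(1)] eq[OF eqs(2)] eq[OF eqs(3)] unfolding M_def by blast
qed

text \<open>Numerator and denominator of the duplication formula are quartic forms in
  \<open>p, q\<close>. The height of the double can fall below their size only through cancellation,
  and the cancelled factor \<open>g\<close> divides the constant \<open>D^2\<close>.\<close>

lemma height_double:
  obtains K where "\<And>P. on_curve E P \<Longrightarrow> height P ^ 4 \<le> K * height (point_add E P P)"
proof -
  define D where "D = 2 * (c1 - c2) * (c1 - c3) * (c2 - c3)"
  define k where "k = c1 * c2 + c1 * c3 - c2 * c3"
  define \<gamma>1 \<gamma>2 \<gamma>3 where "\<gamma>1 = c3 * (c3 - c2) - (c1 - c3) * (c2 - c3)" and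
    "\<gamma>2 = c3 * (c1 - c3) + (c1 - c3) * (c2 - c3)" and "\<gamma>3 = c3 * (c2 - c1)"
  define b1 b2 b3 where "b1 = D + 2 * c1 * \<gamma>1 - k * (c3 - c2)" and "b2 = 2 * c1 * \<gamma>2 - k * (c1 - c3)"
    and "b3 = 2 * c1 * \<gamma>3 - k * (c2 - c1)"
  define k1 k2 k3 where "k1 = 1 + \<bar>c1\<bar>" and "k2 = 1 + \<bar>c2\<bar>" and "k3 = 1 + \<bar>c3\<bar>"
  define A where "A = 3 * ((c3 - c2)\<^sup>2 * k1 + (c1 - c3)\<^sup>2 * k2 + (c2 - c1)\<^sup>2 * k3)"
  define B where "B = 3 * (b1\<^sup>2 * k1 + b2\<^sup>2 * k2 + b3\<^sup>2 * k3)"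
  \<comment> \<open>Absorbs the points with \<open>y = 0\<close>, whose doubles have height
    1.\<close>
  define T where "T = rat_height (of_int c1) ^ 4 + rat_height (of_int c2) ^ 4 + rat_height (of_int c3) ^ 4"
  have kpos: "k1 \<ge> 0" "k2 \<ge> 0" "k3 \<ge> 0" by (simp_all add: k1_def k2_def k3_def)
  have A0: "A \<ge> 0" "B \<ge> 0" using kpos by (simp_all add: A_def B_def)
  have T0: "rat_height x ^ 4 \<ge> 0" for x by simp
  have D0: "D \<noteq> 0" using distinct_c by (simp add: D_def)
  have "height P ^ 4 \<le> (1 + A + B + T) * height (point_add E P P)" if on: "on_curve E P" for P
  proof (cases P)
    case Infinity
    then show ?thesis using A0 T0 by (simp add: T_def)
  next
    case (Affine x y)
    show ?thesis
    proof (cases "y = 0")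
      case True
      hence "x = of_int c1 \<or> x = of_int c2 \<or> x = of_int c3"
        using on unfolding Affine on_curve_iff True by simp
      hence "rat_height x ^ 4 \<le> T" using T0 unfolding T_def by (auto simp: add_nonneg_nonneg)
      then show ?thesis using Affine True A0 by simp
    next
      case False
      obtain p q where pq: "x = of_int p / of_int q" "q > 0" "coprime p q" "rat_height x = max \<bar>p\<bar> q"
        by (rule rat_quotient)
      define N1 N2 N3 where "N1 = (p - c1 * q)\<^sup>2 - (c1 - c2) * (c1 - c3) * q\<^sup>2"
        and "N2 = (p - c2 * q)\<^sup>2 - (c2 - c1) * (c2 - c3) * q\<^sup>2"
        and "N3 = (p - c3 * q)\<^sup>2 - (c3 - c1) * (c3 - c2) * q\<^sup>2"
      define M where "M = 4 * q * (p - c1 * q) * (p - c2 * q) * (p - c3 * q)"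
      obtain r s Y where rs: "s > 0" "coprime r s" "rat_height (of_int r / of_int s) = max \<bar>r\<bar> s"
        and dbl: "point_add E (Affine x y) (Affine x y) = Affine (of_int r / of_int s) Y"
        and M0: "M \<noteq> 0" and eqs: "(r - c1 * s) * M = N1\<^sup>2 * s" "(r - c2 * s) * M = N2\<^sup>2 * s" "(r - c3 * s) * M = N3\<^sup>2 * s"
        using double_int[OF _ False pq(1)] on Affine pq(2) unfolding M_def N1_def N2_def N3_def by blast
      define h where "h = max \<bar>r\<bar> s"
      have "s dvd (r - c1 * s) * M" using eqs(1) by simp
      moreover have "coprime s (r - c1 * s)"
      proof (rule coprimeI)
        fix t assume "t dvd s" "t dvd r - c1 * s"
        hence "t dvd s" "t dvd (r - c1 * s) + c1 * s" by (simp_all only: dvd_add dvd_mult)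
        thus "is_unit t" using rs(2) coprime_common_divisor[of r s t] by simp
      qed
      ultimately have "s dvd M" by (simp add: coprime_dvd_mult_right_iff)
      then obtain g where g: "M = s * g" by blast
      have g0: "g \<noteq> 0" using g M0 by auto
      have N: "N1\<^sup>2 = (r - c1 * s) * g" "N2\<^sup>2 = (r - c2 * s) * g" "N3\<^sup>2 = (r - c3 * s) * g"
      proof -
        have *: "U = (r - c * s) * g" if "(r - c * s) * M = U * s" for U c
        proof -
          have "s * U = s * ((r - c * s) * g)" using that unfolding g by (simp only: mult_ac)
          thus ?thesis using rs(1) by simp
        qed
        show "N1\<^sup>2 = (r - c1 * s) * g" "N2\<^sup>2 = (r - c2 * s) * g" "N3\<^sup>2 = (r - c3 * s) * g"
          by (rule *, rule eqs)+
      qed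
      \<comment> \<open>Divisibility of the squares passes to the mixed products because
        \<open>g^2\<close> divides \<open>(U * V)^2\<close>; hence \<open>g\<close> divides the
        square of every combination of the \<open>N\<close>'s.\<close>
      have gN: "g dvd U * V" if "g dvd U\<^sup>2" "g dvd V\<^sup>2" for U V :: int
      proof -
        have "g\<^sup>2 dvd (U * V)\<^sup>2"
          unfolding power2_eq_square[of g] power_mult_distrib by (rule mult_dvd_mono[OF that])
        thus ?thesis by (simp add: pow_divides_pow_iff)
      qed
      have gs: "g dvd (m1 * N1 + m2 * N2 + m3 * N3)\<^sup>2" for m1 m2 m3
      proof -
        have "(m1 * N1 + m2 * N2 + m3 * N3)\<^sup>2 = m1\<^sup>2 * (N1 * N1) + m2\<^sup>2 * (N2 * N2) + m3\<^sup>2 * (N3 * N3)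
          + 2 * m1 * m2 * (N1 * N2) + 2 * m1 * m3 * (N1 * N3) + 2 * m2 * m3 * (N2 * N3)"
          by (simp add: power2_eq_square algebra_simps)
        moreover have "g dvd N1\<^sup>2" "g dvd N2\<^sup>2" "g dvd N3\<^sup>2" using N by simp_all
        ultimately show ?thesis using gN by (simp add: dvd_add dvd_mult)
      qed
      have Dq: "D * q\<^sup>2 = (c3 - c2) * N1 + (c1 - c3) * N2 + (c2 - c1) * N3"
        unfolding D_def N1_def N2_def N3_def by (rule duplication_forms(1))
      have Dp: "D * p\<^sup>2 = b1 * N1 + b2 * N2 + b3 * N3"
        unfolding b1_def b2_def b3_def \<gamma>1_def \<gamma>2_def \<gamma>3_def k_def D_def N1_def N2_def N3_def
        by (rule duplication_forms(2))
      \<comment> \<open>The forms generate \<open>D * q^2\<close> and \<open>D * p^2\<close>, and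
        \<open>p\<close>, \<open>q\<close> are coprime, so only divisors of \<open>D^2\<close> can
        be cancelled.\<close>
      have "g dvd (D * q\<^sup>2)\<^sup>2" "g dvd (D * p\<^sup>2)\<^sup>2" unfolding Dq Dp by (rule gs)+
      hence "g dvd gcd (D\<^sup>2 * (q\<^sup>2)\<^sup>2) (D\<^sup>2 * (p\<^sup>2)\<^sup>2)" by (simp add: power_mult_distrib)
      also have "\<dots> = D\<^sup>2 * gcd ((q\<^sup>2)\<^sup>2) ((p\<^sup>2)\<^sup>2)" by (subst gcd_mult_left) simp
      also have "gcd ((q\<^sup>2)\<^sup>2) ((p\<^sup>2)\<^sup>2) = 1"
        using pq(3) by (simp add: coprime_commute flip: coprime_iff_gcd_eq_1)
      finally have "g dvd D\<^sup>2" by simp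
      hence gD: "\<bar>g\<bar> \<le> D\<^sup>2" using dvd_imp_le_int[of "D\<^sup>2" g] D0 by simp
      have Nb: "U\<^sup>2 \<le> D\<^sup>2 * ((1 + \<bar>c\<bar>) * h)" if "U\<^sup>2 = (r - c * s) * g" for U c :: int
      proof -
        have "\<bar>r - c * s\<bar> \<le> \<bar>r\<bar> + \<bar>c\<bar> * s" using rs(1) by (simp add: abs_mult abs_triangle_ineq4 order_trans[OF abs_triangle_ineq4])
        also have "\<dots> \<le> h + \<bar>c\<bar> * h" by (intro add_mono mult_left_mono) (auto simp: h_def)
        finally have "\<bar>r - c * s\<bar> \<le> (1 + \<bar>c\<bar>) * h" by (simp add: algebra_simps)
        hence "\<bar>g\<bar> * \<bar>r - c * s\<bar> \<le> D\<^sup>2 * ((1 + \<bar>c\<bar>) * h)" using gD by (intro mult_mono) auto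
        moreover have "U\<^sup>2 = \<bar>g\<bar> * \<bar>r - c * s\<bar>" using that by (metis abs_mult abs_power2 mult.commute)
        ultimately show ?thesis by simp
      qed
      have "(q\<^sup>2)\<^sup>2 \<le> A * h" unfolding A_def k1_def k2_def k3_def
        by (rule combination_bound[OF Dq Nb[OF N(1)] Nb[OF N(2)] Nb[OF N(3)] D0])
      moreover have "(p\<^sup>2)\<^sup>2 \<le> B * h" unfolding B_def k1_def k2_def k3_def
        by (rule combination_bound[OF Dp Nb[OF N(1)] Nb[OF N(2)] Nb[OF N(3)] D0])
      moreover have "h \<ge> 0" using rs(1) by (simp add: h_def)
      hence "A * h \<ge> 0" "B * h \<ge> 0" "(1 + T) * h \<ge> 0" using A0 by (simp_all add: T_def)
      moreover have "(max \<bar>p\<bar> q) ^ 4 \<le> (q\<^sup>2)\<^sup>2 + (p\<^sup>2)\<^sup>2"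
        by (simp add: max_def flip: power_mult)
      ultimately have "(max \<bar>p\<bar> q) ^ 4 \<le> (1 + A + B + T) * h" by (simp add: algebra_simps)
      then show ?thesis using Affine dbl rs(3) pq(4) by (simp add: h_def)
    qed
  qed
  thus ?thesis using that by blast
qed

lemma height_add:
  assumes Q: "on_curve E Q"
  obtains K where "\<And>P. on_curve E P \<Longrightarrow> height (point_add E P Q) \<le> K * (height P)\<^sup>2"
proof (cases Q)
  case Infinity
  have "height P \<le> 1 * (height P)\<^sup>2" for P
    using height_pos[of P] by (simp add: power2_eq_square)
  then show ?thesis using that[of 1] Infinity by simp
next
  case (Affine x0 y0)
  obtain a b where ab: "x0 = of_int a / of_int b" "b > 0" by (rule rat_quotient)
  obtain c d where cd: "y0 = of_int c / of_int d" "d > 0" by (rule rat_quotient)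
  define s1 s2 s3 where "s1 = c1 + c2 + c3" and "s2 = c1 * c2 + c1 * c3 + c2 * c3" and "s3 = c1 * c2 * c3"
  define w where "w = (1 + \<bar>c1\<bar>) * (1 + \<bar>c2\<bar>) * (1 + \<bar>c3\<bar>)"
  \<comment> \<open>Coefficients of \<open>p^2\<close>, \<open>p * q\<close>, \<open>q^2\<close> and
    of minus the integer \<open>Z = y * q^2\<close> in the numerator of \<open>add_x\<close>, after
    multiplication by \<open>q^2 * b^2 * d\<close>.\<close>
  define A1 A2 A3 A4 where "A1 = a * b * d" and "A2 = a\<^sup>2 * d - 2 * s1 * a * b * d + s2 * b\<^sup>2 * d"
    and "A3 = s2 * a * b * d - 2 * s3 * b\<^sup>2 * d" and "A4 = 2 * c * b\<^sup>2"
  define K1 where "K1 = \<bar>A1\<bar> + \<bar>A2\<bar> + \<bar>A3\<bar> + \<bar>A4\<bar> * w"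
  define K2 where "K2 = (b + \<bar>a\<bar>)\<^sup>2 * d"
  \<comment> \<open>Covers the cases outside \<open>add_x\<close>: the first point is
    \<open>Infinity\<close>, \<open>Q\<close> or the opposite of \<open>Q\<close>.\<close>
  define K3 where "K3 = height Q + height (point_add E Q Q) + 1"
  have "1 * 1 * 1 \<le> w" unfolding w_def by (intro mult_mono) auto
  hence w1: "w \<ge> 1" by simp
  have K0: "K1 \<ge> 0" "K2 \<ge> 0" "K3 \<ge> 0" using w1 cd height_pos[of Q] height_pos[of "point_add E Q Q"]
    by (simp_all add: K1_def K2_def K3_def)
  have "height (point_add E P Q) \<le> (K1 + K2 + K3) * (height P)\<^sup>2" if on: "on_curve E P" for P
  proof -
    have hP: "(height P)\<^sup>2 \<ge> 1" using height_pos[of P] by (simp add: one_le_power)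
    have small: ?thesis if "height (point_add E P Q) \<le> K3"
    proof -
      have "K3 * 1 \<le> (K1 + K2 + K3) * (height P)\<^sup>2" using K0 hP by (intro mult_mono) auto
      thus ?thesis using that by simp
    qed
    show ?thesis
    proof (cases P)
      case Infinity
      then show ?thesis using height_pos[of "point_add E Q Q"] by (intro small) (simp add: K3_def)
    next
      case P: (Affine x y)
      show ?thesis
      proof (cases "x = x0")
        case True
        hence "y\<^sup>2 = y0\<^sup>2" using on Q P Affine on_curve_poly by metis
        hence "y = y0 \<or> y = - y0" by (simp add: power2_eq_iff)
        hence "P = Q \<or> point_add E P Q = Infinity" using True P Affine by auto
        thus ?thesis using height_pos[of Q] height_pos[of "point_add E Q Q"]
          by (intro small) (auto simp: K3_def)
      next
        case False
        obtain X Y where XY: "point_add E P Q = Affine X Y" and X: "X * (x - x0)\<^sup>2 = x\<^sup>2 * x0 + x * x0\<^sup>2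
            - 2 * (of_int c1 + of_int c2 + of_int c3) * x * x0
            + (of_int c1 * of_int c2 + of_int c1 * of_int c3 + of_int c2 * of_int c3) * (x + x0)
            - 2 * (of_int c1 * of_int c2 * of_int c3) - 2 * y * y0"
          using add_x[of x y x0 y0] on Q P Affine False by blast
        obtain p q where pq: "x = of_int p / of_int q" "q > 0" "rat_height x = max \<bar>p\<bar> q" by (rule rat_quotient)
        define h where "h = max \<bar>p\<bar> q"
        have h: "\<bar>p\<bar> \<le> h" "\<bar>q\<bar> \<le> h" "h \<ge> 0" using pq(2) by (auto simp: h_def)
        have y2: "y\<^sup>2 = (x - of_int c1) * (x - of_int c2) * (x - of_int c3)" using on P on_curve_iff by blast
        have xc: "x - of_int c = of_int (p - c * q) / of_int q" for c
          using pq(1,2) by (simp add: field_simps)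
        \<comment> \<open>The ordinate is tamed through \<open>W\<close>: \<open>y * q^2\<close> is
          a rational square root of an integer, hence an integer, of size at most a constant times
          \<open>h^2\<close>.\<close>
        define W where "W = q * ((p - c1 * q) * (p - c2 * q) * (p - c3 * q))"
        have "(y * (of_int q)\<^sup>2)\<^sup>2 = of_int W"
          unfolding power_mult_distrib y2 xc W_def using pq(2)
          by (simp add: power2_eq_square)
        then obtain Z where Z: "y * (of_int q)\<^sup>2 = of_int Z" "Z\<^sup>2 = W" by (rule rat_square_int)
        have pc: "\<bar>p - c * q\<bar> \<le> (1 + \<bar>c\<bar>) * h" for c
        proof -
          have "\<bar>p - c * q\<bar> \<le> \<bar>p\<bar> + \<bar>c\<bar> * \<bar>q\<bar>" by (metis abs_mult abs_triangle_ineq4)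
          also have "\<dots> \<le> h + \<bar>c\<bar> * h" using h by (intro add_mono mult_left_mono) auto
          finally show ?thesis by (simp add: algebra_simps)
        qed
        have "\<bar>W\<bar> \<le> h * (((1 + \<bar>c1\<bar>) * h) * ((1 + \<bar>c2\<bar>) * h) * ((1 + \<bar>c3\<bar>) * h))"
          unfolding W_def abs_mult using h pc by (intro mult_mono) (auto intro!: mult_nonneg_nonneg)
        also have "\<dots> = w * (h\<^sup>2)\<^sup>2" by (simp add: w_def power2_eq_square)
        \<comment> \<open>Replacing \<open>w\<close> by \<open>w^2\<close>, possible since
          \<open>w\<close> is at least 1, makes the bound a perfect square whose root can be taken
          in the integers.\<close>
        also have "\<dots> \<le> w\<^sup>2 * (h\<^sup>2)\<^sup>2" using w1 by (intro mult_right_mono) (simp_all add: power2_eq_square)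
        finally have "\<bar>Z\<^sup>2\<bar> \<le> (w * h\<^sup>2)\<^sup>2" using Z(2) by (simp add: power_mult_distrib)
        hence "\<bar>Z\<bar>\<^sup>2 \<le> (w * h\<^sup>2)\<^sup>2" by simp
        hence Zb: "\<bar>Z\<bar> \<le> w * h\<^sup>2" by (rule power2_le_imp_le) (use w1 in simp)
        define N' where "N' = A1 * p\<^sup>2 + A2 * (p * q) + A3 * q\<^sup>2 - A4 * Z"
        define D' where "D' = (p * b - a * q)\<^sup>2 * d"
        have D0: "D' \<noteq> 0"
        proof -
          have "p * b - a * q \<noteq> 0"
          proof
            assume "p * b - a * q = 0"
            hence "of_int (p * b) = (of_int (a * q) :: rat)" by simp
            thus False using False pq ab by (simp add: field_simps)
          qed
          thus ?thesis using cd(2) by (simp add: D'_def)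
        qed
        have XN: "X = of_int N' / of_int D'"
        proof -
          define P' Q' a' b' c' d' :: rat where "P' = of_int p" and "Q' = of_int q" and "a' = of_int a"
            and "b' = of_int b" and "c' = of_int c" and "d' = of_int d"
          have q: "x * Q' = P'" "x0 * b' = a'" "y0 * d' = c'" "y * Q'\<^sup>2 = of_int Z" using pq ab cd Z
            by (simp_all add: P'_def Q'_def a'_def b'_def c'_def d'_def)
          have D: "of_int D' = (P' * b' - a' * Q')\<^sup>2 * d'"
            by (simp add: D'_def P'_def Q'_def a'_def b'_def d'_def)
          have N: "of_int N' = a' * b' * d' * P'\<^sup>2 + (a'\<^sup>2 * d' - 2 * of_int s1 * a' * b' * d' + of_int s2 * b'\<^sup>2 * d') * (P' * Q')
             + (of_int s2 * a' * b' * d' - 2 * of_int s3 * b'\<^sup>2 * d') * Q'\<^sup>2 - 2 * c' * b'\<^sup>2 * of_int Z"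
            by (simp add: N'_def A1_def A2_def A3_def A4_def P'_def Q'_def a'_def b'_def c'_def d'_def)
          have "X * of_int D' = Q'\<^sup>2 * b'\<^sup>2 * d' * (X * (x - x0)\<^sup>2)"
            unfolding D q(1,2)[symmetric] by Groebner_Basis.algebra
          also have "X * (x - x0)\<^sup>2 = x\<^sup>2 * x0 + x * x0\<^sup>2 - 2 * of_int s1 * x * x0
             + of_int s2 * (x + x0) - 2 * of_int s3 - 2 * y * y0"
            unfolding X s1_def s2_def s3_def by simp
          also have "Q'\<^sup>2 * b'\<^sup>2 * d' * \<dots> = of_int N'"
            unfolding N q[symmetric] by Groebner_Basis.algebra
          finally show ?thesis using D0 by (simp add: field_simps)
        qed
        have hh: "\<bar>p\<^sup>2\<bar> \<le> h\<^sup>2" "\<bar>p * q\<bar> \<le> h\<^sup>2" "\<bar>q\<^sup>2\<bar> \<le> h\<^sup>2"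
          unfolding power2_eq_square abs_mult by (intro mult_mono h abs_ge_zero)+
        have "\<bar>N'\<bar> \<le> \<bar>A1\<bar> * \<bar>p\<^sup>2\<bar> + \<bar>A2\<bar> * \<bar>p * q\<bar> + \<bar>A3\<bar> * \<bar>q\<^sup>2\<bar> + \<bar>A4\<bar> * \<bar>Z\<bar>"
          unfolding N'_def abs_mult[symmetric] by linarith
        also have "\<dots> \<le> \<bar>A1\<bar> * h\<^sup>2 + \<bar>A2\<bar> * h\<^sup>2 + \<bar>A3\<bar> * h\<^sup>2 + \<bar>A4\<bar> * (w * h\<^sup>2)"
          using hh Zb by (intro add_mono mult_left_mono) auto
        also have "\<dots> = K1 * h\<^sup>2" by (simp add: K1_def algebra_simps)
        finally have Nb: "\<bar>N'\<bar> \<le> K1 * h\<^sup>2" .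
        have "\<bar>p * b - a * q\<bar> \<le> \<bar>p\<bar> * b + \<bar>a\<bar> * \<bar>q\<bar>" using ab(2) by (metis abs_mult abs_of_pos abs_triangle_ineq4)
        also have "\<dots> \<le> h * b + \<bar>a\<bar> * h" using h ab(2) by (intro add_mono mult_mono) auto
        finally have "\<bar>p * b - a * q\<bar> \<le> (b + \<bar>a\<bar>) * h" by (simp add: algebra_simps)
        hence "\<bar>p * b - a * q\<bar>\<^sup>2 \<le> ((b + \<bar>a\<bar>) * h)\<^sup>2" by (intro power_mono) auto
        hence Db: "\<bar>D'\<bar> \<le> K2 * h\<^sup>2" using cd(2)
          by (simp add: D'_def K2_def abs_mult power_mult_distrib mult_right_mono mult.commute mult.left_commute)
        have "h\<^sup>2 \<ge> 0" by simp
        hence "K1 * h\<^sup>2 \<le> (K1 + K2 + K3) * h\<^sup>2" "K2 * h\<^sup>2 \<le> (K1 + K2 + K3) * h\<^sup>2"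
          using K0 by (intro mult_right_mono; simp)+
        hence "rat_height X \<le> (K1 + K2 + K3) * h\<^sup>2"
          using Nb Db by (intro rat_height_le[OF XN D0]) auto
        then show ?thesis using XY P pq(3) by (simp add: h_def)
      qed
    qed
  qed
  thus ?thesis using that by blast
qed

end

section \<open>Finitely generated abelian groups\<close>

context comm_group
begin

definition lincomb :: "'i set \<Rightarrow> ('i \<Rightarrow> 'a) \<Rightarrow> ('i \<Rightarrow> int) \<Rightarrow> 'a" where
  "lincomb I g k = (\<Otimes>i\<in>I. g i [^] k i)"

abbreviation "torsion \<equiv> carrier (torsion_part G)"

lemma torsion_iff: "x \<in> torsion \<longleftrightarrow> x \<in> carrier G \<and> (\<exists>n::nat. n > 0 \<and> x [^] n = \<one>)"
  by (simp add: torsion_part_def)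

lemma torsion_carrier: "x \<in> torsion \<Longrightarrow> x \<in> carrier G"
  by (simp add: torsion_iff)

lemma subgroup_torsion: "subgroup torsion G"
proof
  show "torsion \<subseteq> carrier G" by (auto simp: torsion_iff)
  show "\<one> \<in> torsion" by (auto simp: torsion_iff intro: exI[of _ 1])
next
  fix x y assume x: "x \<in> torsion" and y: "y \<in> torsion"
  obtain m n :: nat where mn: "m > 0" "x [^] m = \<one>" "n > 0" "y [^] n = \<one>"
    using x y by (auto simp: torsion_iff)
  have xy: "x \<in> carrier G" "y \<in> carrier G" using x y by (auto simp: torsion_iff)
  have "(x \<otimes> y) [^] (m * n) = (x [^] m) [^] n \<otimes> (y [^] n) [^] m"
    using xy by (simp add: nat_pow_distrib nat_pow_pow mult.commute)
  hence "(x \<otimes> y) [^] (m * n) = \<one>" using mn by simp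
  thus "x \<otimes> y \<in> torsion" using mn xy by (auto simp: torsion_iff intro!: exI[of _ "m * n"])
next
  fix x assume "x \<in> torsion"
  thus "inv x \<in> torsion" by (auto simp: torsion_iff nat_pow_inv)
qed

lemma torsion_int_pow_cancel:
  assumes "x \<in> carrier G" "x [^] (k::int) \<in> torsion" "k \<noteq> 0"
  shows "x \<in> torsion"
proof -
  obtain n :: nat where n: "n > 0" "(x [^] k) [^] n = \<one>" using assms(2) by (auto simp: torsion_iff)
  have *: "x [^] (k * int n) = \<one>" using n assms(1) by (simp add: int_pow_pow flip: int_pow_int)
  have "x [^] (\<bar>k\<bar> * int n) = \<one>"
  proof (cases "k \<ge> 0")
    case False
    have "x [^] (\<bar>k\<bar> * int n) = inv (x [^] (k * int n))"
      using False assms(1) by (simp flip: int_pow_neg)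
    then show ?thesis using * by simp
  qed (use * in simp)
  hence "x [^] (nat \<bar>k\<bar> * n) = \<one>" by (simp flip: int_pow_int)
  moreover have "nat \<bar>k\<bar> * n > 0" using n(1) assms(3) by simp
  ultimately show ?thesis using assms(1) unfolding torsion_iff by blast
qed

lemma lincomb_closed [simp]: "g \<in> I \<rightarrow> carrier G \<Longrightarrow> lincomb I g k \<in> carrier G"
  unfolding lincomb_def by (intro finprod_closed) auto

lemma lincomb_add:
  assumes "g \<in> I \<rightarrow> carrier G"
  shows "lincomb I g (\<lambda>i. k i + l i) = lincomb I g k \<otimes> lincomb I g l"
proof -
  have "lincomb I g (\<lambda>i. k i + l i) = (\<Otimes>i\<in>I. g i [^] k i \<otimes> g i [^] l i)"
    unfolding lincomb_def using assms by (intro finprod_cong') (auto simp: int_pow_mult Pi_def)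
  thus ?thesis unfolding lincomb_def using assms by (subst (asm) finprod_multf) auto
qed

lemma lincomb_zero: "g \<in> I \<rightarrow> carrier G \<Longrightarrow> (\<And>i. i \<in> I \<Longrightarrow> k i = 0) \<Longrightarrow> lincomb I g k = \<one>"
  unfolding lincomb_def by (rule finprod_one_eqI) simp

lemma lincomb_cong:
  "g \<in> I \<rightarrow> carrier G \<Longrightarrow> (\<And>i. i \<in> I \<Longrightarrow> k i = l i) \<Longrightarrow> lincomb I g k = lincomb I g l"
  unfolding lincomb_def by (rule finprod_cong') auto

lemma lincomb_neg:
  assumes "g \<in> I \<rightarrow> carrier G"
  shows "lincomb I g (\<lambda>i. - k i) = inv (lincomb I g k)"
proof -
  have "lincomb I g (\<lambda>i. - k i) \<otimes> lincomb I g k = \<one>"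
    using assms lincomb_zero[OF assms, of "\<lambda>i. - k i + k i"] by (simp flip: lincomb_add)
  thus ?thesis using assms by (metis inv_equality lincomb_closed)
qed

lemma lincomb_insert:
  assumes "finite I" "i \<notin> I" "g \<in> insert i I \<rightarrow> carrier G"
  shows "lincomb (insert i I) g k = g i [^] k i \<otimes> lincomb I g k"
  unfolding lincomb_def using assms by (subst finprod_insert) auto

lemma lincomb_remove:
  assumes "finite I" "i \<in> I" "g \<in> I \<rightarrow> carrier G"
  shows "lincomb I g k = g i [^] k i \<otimes> lincomb (I - {i}) g k"
proof -
  have I: "insert i (I - {i}) = I" using assms(2) by (rule insert_Diff)
  have "lincomb (insert i (I - {i})) g k = g i [^] k i \<otimes> lincomb (I - {i}) g k"
    by (rule lincomb_insert) (use assms in auto)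
  thus ?thesis by (simp only: I)
qed

lemma lincomb_unit:
  assumes "finite I" "i \<in> I" "g \<in> I \<rightarrow> carrier G"
  shows "lincomb I g (\<lambda>j. if j = i then 1 else 0) = g i"
proof -
  obtain J where J: "I = insert i J" "i \<notin> J" using assms(2) by (meson mk_disjoint_insert)
  have "lincomb J g (\<lambda>j. if j = i then 1 else 0) = \<one>"
    using J assms by (intro lincomb_zero) auto
  thus ?thesis using J assms by (simp add: lincomb_insert Pi_def)
qed

section \<open>Bases modulo torsion\<close>

definition spans :: "'i set \<Rightarrow> ('i \<Rightarrow> 'a) \<Rightarrow> bool" where
  "spans I g \<longleftrightarrow> finite I \<and> g \<in> I \<rightarrow> carrier G \<and>
    (\<forall>x\<in>carrier G. \<exists>t\<in>torsion. \<exists>k. x = t \<otimes> lincomb I g k)"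

definition indep :: "'i set \<Rightarrow> ('i \<Rightarrow> 'a) \<Rightarrow> bool" where
  "indep I g \<longleftrightarrow> (\<forall>k. lincomb I g k \<in> torsion \<longrightarrow> (\<forall>i\<in>I. k i = 0))"

lemma spansE:
  assumes "spans I g" "x \<in> carrier G"
  obtains t k where "t \<in> torsion" "x = t \<otimes> lincomb I g k"
  using assms unfolding spans_def by metis

lemma spans_generate:
  assumes "finite S" "S \<subseteq> carrier G" "carrier G \<subseteq> generate G S"
  shows "spans S id"
proof -
  have id: "id \<in> S \<rightarrow> carrier G" using assms by auto
  have "subgroup (range (lincomb S id)) G"
  proof
    show "range (lincomb S id) \<subseteq> carrier G" using id by auto
    have "\<one> = lincomb S id (\<lambda>_. 0)" using lincomb_zero[OF id] by simp
    thus "\<one> \<in> range (lincomb S id)" by blast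
  next
    fix x y assume "x \<in> range (lincomb S id)" "y \<in> range (lincomb S id)"
    then obtain k l where "x = lincomb S id k" "y = lincomb S id l" by blast
    hence "x \<otimes> y = lincomb S id (\<lambda>i. k i + l i)" using lincomb_add[OF id] by simp
    thus "x \<otimes> y \<in> range (lincomb S id)" by blast
  next
    fix x assume "x \<in> range (lincomb S id)"
    then obtain k where "x = lincomb S id k" by blast
    hence "inv x = lincomb S id (\<lambda>i. - k i)" using lincomb_neg[OF id] by simp
    thus "inv x \<in> range (lincomb S id)" by blast
  qed
  moreover have "S \<subseteq> range (lincomb S id)"
  proof
    fix s assume "s \<in> S"
    hence "s = lincomb S id (\<lambda>j. if j = s then 1 else 0)" using lincomb_unit[OF assms(1) _ id] by simp
    thus "s \<in> range (lincomb S id)" by blast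
  qed
  ultimately have "generate G S \<subseteq> range (lincomb S id)" by (rule generate_subgroup_incl[rotated])
  hence gen: "carrier G \<subseteq> range (lincomb S id)" using assms(3) by (rule order_trans[rotated])
  have "\<exists>t\<in>torsion. \<exists>k. x = t \<otimes> lincomb S id k" if "x \<in> carrier G" for x
  proof -
    have "x \<in> range (lincomb S id)" using gen that by (rule subsetD)
    then obtain k where k: "x = lincomb S id k" by (rule imageE)
    have "x = \<one> \<otimes> lincomb S id k" using that unfolding k[symmetric] by (rule l_one[symmetric])
    moreover have "\<one> \<in> torsion" using subgroup_torsion by (rule subgroup.one_closed)
    ultimately show ?thesis by blast
  qed
  thus ?thesis unfolding spans_def using id assms by blast
qed

text \<open>An elementary operation on the generators is compensated by the dual operation on the
  coefficients. It performs one subtraction of the Euclidean algorithm on a relation.\<close>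

lemma lincomb_shear:
  assumes I: "finite I" "i \<in> I" "j \<in> I" "i \<noteq> j" and g: "g \<in> I \<rightarrow> carrier G"
  shows "lincomb I g k = lincomb I (g(j := g j \<otimes> g i [^] (s::int))) (k(i := k i - s * k j))"
proof -
  define J where "J = I - {i, j}"
  have J: "I = insert i (insert j J)" "i \<notin> insert j J" "j \<notin> J" "finite J" using I by (auto simp: J_def)
  define g' k' where "g' = g(j := g j \<otimes> g i [^] s)" and "k' = k(i := k i - s * k j)"
  have gi: "g i \<in> carrier G" "g j \<in> carrier G" using g I by auto
  have g': "g' \<in> I \<rightarrow> carrier G" using g gi by (auto simp: g'_def)
  have same: "lincomb J g' k' = lincomb J g k"
    unfolding lincomb_def by (rule finprod_cong') (use g J in \<open>auto simp: g'_def k'_def\<close>)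
  have gJ: "lincomb J g k \<in> carrier G" using g J by auto
  have "lincomb I g' k' = g' i [^] k' i \<otimes> (g' j [^] k' j \<otimes> lincomb J g' k')"
    using J g' by (simp add: lincomb_insert Pi_def)
  also have "\<dots> = g i [^] (k i - s * k j) \<otimes> ((g j \<otimes> g i [^] s) [^] k j \<otimes> lincomb J g k)"
    using I(4) same by (simp add: g'_def k'_def)
  also have "\<dots> = g i [^] (k i - s * k j) \<otimes> (g j [^] k j \<otimes> g i [^] (s * k j) \<otimes> lincomb J g k)"
    using gi by (simp add: int_pow_distrib int_pow_pow)
  also have "\<dots> = (g i [^] (k i - s * k j) \<otimes> g i [^] (s * k j)) \<otimes> (g j [^] k j \<otimes> lincomb J g k)"
    using gi gJ by (simp add: m_ac)
  also have "g i [^] (k i - s * k j) \<otimes> g i [^] (s * k j) = g i [^] k i"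
    using gi by (simp flip: int_pow_mult)
  also have "g i [^] k i \<otimes> (g j [^] k j \<otimes> lincomb J g k) = lincomb I g k"
    using J g by (simp add: lincomb_insert Pi_def)
  finally show ?thesis unfolding g'_def k'_def by (rule sym)
qed

lemma spans_shear:
  assumes "spans I g" "i \<in> I" "j \<in> I" "i \<noteq> j"
  shows "spans I (g(j := g j \<otimes> g i [^] (s::int)))"
proof -
  have g: "finite I" "g \<in> I \<rightarrow> carrier G" using assms(1) unfolding spans_def by auto
  have "g i \<in> carrier G" "g j \<in> carrier G" using g assms by auto
  hence "g(j := g j \<otimes> g i [^] s) \<in> I \<rightarrow> carrier G" using g by auto
  then show ?thesis
    using assms(1) lincomb_shear[OF g(1) assms(2-4) g(2)] unfolding spans_def by metis
qed

lemma spans_remove: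
  assumes "spans I g" "j \<in> I" "g j \<in> torsion"
  shows "spans (I - {j}) g"
proof -
  have g: "finite I" "g \<in> I \<rightarrow> carrier G" using assms(1) unfolding spans_def by auto
  have "\<exists>t\<in>torsion. \<exists>k. x = t \<otimes> lincomb (I - {j}) g k" if "x \<in> carrier G" for x
  proof -
    obtain t k where t: "t \<in> torsion" "x = t \<otimes> lincomb I g k" using assms(1) \<open>x \<in> carrier G\<close> by (rule spansE)
    have "lincomb I g k = g j [^] k j \<otimes> lincomb (I - {j}) g k"
      using lincomb_remove[OF g(1) assms(2) g(2)] .
    moreover have "g j [^] k j \<in> torsion"
      using assms(3) subgroup_torsion by (simp add: subgroup_int_pow_closed)
    moreover have "lincomb (I - {j}) g k \<in> carrier G" using g by (intro lincomb_closed) auto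
    ultimately have "x = (t \<otimes> g j [^] k j) \<otimes> lincomb (I - {j}) g k" and "t \<otimes> g j [^] k j \<in> torsion"
      using t subgroup.m_closed[OF subgroup_torsion t(1)] by (simp_all add: m_assoc torsion_carrier)
    then show ?thesis by blast
  qed
  then show ?thesis using g unfolding spans_def by auto
qed

text \<open>Among the generating families of minimal size with a nontrivial relation, take a relation
  of minimal weight: the Euclidean algorithm leaves it with a single term, so that one of the
  generators is torsion and can be dropped.\<close>

lemma exists_basis:
  fixes I0 :: "'i set"
  assumes "spans I0 g0"
  shows "\<exists>(I :: 'i set) g. spans I g \<and> indep I g"
proof -
  define n where "n = (LEAST n. \<exists>(I :: 'i set) g. spans I g \<and> card I = n)"
  have "\<exists>(I :: 'i set) g. spans I g \<and> card I = n"
    unfolding n_def by (rule LeastI_ex) (use assms in blast)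
  then obtain I :: "'i set" and g where I: "spans I g" "card I = n" by blast
  have min: "n \<le> card J" if "spans J h" for J :: "'i set" and h
    unfolding n_def by (rule Least_le) (use that in blast)
  have "indep I h" if "spans I h" for h
  proof (rule ccontr)
    define W where "W = (\<lambda>m. \<exists>h k. spans I h \<and> lincomb I h k \<in> torsion \<and> (\<exists>i\<in>I. k i \<noteq> 0) \<and>
       (\<Sum>i\<in>I. nat \<bar>k i\<bar>) = m)"
    assume "\<not> indep I h"
    hence "\<exists>m. W m" using that unfolding W_def indep_def by blast
    define m where "m = (LEAST m. W m)"
    have "W m" unfolding m_def using \<open>\<exists>m. W m\<close> by (rule LeastI_ex)
    then obtain h k where hk: "spans I h" "lincomb I h k \<in> torsion" "\<exists>i\<in>I. k i \<noteq> 0"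
      "(\<Sum>i\<in>I. nat \<bar>k i\<bar>) = m" unfolding W_def by blast
    have h: "finite I" "h \<in> I \<rightarrow> carrier G" using hk(1) unfolding spans_def by auto
    obtain j where j: "j \<in> I" "k j \<noteq> 0" using hk(3) by blast
    show False
    proof (cases "\<exists>i\<in>I. i \<noteq> j \<and> k i \<noteq> 0")
      case True
      have red: False if ij: "i \<in> I" "j \<in> I" "i \<noteq> j" "k j \<noteq> 0" "\<bar>k j\<bar> \<le> \<bar>k i\<bar>" for i j
      proof -
        \<comment> \<open>With this sign the new coefficient has absolute value
          \<open>|k i| - |k j|\<close>.\<close>
        define s where "s = sgn (k i) * sgn (k j)"
        have less: "\<bar>k i - s * k j\<bar> < \<bar>k i\<bar>"
          using ij by (auto simp: s_def sgn_if abs_if split: if_splits)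
        define k' where "k' = k(i := k i - s * k j)"
        define h' where "h' = h(j := h j \<otimes> h i [^] s)"
        have "lincomb I h' k' \<in> torsion"
          using hk(2) unfolding k'_def h'_def lincomb_shear[OF h(1) ij(1,2,3) h(2), of k s] .
        moreover have "spans I h'" unfolding h'_def by (rule spans_shear[OF hk(1) ij(1,2,3)])
        moreover have "\<exists>i\<in>I. k' i \<noteq> 0" using ij by (intro bexI[of _ j]) (auto simp: k'_def)
        ultimately have "W (\<Sum>i\<in>I. nat \<bar>k' i\<bar>)"
          unfolding W_def by (intro exI[of _ h'] exI[of _ k'] conjI refl)
        hence "m \<le> (\<Sum>i\<in>I. nat \<bar>k' i\<bar>)" unfolding m_def by (rule Least_le)
        moreover have "(\<Sum>i\<in>I. nat \<bar>k' i\<bar>) < (\<Sum>i\<in>I. nat \<bar>k i\<bar>)"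
          by (rule sum_strict_mono_ex1) (use h less ij in \<open>auto simp: k'_def intro!: bexI[of _ i]\<close>)
        ultimately show False using hk(4) by simp
      qed
      obtain i where "i \<in> I" "i \<noteq> j" "k i \<noteq> 0" using True by blast
      then show ?thesis using red[of i j] red[of j i] j by (cases "\<bar>k j\<bar> \<le> \<bar>k i\<bar>") auto
    next
      case False
      have "lincomb (I - {j}) h k = \<one>" using False h by (intro lincomb_zero) auto
      hence "lincomb I h k = h j [^] k j"
        using lincomb_remove[OF h(1) j(1) h(2), of k] h j by (auto simp: Pi_def)
      hence "h j \<in> torsion" using torsion_int_pow_cancel[of "h j" "k j"] hk(2) j h by auto
      hence "spans (I - {j}) h" by (rule spans_remove[OF hk(1) j(1)])
      hence "n \<le> card (I - {j})" by (rule min)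
      moreover have "card (I - {j}) < card I" using h(1) j(1) by (rule card_Diff1_less)
      ultimately show ?thesis using I(2) by simp
    qed
  qed
  thus ?thesis using I(1) by blast
qed

lemma torsion_Int_free:
  assumes "indep I g" "g \<in> I \<rightarrow> carrier G" "t \<in> torsion" "u \<in> torsion"
    and eq: "t \<otimes> lincomb I g k = u \<otimes> lincomb I g l"
  shows "t = u \<and> (\<forall>i\<in>I. k i = l i)"
proof -
  let ?k = "lincomb I g k" and ?l = "lincomb I g l"
  have c: "t \<in> carrier G" "u \<in> carrier G" "?k \<in> carrier G" "?l \<in> carrier G"
    using assms by (auto simp: torsion_carrier)
  have "lincomb I g (\<lambda>i. k i + - l i) = ?k \<otimes> inv ?l"
    using assms(2) by (subst lincomb_add) (auto simp: lincomb_neg)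
  also have "\<dots> = inv t \<otimes> ((t \<otimes> ?k) \<otimes> inv ?l)" using c by (simp add: m_assoc inv_solve_left)
  also have "\<dots> = inv t \<otimes> u" unfolding eq using c by (simp add: m_assoc)
  also have "\<dots> \<in> torsion" using assms(3,4) subgroup_torsion by (simp add: subgroup.m_closed subgroup.m_inv_closed)
  finally have kl: "\<forall>i\<in>I. k i = l i" using assms(1) unfolding indep_def by fastforce
  hence "?k = ?l" using lincomb_cong assms(2) by blast
  hence "t = u" using eq c by simp
  thus ?thesis using kl by blast
qed

lemma iso_torsion_free:
  assumes "spans I g" "indep I g"
  shows "G \<cong> torsion_part G \<times>\<times> free_Abelian_group {..<card I}"
proof -
  have g: "finite I" "g \<in> I \<rightarrow> carrier G" using assms(1) unfolding spans_def by auto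
  define T where "T = torsion_part G"
  have Ts: "T = G\<lparr>carrier := torsion\<rparr>" by (simp add: T_def torsion_part_def)
  have gT: "group T" unfolding Ts by (rule subgroup.subgroup_is_group[OF subgroup_torsion]) (rule group_axioms)
  define F where "F = (\<lambda>(t, c). t \<otimes> lincomb I g (Poly_Mapping.lookup c))"
  have "F \<in> iso (T \<times>\<times> free_Abelian_group I) G"
  proof (rule isoI)
    show "F \<in> hom (T \<times>\<times> free_Abelian_group I) G"
    proof (rule homI)
      fix x assume "x \<in> carrier (T \<times>\<times> free_Abelian_group I)"
      thus "F x \<in> carrier G" using g by (auto simp: F_def T_def torsion_carrier)
    next
      fix x y assume "x \<in> carrier (T \<times>\<times> free_Abelian_group I)" "y \<in> carrier (T \<times>\<times> free_Abelian_group I)"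
      then obtain t c u d where xy: "x = (t, c)" "y = (u, d)" "t \<in> torsion" "u \<in> torsion"
        by (auto simp: T_def)
      have "x \<otimes>\<^bsub>T \<times>\<times> free_Abelian_group I\<^esub> y = (t \<otimes> u, c + d)" by (simp add: xy Ts)
      moreover have "lincomb I g (Poly_Mapping.lookup (c + d))
          = lincomb I g (Poly_Mapping.lookup c) \<otimes> lincomb I g (Poly_Mapping.lookup d)"
        unfolding lookup_add[abs_def] by (rule lincomb_add[OF g(2)])
      ultimately show "F (x \<otimes>\<^bsub>T \<times>\<times> free_Abelian_group I\<^esub> y) = F x \<otimes> F y"
        using xy g by (simp add: F_def m_ac torsion_carrier)
    qed
    show "bij_betw F (carrier (T \<times>\<times> free_Abelian_group I)) (carrier G)"
    proof (rule bij_betwI')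
      fix x y assume "x \<in> carrier (T \<times>\<times> free_Abelian_group I)" "y \<in> carrier (T \<times>\<times> free_Abelian_group I)"
      then obtain t c u d where xy: "x = (t, c)" "y = (u, d)" "t \<in> torsion" "u \<in> torsion"
        "Poly_Mapping.keys c \<subseteq> I" "Poly_Mapping.keys d \<subseteq> I"
        by (auto simp: T_def)
      show "F x = F y \<longleftrightarrow> x = y"
      proof
        assume "F x = F y"
        hence "t = u \<and> (\<forall>i\<in>I. Poly_Mapping.lookup c i = Poly_Mapping.lookup d i)"
          using torsion_Int_free[OF assms(2) g(2) xy(3,4)] xy by (simp add: F_def)
        moreover have "Poly_Mapping.lookup c i = Poly_Mapping.lookup d i" if "i \<notin> I" for i
          using that xy by (metis in_keys_iff subsetD)
        ultimately have "c = d" by (intro poly_mapping_eqI) blast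
        thus "x = y" using xy \<open>t = u \<and> _\<close> by simp
      qed simp
    next
      fix x assume "x \<in> carrier (T \<times>\<times> free_Abelian_group I)"
      thus "F x \<in> carrier G" using g by (auto simp: F_def T_def torsion_carrier)
    next
      fix x assume "x \<in> carrier G"
      then obtain t k where tk: "t \<in> torsion" "x = t \<otimes> lincomb I g k" by (rule spansE[OF assms(1)])
      define c where "c = Abs_poly_mapping (\<lambda>i. if i \<in> I then k i else 0)"
      have lc: "Poly_Mapping.lookup c = (\<lambda>i. if i \<in> I then k i else 0)"
        unfolding c_def by (rule lookup_Abs_poly_mapping) (rule finite_subset[OF _ g(1)], auto)
      hence "lincomb I g (Poly_Mapping.lookup c) = lincomb I g k" using g by (intro lincomb_cong) auto
      moreover have "Poly_Mapping.keys c \<subseteq> I" using lc by (auto simp: in_keys_iff split: if_splits)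
      ultimately show "\<exists>z\<in>carrier (T \<times>\<times> free_Abelian_group I). x = F z"
        using tk by (intro bexI[of _ "(t, c)"]) (auto simp: F_def T_def)
    qed
  qed
  hence "T \<times>\<times> free_Abelian_group I \<cong> G" by (rule is_isoI)
  hence "G \<cong> T \<times>\<times> free_Abelian_group I"
    using group.iso_sym DirProd_group gT group_free_Abelian_group by blast
  moreover have "T \<times>\<times> free_Abelian_group I \<cong> T \<times>\<times> free_Abelian_group {..<card I}"
  proof (rule group.DirProd_iso_trans[OF gT])
    have "I \<approx> {..<card I}" using g(1) by (simp add: eqpoll_iff_card)
    thus "free_Abelian_group I \<cong> free_Abelian_group {..<card I}"
      by (simp add: isomorphic_free_Abelian_groups)
  qed (auto simp: iso_refl)
  ultimately show ?thesis unfolding T_def using iso_trans by blast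
qed

text \<open>By \<open>xor\<close>, \<open>ker\<close> and \<open>surj\<close> the parities identify
  the group modulo doubles with the subsets of \<open>K\<close>. As torsion is killed by two, every
  class has exactly one representative that is a torsion element times a subset product of the
  basis.\<close>

lemma card_basis:
  fixes b :: "'k \<Rightarrow> 'a \<Rightarrow> bool"
  assumes sp: "spans I g" and ind: "indep I g" and K: "finite K"
    and T: "\<And>t. t \<in> torsion \<Longrightarrow> t \<otimes> t = \<one>"
    and xor: "\<And>k x y. k \<in> K \<Longrightarrow> x \<in> carrier G \<Longrightarrow> y \<in> carrier G \<Longrightarrow> b k (x \<otimes> y) \<longleftrightarrow> b k x \<noteq> b k y"
    and ker: "\<And>x. x \<in> carrier G \<Longrightarrow> (\<And>k. k \<in> K \<Longrightarrow> \<not> b k x) \<Longrightarrow> \<exists>y\<in>carrier G. x = y \<otimes> y"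
    and surj: "\<And>A. A \<subseteq> K \<Longrightarrow> \<exists>x\<in>carrier G. \<forall>k\<in>K. b k x \<longleftrightarrow> k \<in> A"
  shows "card torsion * 2 ^ card I = 2 ^ card K"
proof -
  have g: "finite I" "g \<in> I \<rightarrow> carrier G" using sp unfolding spans_def by auto
  define e where "e = (\<lambda>A. lincomb I g (\<lambda>i. if i \<in> A then 1 else 0))"
  define F where "F = (\<lambda>(t, A). {k \<in> K. b k (t \<otimes> e A)})"
  have ec: "e A \<in> carrier G" for A using g by (simp add: e_def)
  have b1: "\<not> b k (x \<otimes> x)" if "k \<in> K" "x \<in> carrier G" for k x using xor[OF that that(2)] by simp
  have "bij_betw F (torsion \<times> Pow I) (Pow K)"
  proof (rule bij_betwI')
    fix x y assume "x \<in> torsion \<times> Pow I" "y \<in> torsion \<times> Pow I"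
    then obtain t A u B where xy: "x = (t, A)" "y = (u, B)" "t \<in> torsion" "u \<in> torsion" "A \<subseteq> I" "B \<subseteq> I" by blast
    have c: "t \<in> carrier G" "u \<in> carrier G" using xy torsion_carrier by auto
    show "F x = F y \<longleftrightarrow> x = y"
    proof
      assume eq: "F x = F y"
      \<comment> \<open>Equal parities make \<open>z\<close> a double. Comparing torsion parts and
        coefficients, where \<open>v\<close> squares to the identity, gives \<open>t = u\<close> and
        equal parities of the indicators of \<open>A\<close> and \<open>B\<close>.\<close>
      define z where "z = (t \<otimes> e A) \<otimes> (u \<otimes> e B)"
      have zc: "z \<in> carrier G" using c ec by (simp add: z_def)
      have "\<not> b k z" if "k \<in> K" for k
        unfolding z_def using eq that c ec by (subst xor) (auto simp: F_def xy)
      then obtain w where w: "w \<in> carrier G" "z = w \<otimes> w" using ker zc by blast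
      obtain v k where v: "v \<in> torsion" "w = v \<otimes> lincomb I g k" using sp w(1) by (rule spansE)
      have "(t \<otimes> u) \<otimes> lincomb I g (\<lambda>i. (if i \<in> A then 1 else 0) + (if i \<in> B then 1 else 0)) = z"
        using c g by (simp add: z_def e_def lincomb_add m_ac)
      also have "z = (v \<otimes> v) \<otimes> lincomb I g (\<lambda>i. k i + k i)"
        unfolding lincomb_add[OF g(2)] using w v g by (simp add: m_ac torsion_carrier)
      finally have "t \<otimes> u = v \<otimes> v \<and> (\<forall>i\<in>I. (if i \<in> A then 1 else 0) + (if i \<in> B then 1 else 0) = k i + k i)"
        using torsion_Int_free[OF ind g(2)] subgroup.m_closed[OF subgroup_torsion] xy v by blast
      hence tu: "t \<otimes> u = \<one>" and par: "\<And>i. i \<in> I \<Longrightarrow> (if i \<in> A then 1 else 0) + (if i \<in> B then 1 else 0) = 2 * k i"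
        using T v by auto
      have "i \<in> A \<longleftrightarrow> i \<in> B" if "i \<in> I" for i using par[OF that] by (auto split: if_splits) presburger+
      hence "A = B" using xy by blast
      moreover have "t = u" using tu T[OF xy(4)] c by (metis right_cancel)
      ultimately show "x = y" using xy by simp
    qed simp
  next
    fix x assume "x \<in> torsion \<times> Pow I"
    thus "F x \<in> Pow K" by (auto simp: F_def)
  next
    fix D assume "D \<in> Pow K"
    then obtain x where x: "x \<in> carrier G" "\<forall>k\<in>K. b k x \<longleftrightarrow> k \<in> D" using surj by blast
    obtain t l where tl: "t \<in> torsion" "x = t \<otimes> lincomb I g l" using sp x(1) by (rule spansE)
    \<comment> \<open>The odd coefficients select the representative; the halved coefficients go
      into a double, which the parities do not see.\<close>
    define A where "A = {i \<in> I. odd (l i)}"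
    define h where "h = lincomb I g (\<lambda>i. l i div 2)"
    have hc: "h \<in> carrier G" using g by (simp add: h_def)
    have "e A \<otimes> (h \<otimes> h) = lincomb I g (\<lambda>i. (if i \<in> A then 1 else 0) + (l i div 2 + l i div 2))"
      by (simp only: e_def h_def lincomb_add[OF g(2)])
    also have "\<dots> = lincomb I g l"
      using g by (intro lincomb_cong) (auto simp: A_def elim!: oddE evenE)
    finally have "x = (t \<otimes> e A) \<otimes> (h \<otimes> h)" using tl ec hc by (simp add: m_assoc torsion_carrier)
    hence "b k x \<longleftrightarrow> b k (t \<otimes> e A)" if "k \<in> K" for k
      using that b1[OF that hc] tl ec hc by (simp add: xor torsion_carrier)
    hence "D = F (t, A)" using x(2) \<open>D \<in> Pow K\<close> by (auto simp: F_def)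
    thus "\<exists>z\<in>torsion \<times> Pow I. D = F z" using tl(1) by (intro bexI[of _ "(t, A)"]) (auto simp: A_def)
  qed
  hence "card (torsion \<times> Pow I) = card (Pow K)" by (rule bij_betw_same_card)
  thus ?thesis using g(1) K by (simp add: card_cartesian_product card_Pow)
qed

text \<open>Elimination: a wrong value at position \<open>m\<close> is corrected by
  \<open>p m\<close>, which leaves all earlier positions untouched.\<close>

lemma surj_triangular:
  fixes b :: "nat \<Rightarrow> 'a \<Rightarrow> bool"
  assumes xor: "\<And>k x y. k < N \<Longrightarrow> x \<in> carrier G \<Longrightarrow> y \<in> carrier G \<Longrightarrow> b k (x \<otimes> y) \<longleftrightarrow> b k x \<noteq> b k y"
    and p: "\<And>k. k < N \<Longrightarrow> p k \<in> carrier G" "\<And>k. k < N \<Longrightarrow> b k (p k)" "\<And>j k. k < N \<Longrightarrow> j < k \<Longrightarrow> \<not> b j (p k)"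
  shows "\<exists>x\<in>carrier G. \<forall>k<N. b k x \<longleftrightarrow> k \<in> A"
proof -
  have "\<exists>x\<in>carrier G. \<forall>k<m. b k x \<longleftrightarrow> k \<in> A" if "m \<le> N" for m
    using that
  proof (induction m)
    case (Suc m)
    then obtain x where x: "x \<in> carrier G" "\<forall>k<m. b k x \<longleftrightarrow> k \<in> A" by auto
    have m: "m < N" using Suc.prems by simp
    show ?case
    proof (cases "b m x \<longleftrightarrow> m \<in> A")
      case True
      then show ?thesis using x by (metis less_Suc_eq)
    next
      case False
      have "b k (x \<otimes> p m) \<longleftrightarrow> k \<in> A" if "k < Suc m" for k
        using that False x m p xor[of k x "p m"] by (cases "k = m") auto
      then show ?thesis using x p m by blast
    qed
  qed auto
  thus ?thesis by blast
qed

text \<open>Doubling raises the height to about its fourth power and translation by \<open>q\<close>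
  at most squares it. Hence for \<open>H x > M\<close> the half \<open>r\<close> of
  \<open>x \<otimes> q\<close> satisfies \<open>H r < H x\<close>, and the descent ends among the
  finitely many elements of height at most \<open>M\<close>.\<close>

lemma generate_descent:
  fixes H :: "'a \<Rightarrow> int" and C :: "'a \<Rightarrow> int"
  assumes fin: "\<And>B. finite {x \<in> carrier G. H x \<le> B}"
    and pos: "\<And>x. x \<in> carrier G \<Longrightarrow> H x \<ge> 1"
    and F: "finite F" "F \<subseteq> carrier G"
    and cosets: "\<And>x. x \<in> carrier G \<Longrightarrow> \<exists>q\<in>F. \<exists>r\<in>carrier G. x \<otimes> q = r \<otimes> r"
    and mult: "\<And>x q. x \<in> carrier G \<Longrightarrow> q \<in> F \<Longrightarrow> H (x \<otimes> q) \<le> C q * H x ^ 2"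
    and double: "\<And>x. x \<in> carrier G \<Longrightarrow> H x ^ 4 \<le> D * H (x \<otimes> x)"
  shows "\<exists>S. finite S \<and> S \<subseteq> carrier G \<and> carrier G \<subseteq> generate G S"
proof -
  define M where "M = \<bar>D\<bar> * (\<Sum>q\<in>F. \<bar>C q\<bar>)"
  have M: "D * C q \<le> M" if "q \<in> F" for q
  proof -
    have "\<bar>C q\<bar> \<le> (\<Sum>q\<in>F. \<bar>C q\<bar>)" using F that by (intro member_le_sum) auto
    hence "\<bar>D\<bar> * \<bar>C q\<bar> \<le> M" unfolding M_def by (intro mult_left_mono) auto
    thus ?thesis by (metis abs_mult abs_le_D1)
  qed
  have D0: "D \<ge> 0"
  proof (rule ccontr)
    assume "\<not> D \<ge> 0"
    moreover have "H \<one> \<ge> 1" using pos by simp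
    ultimately have "D * H \<one> < 0" by (simp add: mult_neg_pos)
    moreover have "H \<one> ^ 4 \<le> D * H \<one>" using double[OF one_closed] by simp
    moreover have "0 \<le> H \<one> ^ 4" by simp
    ultimately show False by linarith
  qed
  define S where "S = F \<union> {x \<in> carrier G. H x \<le> M}"
  have S: "S \<subseteq> carrier G" "finite S" using F fin by (auto simp: S_def)
  have sub: "subgroup (generate G S) G" using generate_is_subgroup[OF S(1)] .
  have "x \<in> generate G S" if "x \<in> carrier G" for x
    using that
  proof (induction "nat (H x)" arbitrary: x rule: less_induct)
    case less
    show ?case
    proof (cases "H x \<le> M")
      case True
      thus ?thesis using less.prems by (intro generate.incl) (simp add: S_def)
    next
      case False
      obtain q r where qr: "q \<in> F" "r \<in> carrier G" "x \<otimes> q = r \<otimes> r" using cosets less.prems by blast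
      have Hx: "H x \<ge> 1" "H r \<ge> 1" using pos less.prems qr by auto
      have "H r ^ 4 \<le> D * H (x \<otimes> q)" using double qr by metis
      also have "\<dots> \<le> D * (C q * H x ^ 2)" using mult[OF less.prems qr(1)] D0 by (rule mult_left_mono)
      also have "\<dots> = (D * C q) * H x ^ 2" by simp
      also have "\<dots> \<le> M * H x ^ 2" using M[OF qr(1)] by (intro mult_right_mono) auto
      also have "\<dots> < H x * H x ^ 2" using False Hx by (intro mult_strict_right_mono) auto
      also have "\<dots> = H x ^ 3" by (simp add: power2_eq_square power3_eq_cube)
      also have "\<dots> \<le> H x ^ 4" by (rule power_increasing) (use Hx in simp_all)
      finally have "H r ^ 4 < H x ^ 4" .
      hence "H r < H x" by (rule power_less_imp_less_base) (use Hx in simp)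
      hence "r \<in> generate G S" using less.hyps[of r] qr Hx by simp
      moreover have "q \<in> generate G S" using qr(1) by (intro generate.incl) (simp add: S_def)
      moreover have "x = (r \<otimes> r) \<otimes> inv q"
      proof -
        have "q \<in> carrier G" using qr(1) F(2) by (rule subsetD[rotated])
        hence "x = (x \<otimes> q) \<otimes> inv q" using less.prems by (simp add: m_assoc)
        thus ?thesis by (simp only: qr(3))
      qed
      ultimately show ?thesis using subgroup.m_closed[OF sub] subgroup.m_inv_closed[OF sub] by simp
    qed
  qed
  thus ?thesis using S by blast
qed

end

section \<open>Valuations and quadratic residues\<close>

lemma QuadRes_cancel:
  assumes p: "prime p" "\<not> p dvd A" and q: "QuadRes p (d * A\<^sup>2)"
  shows "QuadRes p d"
proof -
  have "coprime A p" using p by (metis coprime_commute prime_imp_coprime)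
  then obtain v where v: "[A * v = 1] (mod p)" using cong_solve_coprime_int by blast
  obtain y where "[y\<^sup>2 = d * A\<^sup>2] (mod p)" using q unfolding QuadRes_def by blast
  hence "[y\<^sup>2 * v\<^sup>2 = d * A\<^sup>2 * v\<^sup>2] (mod p)" by (rule cong_mult[OF _ cong_refl])
  hence "[(y * v)\<^sup>2 = d * (A * v)\<^sup>2] (mod p)" by (simp add: power_mult_distrib mult.assoc)
  also have "[d * (A * v)\<^sup>2 = d * 1\<^sup>2] (mod p)" by (intro cong_mult cong_pow v cong_refl)
  finally show ?thesis unfolding QuadRes_def by auto
qed

lemma QuadRes_cong: "[a = b] (mod p) \<Longrightarrow> QuadRes p a \<Longrightarrow> QuadRes p b"
  unfolding QuadRes_def using cong_trans by blast

lemma not_QuadResI: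
  assumes "p > 0" "\<forall>y\<in>set [0..p-1]. y\<^sup>2 mod p \<noteq> a mod p"
  shows "\<not> QuadRes p a"
proof
  assume "QuadRes p a"
  then obtain y where "y\<^sup>2 mod p = a mod p" unfolding QuadRes_def cong_def by blast
  hence "(y mod p)\<^sup>2 mod p = a mod p" by (simp add: power_mod)
  moreover have "y mod p \<in> set [0..p-1]" using assms(1) by simp
  ultimately show False using assms(2) by blast
qed

text \<open>The sum and the difference of the valuations of numerator and denominator have the same
  parity; taking the product avoids negative valuations.\<close>

definition odd_val :: "int \<Rightarrow> rat \<Rightarrow> bool" where
  "odd_val p x \<longleftrightarrow> odd (multiplicity p (fst (quotient_of x) * snd (quotient_of x)))"

lemma odd_val_frac:
  assumes p: "prime p" and ab: "a \<noteq> 0" "b \<noteq> 0"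
  shows "odd_val p (of_int a / of_int b) \<longleftrightarrow> odd (multiplicity p (a * b))"
proof -
  obtain N D where q: "quotient_of (of_int a / of_int b :: rat) = (N, D)" by fastforce
  have D: "D > 0" using quotient_of_denom_pos[OF q] .
  have "(of_int a / of_int b :: rat) = of_int N / of_int D" using quotient_of_div[OF q] .
  hence "of_int (a * D) = (of_int (N * b) :: rat)" using ab D by (simp add: field_simps)
  hence eq: "a * D = N * b" by (simp only: of_int_eq_iff)
  hence N: "N \<noteq> 0" using ab D by auto
  have pe: "prime_elem p" using p by (rule prime_imp_prime_elem)
  have "a * b * D\<^sup>2 = (a * D) * (b * D)" by (simp add: power2_eq_square)
  also have "\<dots> = N * D * b\<^sup>2" unfolding eq by (simp add: power2_eq_square)
  finally have "a * b * D\<^sup>2 = N * D * b\<^sup>2" .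
  hence "multiplicity p (a * b) + 2 * multiplicity p D = multiplicity p (N * D) + 2 * multiplicity p b"
    using ab D N by (metis (no_types, lifting) pe prime_elem_multiplicity_mult_distrib
      prime_elem_multiplicity_power_distrib mult_eq_0_iff power_not_zero less_irrefl)
  hence "odd (multiplicity p (a * b)) \<longleftrightarrow> odd (multiplicity p (N * D))" by presburger
  thus ?thesis by (simp add: odd_val_def q)
qed

lemma odd_val_mult:
  assumes p: "prime p" and xy: "x \<noteq> 0" "y \<noteq> 0"
  shows "odd_val p (x * y) \<longleftrightarrow> odd_val p x \<noteq> odd_val p y"
proof -
  obtain a b where ab: "x = of_int a / of_int b" "b > 0" by (rule rat_quotient)
  obtain c d where cd: "y = of_int c / of_int d" "d > 0" by (rule rat_quotient)
  have nz: "a \<noteq> 0" "c \<noteq> 0" using xy ab cd by auto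
  have "x * y = of_int (a * c) / of_int (b * d)" using ab cd by simp
  hence "odd_val p (x * y) \<longleftrightarrow> odd (multiplicity p ((a * c) * (b * d)))"
    using odd_val_frac[OF p, of "a * c" "b * d"] nz ab cd by simp
  also have "(a * c) * (b * d) = (a * b) * (c * d)" by simp
  also have "multiplicity p \<dots> = multiplicity p (a * b) + multiplicity p (c * d)"
    using nz ab cd p by (subst prime_elem_multiplicity_mult_distrib) auto
  also have "odd \<dots> \<longleftrightarrow> odd_val p x \<noteq> odd_val p y"
    using odd_val_frac[OF p, of a b] odd_val_frac[OF p, of c d] nz ab cd by auto
  finally show ?thesis .
qed

lemma odd_val_square: "prime p \<Longrightarrow> s \<noteq> 0 \<Longrightarrow> \<not> odd_val p (s\<^sup>2)"
  by (simp add: power2_eq_square odd_val_mult)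

lemma odd_val_int: "prime p \<Longrightarrow> d \<noteq> 0 \<Longrightarrow> odd_val p (of_int d) \<longleftrightarrow> odd (multiplicity p d)"
  using odd_val_frac[of p d 1] by simp

lemma odd_val_int_square:
  "prime p \<Longrightarrow> d \<noteq> 0 \<Longrightarrow> s \<noteq> 0 \<Longrightarrow> odd_val p (of_int d * s\<^sup>2) \<longleftrightarrow> odd (multiplicity p d)"
  by (simp add: odd_val_mult odd_val_square odd_val_int)

lemma odd_multiplicity_once:
  assumes "p dvd d" "\<not> p * p dvd (d :: int)"
  shows "odd (multiplicity p d)"
proof -
  have "multiplicity p d = 1" by (rule multiplicity_eqI) (use assms in simp_all)
  thus ?thesis by simp
qed

lemma prime_dvd_squarefree_part:
  fixes n :: int
  assumes p: "prime p"
  shows "p dvd squarefree_part n \<longleftrightarrow> odd (multiplicity p n)"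
proof -
  have "p dvd squarefree_part n \<longleftrightarrow> multiplicity p (squarefree_part n) > 0"
    by (subst prime_multiplicity_gt_zero_iff[OF prime_imp_prime_elem[OF p]]) simp_all
  thus ?thesis unfolding prime_multiplicity_squarefree_part[OF p] by (auto simp: odd_iff_mod_2_eq_one)
qed

lemma squarefree_part_dvdI:
  fixes n m :: int
  assumes "\<And>p. prime p \<Longrightarrow> p dvd squarefree_part n \<Longrightarrow> p dvd m" "m \<noteq> 0"
  shows "squarefree_part n dvd m"
proof (rule multiplicity_le_imp_dvd)
  fix p :: int assume p: "prime p"
  show "multiplicity p (squarefree_part n) \<le> multiplicity p m"
  proof (cases "p dvd squarefree_part n")
    case True
    hence "p dvd m" using assms p by blast
    hence "multiplicity p m \<ge> 1"
      using prime_multiplicity_gt_zero_iff[OF prime_imp_prime_elem[OF p] assms(2)] by simp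
    moreover have "multiplicity p (squarefree_part n) \<le> 1"
      using prime_multiplicity_squarefree_part[OF p, of n] by simp
    ultimately show ?thesis by simp
  qed (simp add: not_dvd_imp_multiplicity_0)
qed simp

text \<open>A prime that meets only one of three factors of a square contributes all of its even
  exponent to that factor. This confines the descent classes to the bad primes.\<close>

lemma even_multiplicity_of_square:
  fixes u v w Y :: int
  assumes p: "prime p" "\<not> p dvd v" "\<not> p dvd w" and eq: "u * (v * w) = Y\<^sup>2"
  shows "even (multiplicity p u)"
proof (cases "u = 0")
  case False
  have vw: "v * w \<noteq> 0" "\<not> p dvd v * w" using p by (auto simp: prime_dvd_mult_iff)
  hence Y: "Y \<noteq> 0" using eq False by auto
  have "multiplicity p u = multiplicity p (u * (v * w))"
    using p False vw by (subst prime_elem_multiplicity_mult_distrib) (auto simp: not_dvd_imp_multiplicity_0)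
  also have "\<dots> = 2 * multiplicity p Y"
    unfolding eq using p Y by (subst prime_elem_multiplicity_power_distrib) auto
  finally show ?thesis by simp
qed simp

lemma coprime_mult_square_int:
  fixes b c :: int
  assumes "b > 0" "coprime b c" "b * c = y\<^sup>2"
  shows "\<exists>z. b = z\<^sup>2"
proof -
  have "b * c \<ge> 0" using assms(3) by simp
  hence c: "c \<ge> 0" using assms(1) by (simp add: zero_le_mult_iff)
  show ?thesis
  proof (cases "c = 0")
    case True
    hence "b = 1\<^sup>2" using assms(1,2) by simp
    thus ?thesis by blast
  next
    case False
    have "coprime (int (nat b)) (int (nat c))" using assms c by simp
    hence "coprime (nat b) (nat c)" by (simp only: coprime_int_iff)
    moreover have "nat b * nat c = (nat \<bar>y\<bar>) ^ 2"
    proof -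
      have "int (nat b * nat c) = int ((nat \<bar>y\<bar>) ^ 2)" using assms c by simp
      thus ?thesis by (simp only: of_nat_eq_iff)
    qed
    ultimately have "is_nth_power 2 (nat b)"
      using is_nth_power_mult_coprime_natD(1)[of "nat b" "nat c" 2] assms(1) c False by (simp add: is_nth_powerI)
    then obtain z where "nat b = z ^ 2" by (auto elim: is_nth_powerE)
    hence "b = (int z)\<^sup>2" using assms(1) by (metis nat_0_le of_nat_power order.strict_implies_order)
    thus ?thesis by blast
  qed
qed

section \<open>Congruent number curves\<close>

text \<open>At an odd prime of additive reduction the local image of the descent map is generated by the
  points of order two.\<close>

lemma local_unit:
  fixes n X Z Y d d' A B p :: int
  assumes p: "prime p" "p dvd n" "\<not> p * p dvd n" and cop: "coprime X (Z\<^sup>2)"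
    and eq: "X * ((X - n * Z\<^sup>2) * (X + n * Z\<^sup>2)) = Y\<^sup>2"
    and X: "X = d * A\<^sup>2" "X - n * Z\<^sup>2 = d' * B\<^sup>2" and d: "\<not> p dvd d" "\<not> p dvd d'"
  shows "QuadRes p d" "QuadRes p d'"
proof -
  \<comment> \<open>If \<open>p\<close> divided \<open>X\<close>, it would divide \<open>A\<close>
    and \<open>B\<close>, so \<open>p^2\<close> would divide \<open>n * Z^2\<close>. As
    \<open>p\<close> divides \<open>n\<close> only once, it would divide \<open>Z^2\<close>, against
    coprimality.\<close>
  have nX: "\<not> p dvd X"
  proof
    assume pX: "p dvd X"
    hence "p dvd d * A\<^sup>2" using X(1) by simp
    hence A: "p dvd A" using p(1) d(1) by (simp add: prime_dvd_mult_iff prime_dvd_power_iff)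
    have "p dvd X - n * Z\<^sup>2" using pX p(2) by simp
    hence "p dvd d' * B\<^sup>2" using X(2) by simp
    hence B: "p dvd B" using p(1) d(2) by (simp add: prime_dvd_mult_iff prime_dvd_power_iff)
    have "p\<^sup>2 dvd d * A\<^sup>2 - d' * B\<^sup>2" using A B by (intro dvd_diff dvd_mult dvd_power_same)
    moreover have "d * A\<^sup>2 - d' * B\<^sup>2 = n * Z\<^sup>2" using X by linarith
    ultimately have "p * p dvd n * Z\<^sup>2" by (simp add: power2_eq_square)
    moreover obtain m where m: "n = p * m" using p(2) by blast
    ultimately have "p dvd m * Z\<^sup>2" using p(1) by (auto simp: mult.assoc)
    moreover have "\<not> p dvd m" using p(3) m by auto
    ultimately have "p dvd Z\<^sup>2" using p(1) by (simp add: prime_dvd_mult_iff)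
    thus False using pX cop p(1) by (meson coprime_common_divisor not_prime_unit)
  qed
  have c1: "[X - n * Z\<^sup>2 = X] (mod p)" "[X + n * Z\<^sup>2 = X] (mod p)"
    using p(2) by (simp_all add: cong_iff_dvd_diff)
  \<comment> \<open>Modulo \<open>p\<close> the three factors agree, so the cube of the unit
    \<open>X\<close> is a square and therefore \<open>X\<close> is one.\<close>
  have "[Y\<^sup>2 = X * (X * X)] (mod p)" unfolding eq[symmetric] by (intro cong_mult c1 cong_refl)
  hence "QuadRes p (X * X\<^sup>2)" unfolding QuadRes_def power2_eq_square[of X] by blast
  hence qX: "QuadRes p X" using QuadRes_cancel p(1) nX by blast
  have "\<not> p dvd A"
  proof
    assume "p dvd A"
    hence "p dvd d * A\<^sup>2" by (simp add: power2_eq_square)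
    thus False using nX X(1) by simp
  qed
  thus "QuadRes p d" using QuadRes_cancel[OF p(1), of A d] qX X(1) by simp
  have "QuadRes p (d' * B\<^sup>2)" using QuadRes_cong[OF cong_sym[OF c1(1)] qX] X(2) by simp
  moreover have "\<not> p dvd B"
  proof
    assume "p dvd B"
    hence "p dvd d' * B\<^sup>2" by (simp add: power2_eq_square)
    hence "p dvd X - n * Z\<^sup>2" using X(2) by simp
    hence "p dvd (X - n * Z\<^sup>2) + n * Z\<^sup>2" using p(2) by (intro dvd_add) simp_all
    thus False using nX by simp
  qed
  ultimately show "QuadRes p d'" using QuadRes_cancel p(1) by blast
qed

text \<open>Among the local classes of the points of order two, the one with odd valuation in
  \<open>x\<close> and even valuation in \<open>x - n\<close> is that of \<open>(n, 0)\<close>,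
  where \<open>x - n\<close> has the class of \<open>2 * n^2\<close>. Thus \<open>d'\<close> has to
  agree with 2 modulo squares at \<open>p\<close>.\<close>

lemma local_nonunit:
  fixes n X Z Y d d' A B p :: int
  assumes p: "prime p" "p dvd n" "\<not> p * p dvd n" and cop: "coprime X (Z\<^sup>2)"
    and eq: "X * ((X - n * Z\<^sup>2) * (X + n * Z\<^sup>2)) = Y\<^sup>2" and nz: "X - n * Z\<^sup>2 \<noteq> 0"
    and X: "X = d * A\<^sup>2" "X - n * Z\<^sup>2 = d' * B\<^sup>2" and d: "p dvd d" "\<not> p dvd d'"
  shows "QuadRes p (2 * d')"
proof -
  obtain m where m: "n = p * m" using p(2) by blast
  have pX: "p dvd X" using X(1) d(1) by simp
  have p0: "p \<noteq> 0" using p(1) by auto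
  have pm: "\<not> p dvd m" using p(3) m by auto
  have pZ: "\<not> p dvd Z"
  proof
    assume "p dvd Z"
    hence "p dvd Z\<^sup>2" by (simp add: power2_eq_square)
    thus False using pX cop p(1) by (meson coprime_common_divisor not_prime_unit)
  qed
  have "p dvd X - n * Z\<^sup>2" using pX p(2) by simp
  hence "p dvd d' * B\<^sup>2" using X(2) by simp
  hence "p dvd B" using p(1) d(2) by (simp add: prime_dvd_mult_iff prime_dvd_power_iff)
  then obtain B' where B': "B = p * B'" by blast
  obtain X' where X': "X = p * X'" using pX by blast
  have B0: "B \<noteq> 0" using nz X(2) by auto
  have "p * X' - p * m * Z\<^sup>2 = d' * (p * p * B'\<^sup>2)"
    using X(2) unfolding X' m B' by (simp add: power2_eq_square mult.assoc mult.left_commute)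
  hence "p * (X' - m * Z\<^sup>2) = p * (p * (d' * B'\<^sup>2))" by (simp add: algebra_simps)
  hence XmZ: "X' - m * Z\<^sup>2 = p * (d' * B'\<^sup>2)" using p0 by simp
  have "Y\<^sup>2 = (p * B)\<^sup>2 * (X' * (X' + m * Z\<^sup>2) * d')"
    unfolding eq[symmetric] X(2) unfolding X' m by (simp add: power2_eq_square algebra_simps)
  moreover from this have "(p * B)\<^sup>2 dvd Y\<^sup>2" by simp
  hence "p * B dvd Y" by (simp add: pow_divides_pow_iff)
  then obtain W where W: "Y = p * B * W" by blast
  ultimately have "(p * B)\<^sup>2 * W\<^sup>2 = (p * B)\<^sup>2 * (X' * (X' + m * Z\<^sup>2) * d')"
    by (simp add: power_mult_distrib)
  hence W2: "W\<^sup>2 = X' * (X' + m * Z\<^sup>2) * d'" using p0 B0 by simp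
  \<comment> \<open>\<open>p\<close> divides \<open>B\<close>, so \<open>X - n * Z^2\<close> is
    divisible by \<open>p^2\<close> and one factor of \<open>p\<close> survives the division by
    \<open>p\<close>.\<close>
  have c: "[X' = m * Z\<^sup>2] (mod p)" using XmZ by (simp add: cong_iff_dvd_diff)
  have "[W\<^sup>2 = (m * Z\<^sup>2) * (m * Z\<^sup>2 + m * Z\<^sup>2) * d'] (mod p)"
    unfolding W2 by (intro cong_mult cong_add c cong_refl)
  also have "(m * Z\<^sup>2) * (m * Z\<^sup>2 + m * Z\<^sup>2) * d' = (2 * d') * (m * Z\<^sup>2)\<^sup>2"
    by (simp add: power2_eq_square algebra_simps)
  finally have "QuadRes p ((2 * d') * (m * Z\<^sup>2)\<^sup>2)" unfolding QuadRes_def by blast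
  moreover have "\<not> p dvd m * Z\<^sup>2" using pm pZ p(1) by (simp add: prime_dvd_mult_iff prime_dvd_power_iff)
  ultimately show ?thesis using QuadRes_cancel p(1) by blast
qed

locale congruent_number_curve =
  fixes n :: int
  assumes odd_n: "odd n"

sublocale congruent_number_curve \<subseteq> integral_cubic 0 n "- n"
  rewrites "rat_of_int 0 = 0" and "rat_of_int (- n) = - rat_of_int n"
  by unfold_locales (use odd_n in auto)

context congruent_number_curve
begin

abbreviation "G \<equiv> point_group E"

interpretation G: comm_group G by (rule comm_group_point_group)

section \<open>Doubling and the power of 2 in the denominator of the abscissa\<close>

definition deep :: "nat \<Rightarrow> rat \<Rightarrow> bool" where
  "deep k x \<longleftrightarrow> 2 ^ k dvd snd (quotient_of x)"

lemma deep_frac: "s > 0 \<Longrightarrow> coprime r s \<Longrightarrow> deep k (of_int r / of_int s) \<longleftrightarrow> 2 ^ k dvd s"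
  by (simp add: deep_def quotient_of_Fract flip: Fract_of_int_quotient)

lemma deep_height: "deep k x \<Longrightarrow> 2 ^ k \<le> rat_height x"
proof -
  assume "deep k x"
  moreover obtain p q where pq: "quotient_of x = (p, q)" by fastforce
  moreover have "q > 0" using quotient_of_denom_pos[OF pq] .
  ultimately have "2 ^ k \<le> q" unfolding deep_def by (simp add: zdvd_imp_le)
  thus ?thesis using pq by (simp add: rat_height_def)
qed

lemma double_pq:
  assumes on: "on_curve E (Affine x y)" and y: "y \<noteq> 0"
    and x: "x = of_int p / of_int q" "q > 0"
  obtains r s Y where "s > 0" "coprime r s"
    "point_add E (Affine x y) (Affine x y) = Affine (of_int r / of_int s) Y"
    "r * (4 * q * p * ((p - n * q) * (p + n * q))) = (p\<^sup>2 + n\<^sup>2 * q\<^sup>2)\<^sup>2 * s"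
  using double_int[OF on y x(1)] x(2) that by (auto simp: power2_eq_square mult.assoc)

text \<open>For even \<open>q\<close> the numerator \<open>p^2 + n^2 * q^2\<close> is odd, so at
  least \<open>2 * q\<close> contributes all its powers of 2 to the new denominator.\<close>

lemma double_deep:
  assumes on: "on_curve E (Affine x y)" and k: "k > 0" "deep k x"
  shows "\<exists>X Y. point_add E (Affine x y) (Affine x y) = Affine X Y \<and> deep (Suc k) X"
proof -
  obtain p q where pq: "x = of_int p / of_int q" "q > 0" "coprime p q" by (rule rat_quotient)
  have q: "2 ^ k dvd q" using k pq deep_frac by simp
  have "even ((2::int) ^ k)" using k by simp
  hence even_q: "even q" using q dvd_trans by blast
  hence "odd p" using pq(3) coprime_common_divisor[of p q 2] by auto
  have "y \<noteq> 0"
  proof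
    assume "y = 0"
    hence "x = of_int 0 / of_int 1 \<or> x = of_int n / of_int 1 \<or> x = of_int (- n) / of_int 1"
      using on unfolding on_curve_iff by (auto simp: eq_neg_iff_add_eq_0)
    then obtain c where "x = of_int c / of_int 1" by blast
    hence "2 ^ k dvd (1::int)" using k deep_frac[of 1 c k] by simp
    thus False using k by simp
  qed
  then obtain r s Y where rs: "s > 0" "coprime r s"
    "point_add E (Affine x y) (Affine x y) = Affine (of_int r / of_int s) Y"
    "r * (4 * q * p * ((p - n * q) * (p + n * q))) = (p\<^sup>2 + n\<^sup>2 * q\<^sup>2)\<^sup>2 * s"
    using double_pq[OF on _ pq(1,2)] by blast
  have "2 ^ Suc k dvd 2 * q" using q by (simp add: mult_dvd_mono)
  also have "2 * q dvd (p\<^sup>2 + n\<^sup>2 * q\<^sup>2)\<^sup>2 * s" unfolding rs(4)[symmetric]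
    by (rule dvdI[of _ _ "r * (2 * p * ((p - n * q) * (p + n * q)))"]) simp
  finally have "2 ^ Suc k dvd (p\<^sup>2 + n\<^sup>2 * q\<^sup>2)\<^sup>2 * s" .
  moreover have "odd ((p\<^sup>2 + n\<^sup>2 * q\<^sup>2)\<^sup>2)" using even_q \<open>odd p\<close> by simp
  hence "coprime (2 ^ Suc k) ((p\<^sup>2 + n\<^sup>2 * q\<^sup>2)\<^sup>2)"
    by (simp only: coprime_power_left_iff coprime_left_2_iff_odd simp_thms)
  ultimately have "2 ^ Suc k dvd s" by (simp only: coprime_dvd_mult_right_iff)
  thus ?thesis using rs deep_frac by blast
qed

text \<open>If \<open>p\<close> or \<open>q\<close> is even, the numerator is odd against a factor
  4. If both are odd, the squared numerator is 4 times an odd number, while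
  \<open>(p - n * q) * (p + n * q)\<close> adds a factor 8 to the left-hand side.\<close>

lemma double_deep_1:
  assumes on: "on_curve E (Affine x y)" and y: "y \<noteq> 0"
  shows "\<exists>X Y. point_add E (Affine x y) (Affine x y) = Affine X Y \<and> deep 1 X"
proof -
  obtain p q where pq: "x = of_int p / of_int q" "q > 0" "coprime p q" by (rule rat_quotient)
  obtain r s Y where rs: "s > 0" "coprime r s"
    "point_add E (Affine x y) (Affine x y) = Affine (of_int r / of_int s) Y"
    "r * (4 * q * p * ((p - n * q) * (p + n * q))) = (p\<^sup>2 + n\<^sup>2 * q\<^sup>2)\<^sup>2 * s"
    using double_pq[OF on y pq(1,2)] by blast
  have "even s"
  proof (cases "even p \<or> even q")
    case True
    have "even ((p\<^sup>2 + n\<^sup>2 * q\<^sup>2)\<^sup>2 * s)" unfolding rs(4)[symmetric] by simp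
    moreover have "odd (p\<^sup>2 + n\<^sup>2 * q\<^sup>2)"
      using True coprime_common_divisor[OF pq(3), of 2] odd_n by auto
    ultimately show ?thesis by (metis even_mult_iff even_power)
  next
    case False
    hence "even (p - n * q)" using odd_n by simp
    then obtain u where u: "p - n * q = 2 * u" by (rule evenE)
    hence v: "p + n * q = 2 * (u + n * q)" by simp
    \<comment> \<open>\<open>n * q\<close> is odd, so the two factors have opposite parity.\<close>
    have "even (u * (u + n * q))" using False odd_n by auto
    then obtain w where w: "u * (u + n * q) = 2 * w" by blast
    have uv: "(p - n * q) * (p + n * q) = 8 * w"
    proof -
      have "(p - n * q) * (p + n * q) = 4 * (u * (u + n * q))" unfolding u v by simp
      thus ?thesis using w by simp
    qed
    have "p\<^sup>2 + n\<^sup>2 * q\<^sup>2 = (p - n * q)\<^sup>2 + 2 * (n * p * q)" by (simp add: power2_eq_square algebra_simps)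
    also have "\<dots> = 2 * (2 * u\<^sup>2 + n * p * q)" unfolding u by (simp add: power2_eq_square)
    finally have sum: "p\<^sup>2 + n\<^sup>2 * q\<^sup>2 = 2 * (2 * u\<^sup>2 + n * p * q)" .
    have "r * (4 * q * p * (8 * w)) = (2 * (2 * u\<^sup>2 + n * p * q))\<^sup>2 * s"
      using rs(4) unfolding uv sum .
    hence "4 * (2 * (r * 4 * q * p * w)) = 4 * ((2 * u\<^sup>2 + n * p * q)\<^sup>2 * s)"
      by (simp add: power2_eq_square algebra_simps)
    hence "(2 * u\<^sup>2 + n * p * q)\<^sup>2 * s = 2 * (r * 4 * q * p * w)" by (simp add: mult_ac)
    hence "even ((2 * u\<^sup>2 + n * p * q)\<^sup>2 * s)" by simp
    moreover have "odd (2 * u\<^sup>2 + n * p * q)" using False odd_n by simp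
    ultimately show ?thesis by simp
  qed
  thus ?thesis using rs deep_frac[of s r 1] by auto
qed

text \<open>The multiples by powers of 2 have unbounded height, whereas a torsion point has only
  finitely many multiples.\<close>

lemma not_torsion:
  assumes on: "on_curve E P" and P: "point_add E P P \<noteq> Infinity"
  shows "P \<notin> G.torsion"
proof
  assume "P \<in> G.torsion"
  then obtain m :: nat where m: "m > 0" "P [^]\<^bsub>G\<^esub> m = \<one>\<^bsub>G\<^esub>" by (auto simp: G.torsion_iff)
  have PG: "P \<in> carrier G" using on by simp
  obtain x y where xy: "P = Affine x y" using P by (cases P) auto
  have "y \<noteq> 0" using P xy by auto
  have deep: "\<exists>X Y. P [^]\<^bsub>G\<^esub> ((2::nat) ^ Suc k) = Affine X Y \<and> deep (Suc k) X" for k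
  proof (induction k)
    case 0
    have "P [^]\<^bsub>G\<^esub> ((2::nat) ^ Suc 0) = point_add E P P" using PG by (simp add: numeral_2_eq_2)
    then show ?case using double_deep_1[of x y] on xy \<open>y \<noteq> 0\<close> by auto
  next
    case (Suc k)
    then obtain X Y where XY: "P [^]\<^bsub>G\<^esub> ((2::nat) ^ Suc k) = Affine X Y" "deep (Suc k) X" by blast
    have "on_curve E (Affine X Y)" using G.nat_pow_closed[OF PG] XY(1) by (metis carrier_point_group)
    moreover have "P [^]\<^bsub>G\<^esub> ((2::nat) ^ Suc (Suc k)) = point_add E (Affine X Y) (Affine X Y)"
      using PG unfolding XY(1)[symmetric] mult_point_group[symmetric] by (subst G.nat_pow_mult) simp_all
    ultimately show ?case using double_deep[of X Y "Suc k"] XY(2) by auto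
  qed
  define B where "B = Max ((\<lambda>i. height (P [^]\<^bsub>G\<^esub> i)) ` {..<m})"
  have "height (P [^]\<^bsub>G\<^esub> j) \<le> B" for j :: nat
  proof -
    have "P [^]\<^bsub>G\<^esub> j = P [^]\<^bsub>G\<^esub> (m * (j div m) + j mod m)" by simp
    also have "\<dots> = (P [^]\<^bsub>G\<^esub> m) [^]\<^bsub>G\<^esub> (j div m) \<otimes>\<^bsub>G\<^esub> P [^]\<^bsub>G\<^esub> (j mod m)"
      using PG by (simp only: G.nat_pow_mult[symmetric] G.nat_pow_pow)
    also have "\<dots> = P [^]\<^bsub>G\<^esub> (j mod m)" unfolding m(2) using PG G.nat_pow_closed[OF PG] by (simp only: G.nat_pow_one G.l_one)
    finally show ?thesis unfolding B_def using m(1) by (intro Max_ge) auto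
  qed
  moreover obtain k :: nat where "B < 2 ^ k"
  proof -
    have "B < 2 ^ nat \<bar>B\<bar>"
    proof -
      have "nat \<bar>B\<bar> < 2 ^ nat \<bar>B\<bar>" by (rule less_exp)
      hence "int (nat \<bar>B\<bar>) < int (2 ^ nat \<bar>B\<bar>)" by (simp only: of_nat_less_iff)
      thus ?thesis by simp
    qed
    thus ?thesis by (rule that)
  qed
  moreover obtain X Y where "P [^]\<^bsub>G\<^esub> ((2::nat) ^ Suc k) = Affine X Y" "deep (Suc k) X" using deep by blast
  moreover from this have "2 ^ Suc k \<le> height (P [^]\<^bsub>G\<^esub> ((2::nat) ^ Suc k))"
    using deep_height[of "Suc k" X] by simp
  ultimately have "(2::int) ^ Suc k \<le> B" by (meson order_trans)
  moreover have "(2::int) ^ k \<le> 2 ^ Suc k" by simp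
  ultimately show False using \<open>B < 2 ^ k\<close> by linarith
qed

lemma double_eq_Infinity_iff:
  "on_curve E P \<and> point_add E P P = Infinity \<longleftrightarrow>
    P \<in> {Infinity, Affine 0 0, Affine (of_int n) 0, Affine (- of_int n) 0}"
proof (cases P)
  case (Affine x y)
  have "on_curve E P \<and> point_add E P P = Infinity \<longleftrightarrow> on_curve E (Affine x y) \<and> y = 0"
    unfolding Affine by (auto simp: Let_def)
  also have "\<dots> \<longleftrightarrow> (x = 0 \<or> x = of_int n \<or> x = - of_int n) \<and> y = 0"
    unfolding on_curve_iff by (auto simp: add_eq_0_iff2)
  finally show ?thesis unfolding Affine by auto
qed simp

lemma torsion_eq:
  "G.torsion = {Infinity, Affine 0 0, Affine (of_int n) 0, Affine (- of_int n) 0}"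
proof (rule Set.set_eqI)
  fix P
  have "P \<in> G.torsion \<longleftrightarrow> on_curve E P \<and> point_add E P P = Infinity"
  proof
    assume "P \<in> G.torsion"
    thus "on_curve E P \<and> point_add E P P = Infinity"
      using not_torsion G.torsion_carrier by fastforce
  next
    assume P: "on_curve E P \<and> point_add E P P = Infinity"
    hence "P [^]\<^bsub>G\<^esub> (2::nat) = \<one>\<^bsub>G\<^esub>" by (simp add: numeral_2_eq_2)
    thus "P \<in> G.torsion" using P unfolding G.torsion_iff by (auto intro!: exI[of _ 2])
  qed
  thus "P \<in> G.torsion \<longleftrightarrow> P \<in> {Infinity, Affine 0 0, Affine (of_int n) 0, Affine (- of_int n) 0}"
    unfolding double_eq_Infinity_iff .
qed

lemma n_nonzero: "n \<noteq> 0" "(of_int n :: rat) \<noteq> 0" "(- of_int n :: rat) \<noteq> of_int n"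
  using odd_n by auto

lemma card_torsion: "card G.torsion = 4"
  unfolding torsion_eq using n_nonzero by auto

lemma torsion_iso: "torsion_part G \<cong> integer_mod_group 2 \<times>\<times> integer_mod_group 2"
proof -
  define h where "h = (\<lambda>(a::int, b::int). if a = 0 then if b = 0 then Infinity else Affine (of_int n) 0
     else if b = 0 then Affine 0 0 else Affine (- of_int n) (0::rat))"
  have c2: "carrier (integer_mod_group 2) = {0, 1}" by (auto simp: carrier_integer_mod_group)
  have "h \<in> iso (integer_mod_group 2 \<times>\<times> integer_mod_group 2) (torsion_part G)"
  proof (rule isoI)
    show "h \<in> hom (integer_mod_group 2 \<times>\<times> integer_mod_group 2) (torsion_part G)"
    proof (rule homI)
      fix x assume "x \<in> carrier (integer_mod_group 2 \<times>\<times> integer_mod_group 2)"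
      thus "h x \<in> G.torsion" unfolding torsion_eq by (auto simp: h_def)
    next
      fix x y assume "x \<in> carrier (integer_mod_group 2 \<times>\<times> integer_mod_group 2)"
        "y \<in> carrier (integer_mod_group 2 \<times>\<times> integer_mod_group 2)"
      then obtain a b c d where x: "x = (a, b)" and y: "y = (c, d)"
        and "a \<in> {0, 1}" "b \<in> {0, 1}" "c \<in> {0, 1}" "d \<in> {0, 1}" by (auto simp: c2)
      hence "h ((a + c) mod 2, (b + d) mod 2) = point_add E (h (a, b)) (h (c, d))"
        using n_nonzero unfolding h_def by (elim insertE emptyE) (simp_all add: Let_def)
      thus "h (x \<otimes>\<^bsub>integer_mod_group 2 \<times>\<times> integer_mod_group 2\<^esub> y) = h x \<otimes>\<^bsub>torsion_part G\<^esub> h y"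
        by (simp add: x y torsion_part_def)
    qed
    show "bij_betw h (carrier (integer_mod_group 2 \<times>\<times> integer_mod_group 2)) G.torsion"
      unfolding torsion_eq bij_betw_def using n_nonzero by (auto simp: c2 h_def inj_on_def)
  qed
  hence "integer_mod_group 2 \<times>\<times> integer_mod_group 2 \<cong> torsion_part G" by (rule is_isoI)
  thus ?thesis by (rule group.iso_sym[rotated]) (simp add: DirProd_group)
qed

end

section \<open>The curve of rank seven\<close>

lemma prime_int_trial_division:
  fixes p :: int
  assumes "p > 1" "\<forall>d\<in>set [2..k]. p mod d \<noteq> 0" "p < (k + 1)\<^sup>2" "k \<ge> 0"
  shows "prime p"
proof (rule ccontr)
  assume "\<not> prime p"
  then obtain a where "a \<ge> 0" "a dvd p" "a \<noteq> 1" "a \<noteq> p"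
    using assms(1) unfolding prime_int_iff by blast
  moreover from this have "a \<noteq> 0" using assms(1) by auto
  moreover have "a \<le> p" using \<open>a dvd p\<close> assms(1) by (simp add: zdvd_imp_le)
  ultimately have a: "1 < a" "a < p" "a dvd p" by simp_all
  then obtain b where b: "p = a * b" by blast
  have small: "c \<ge> k + 1" if "c dvd p" "c > 1" for c
  proof (rule ccontr)
    assume "\<not> c \<ge> k + 1"
    hence "c \<in> set [2..k]" using that(2) by simp
    thus False using assms(2) that(1) by (auto simp: dvd_eq_mod_eq_0)
  qed
  have "b > 0" using assms(1) a b by (simp add: zero_less_mult_iff)
  moreover have "b \<noteq> 1" using a b by auto
  ultimately have "b > 1" by simp
  hence "a \<ge> k + 1" "b \<ge> k + 1" using small a b by auto
  hence "(k + 1) * (k + 1) \<le> a * b" using assms(4) by (intro mult_mono) auto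
  thus False using assms(3) b by (simp add: power2_eq_square)
qed

text \<open>Deciding primality of 79873 by this rule tests every number below it.\<close>

declare prime_int_numeral_eq [simp del]

locale rank_seven_curve = congruent_number_curve +
  assumes n_eq: "n = 797507543735"
begin

interpretation G: comm_group G by (rule comm_group_point_group)

lemma primes:
  "prime (2::int)" "prime (5::int)" "prime (7::int)" "prime (17::int)" "prime (97::int)" "prime (173::int)"
  "prime (79873::int)"
proof -
  \<comment> \<open>\<open>283^2 = 80089\<close> exceeds 79873, so divisors up to 282 suffice;
    likewise \<open>14^2 > 173\<close> and \<open>10^2 > 97\<close> below.\<close>
  show "prime (79873::int)"
    by (rule prime_int_trial_division[of _ 282]) (simp, code_simp, simp, simp)
  show "prime (173::int)" by (rule prime_int_trial_division[of _ 13]) (simp, code_simp, simp, simp)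
  show "prime (97::int)" by (rule prime_int_trial_division[of _ 9]) (simp, code_simp, simp, simp)
qed (simp_all add: prime_int_numeral_eq)

lemma prime_dvd_n:
  assumes "prime p" "p dvd n"
  shows "p \<in> {5, 7, 17, 97, 173, 79873}"
proof -
  have "p dvd 5 * (7 * (17 * (97 * (173 * 79873))))" using assms(2) by (simp add: n_eq)
  hence "p dvd 5 \<or> p dvd 7 \<or> p dvd 17 \<or> p dvd 97 \<or> p dvd 173 \<or> p dvd 79873"
    using assms(1) by (simp only: prime_dvd_mult_iff)
  thus ?thesis using primes_dvd_imp_eq[OF assms(1)] primes by blast
qed

text \<open>The order of the nine parities makes their matrix on the points below triangular.\<close>

definition bit :: "nat \<Rightarrow> rat point \<Rightarrow> bool" where
  "bit k P \<longleftrightarrow> odd_val ([2, 17, 7, 97, 97, 79873, 17, 173, 79873] ! k)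
     (delta_point ([of_int n, 0, of_int n, of_int n, 0, 0, of_int n, of_int n, of_int n] ! k) P)"

lemma less_9: "k < 9 \<longleftrightarrow> k \<in> {0, 1, 2, 3, 4, 5, 6, 7, 8::nat}"
  by auto

lemma odd_val_delta_add:
  assumes p: "prime p" and r: "r \<in> {0, of_int n, - of_int n}" and on: "on_curve E P" "on_curve E Q"
  shows "odd_val p (delta_point r (point_add E P Q)) \<longleftrightarrow>
    odd_val p (delta_point r P) \<noteq> odd_val p (delta_point r Q)"
proof -
  have nz: "delta_point r R \<noteq> 0" for R using delta_point_nonzero[OF r] .
  obtain s where s: "delta_point r P * delta_point r Q * delta_point r (point_add E P Q) = s\<^sup>2"
    using delta_point_add[OF r on] by blast
  hence "s \<noteq> 0" using nz by (metis mult_eq_0_iff zero_power2)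
  hence "\<not> odd_val p (delta_point r P * delta_point r Q * delta_point r (point_add E P Q))"
    unfolding s using odd_val_square p by blast
  thus ?thesis using nz p by (simp add: odd_val_mult)
qed

lemma bit_add:
  assumes "k < 9" "on_curve E P" "on_curve E Q"
  shows "bit k (point_add E P Q) \<longleftrightarrow> bit k P \<noteq> bit k Q"
proof -
  have "prime ([2, 17, 7, 97, 97, 79873, 17, 173, 79873 :: int] ! k)"
    using assms(1) primes unfolding less_9 by auto
  moreover have "[of_int n, 0, of_int n, of_int n, 0, 0, of_int n, of_int n, of_int n] ! k \<in> {0, of_int n, - of_int n :: rat}"
    using assms(1) unfolding less_9 by auto
  ultimately show ?thesis unfolding bit_def using odd_val_delta_add assms(2,3) by blast
qed

section \<open>Points whose nine parities vanish\<close>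

lemma odd_val_squarefree_part:
  assumes "prime p" "u \<noteq> 0" "Z \<noteq> 0"
  shows "odd_val p (of_int u / of_int (Z\<^sup>2)) \<longleftrightarrow> p dvd squarefree_part u"
proof -
  have "of_int u / of_int (Z\<^sup>2) = of_int u * (1 / of_int Z :: rat)\<^sup>2" by (simp add: power_divide)
  thus ?thesis using assms by (simp add: odd_val_int_square prime_dvd_squarefree_part)
qed

text \<open>These points are handled apart because one of the three factors is zero there. Each is
  detected by a parity of its own: 7 in \<open>x - n\<close> for \<open>x = 0\<close>, 2 in
  \<open>x - n\<close> for \<open>x = n\<close>, and 17 in \<open>x\<close> for
  \<open>x = - n\<close>.\<close>

lemma bits_vanish_order_two:
  assumes on: "on_curve E (Affine x 0)" and b: "\<And>k. k < 9 \<Longrightarrow> \<not> bit k (Affine x 0)"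
  shows False
proof -
  have "x = 0 \<or> x = of_int n \<or> x = of_int (- n)" using on unfolding on_curve_iff by (auto simp: eq_neg_iff_add_eq_0)
  then show False
  proof (elim disjE)
    assume x: "x = 0"
    have "delta_point (of_int n) (Affine x 0) = of_int (- n)" using n_nonzero x by (simp add: delta_def)
    moreover have "odd (multiplicity 7 (- n))" by (rule odd_multiplicity_once) (simp_all add: n_eq)
    ultimately have "bit 2 (Affine x 0)" unfolding bit_def using primes n_nonzero
      by (simp add: odd_val_int del: of_int_minus)
    thus False using b[of 2] by simp
  next
    assume x: "x = of_int n"
    have "delta_point (of_int n) (Affine x 0) = of_int 2 * (of_int n)\<^sup>2"
      using x by (simp add: delta_def pderiv_f power2_eq_square)
    moreover have "odd (multiplicity 2 (2::int))" by (rule odd_multiplicity_once) simp_all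
    ultimately have "bit 0 (Affine x 0)" unfolding bit_def using primes n_nonzero odd_val_int_square[of 2 2 "of_int n"]
      by simp
    thus False using b[of 0] by simp
  next
    assume x: "x = of_int (- n)"
    have "delta_point 0 (Affine x 0) = of_int (- n)" using n_nonzero x by (simp add: delta_def)
    moreover have "odd (multiplicity 17 (- n))" by (rule odd_multiplicity_once) (simp_all add: n_eq)
    ultimately have "bit 1 (Affine x 0)" unfolding bit_def using primes n_nonzero
      by (simp add: odd_val_int del: of_int_minus)
    thus False using b[of 1] by simp
  qed
qed

text \<open>5 and 173 are congruent to 5 modulo 8, so they reject both 2 and -2. At 17 signs and
  factors 2 are invisible, as -1 and 2 are squares there; 7 is the prime that sees signs.\<close>

lemma non_residues:
  "\<not> QuadRes 17 5" "\<not> QuadRes 17 (- 5)" "\<not> QuadRes 5 2" "\<not> QuadRes 5 (- 2)" "\<not> QuadRes 173 2" "\<not> QuadRes 173 (- 2)"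
  "\<not> QuadRes 17 7" "\<not> QuadRes 17 (- 7)" "\<not> QuadRes 17 14" "\<not> QuadRes 17 (- 14)" "\<not> QuadRes 7 (- 1)" "\<not> QuadRes 7 (- 2)"
  by (rule not_QuadResI; (simp; fail | code_simp))+

lemma dvd_5_cases: "(d::int) dvd 5 \<Longrightarrow> d \<in> {1, - 1, 5, - 5}"
proof -
  assume d: "d dvd 5"
  hence "\<bar>d\<bar> \<le> 5" using dvd_imp_le_int[of 5 d] by simp
  hence "d \<in> set [-5..5]" by (simp only: set_upto atLeastAtMost_iff) linarith
  moreover have "\<forall>d\<in>set [-5..5::int]. d dvd 5 \<longrightarrow> d \<in> {1, - 1, 5, - 5}" by code_simp
  ultimately show ?thesis using d by blast
qed

lemma dvd_14_cases: "(d::int) dvd 14 \<Longrightarrow> d \<in> {1, - 1, 2, - 2, 7, - 7, 14, - 14}"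
proof -
  assume d: "d dvd 14"
  hence "\<bar>d\<bar> \<le> 14" using dvd_imp_le_int[of 14 d] by simp
  hence "d \<in> set [-14..14]" by (simp only: set_upto atLeastAtMost_iff) linarith
  moreover have "\<forall>d\<in>set [-14..14::int]. d dvd 14 \<longrightarrow> d \<in> {1, - 1, 2, - 2, 7, - 7, 14, - 14}" by code_simp
  ultimately show ?thesis using d by blast
qed

text \<open>The squarefree parts can contain only bad primes; most are excluded by hypothesis. The
  order of the local arguments matters: 17 restricts \<open>v\<close> to a sign, which lets 5 and
  173 be excluded from \<open>u\<close>, after which 17, 7 and 5 apply to \<open>u\<close> as a
  unit.\<close>

lemma selmer_trivial:
  fixes a Z Y :: int
  assumes cop: "coprime a (Z\<^sup>2)" and eq: "a * ((a - n * Z\<^sup>2) * (a + n * Z\<^sup>2)) = Y\<^sup>2"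
    and nz: "a - n * Z\<^sup>2 \<noteq> 0"
    and d: "\<And>p. p \<in> {17, 97, 79873} \<Longrightarrow> \<not> p dvd squarefree_part a"
    and d': "\<And>p. p \<in> {2, 7, 17, 97, 173, 79873} \<Longrightarrow> \<not> p dvd squarefree_part (a - n * Z\<^sup>2)"
  shows "squarefree_part a = 1" "squarefree_part (a - n * Z\<^sup>2) = 1"
proof -
  define b where "b = a - n * Z\<^sup>2"
  define u v where "u = squarefree_part a" and "v = squarefree_part b"
  have ua: "a = u * (square_part a)\<^sup>2" and vb: "a - n * Z\<^sup>2 = v * (square_part b)\<^sup>2"
    unfolding u_def v_def b_def by (rule squarefree_decompose)+
  have u_dvd: "u dvd a" using ua by (metis dvd_triv_left)
  have v_dvd: "v dvd a - n * Z\<^sup>2" using vb by (metis dvd_triv_left)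
  have pZ: False if "prime p" "p dvd a" "p dvd Z\<^sup>2" for p
    using that cop by (meson coprime_common_divisor not_prime_unit)
  \<comment> \<open>A prime dividing \<open>a\<close> but not \<open>n\<close> meets neither of the
    other two factors, by coprimality of \<open>a\<close> and \<open>Z\<close>.\<close>
  have u_prime: "p dvd n" if p: "prime p" "p dvd u" for p
  proof (rule ccontr)
    assume pn: "\<not> p dvd n"
    have pa: "p dvd a" using p(2) u_dvd by (rule dvd_trans)
    have nZ: "\<not> p dvd n * Z\<^sup>2" using pn pZ p(1) pa by (auto simp: prime_dvd_mult_iff)
    have "\<not> p dvd a - n * Z\<^sup>2"
    proof
      assume "p dvd a - n * Z\<^sup>2"
      hence "p dvd a - (a - n * Z\<^sup>2)" by (rule dvd_diff[OF pa])
      thus False using nZ by simp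
    qed
    moreover have "\<not> p dvd a + n * Z\<^sup>2" using nZ pa by (simp add: dvd_add_right_iff)
    ultimately have "even (multiplicity p a)" using even_multiplicity_of_square p(1) eq by blast
    thus False using prime_dvd_squarefree_part[OF p(1), of a] p(2) u_def by simp
  qed
  \<comment> \<open>The prime 2 appears because \<open>a - n * Z^2\<close> and
    \<open>a + n * Z^2\<close> differ by \<open>2 * n * Z^2\<close>.\<close>
  have v_prime: "p dvd 2 * n" if p: "prime p" "p dvd v" for p
  proof (rule ccontr)
    assume pn: "\<not> p dvd 2 * n"
    have pb: "p dvd a - n * Z\<^sup>2" using p(2) v_dvd by (rule dvd_trans)
    have pZ2: "\<not> p dvd Z\<^sup>2"
    proof
      assume "p dvd Z\<^sup>2"
      hence "p dvd (a - n * Z\<^sup>2) + n * Z\<^sup>2" using pb by (intro dvd_add) simp_all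
      thus False using pZ p(1) \<open>p dvd Z\<^sup>2\<close> by simp
    qed
    have "\<not> p dvd a"
    proof
      assume "p dvd a"
      hence "p dvd a - (a - n * Z\<^sup>2)" using pb by (rule dvd_diff)
      hence "p dvd n" using pZ2 p(1) by (simp add: prime_dvd_mult_iff)
      thus False using pn by simp
    qed
    moreover have "\<not> p dvd a + n * Z\<^sup>2"
    proof
      assume "p dvd a + n * Z\<^sup>2"
      hence "p dvd (a + n * Z\<^sup>2) - (a - n * Z\<^sup>2)" using pb by (rule dvd_diff)
      hence "p dvd (2 * n) * Z\<^sup>2" by (simp add: mult.assoc)
      thus False using pZ2 pn p(1) prime_dvd_mult_iff by blast
    qed
    moreover have "(a - n * Z\<^sup>2) * (a * (a + n * Z\<^sup>2)) = Y\<^sup>2" using eq by (simp add: mult_ac)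
    ultimately have "even (multiplicity p (a - n * Z\<^sup>2))" using even_multiplicity_of_square p(1) by blast
    thus False using prime_dvd_squarefree_part[OF p(1), of b] p(2) v_def b_def by simp
  qed
  note unit = local_unit[OF _ _ _ cop eq ua vb] and nonunit = local_nonunit[OF _ _ _ cop eq nz ua vb]
  have nd: "(5::int) dvd n" "\<not> (5::int) * 5 dvd n" "(7::int) dvd n" "\<not> (7::int) * 7 dvd n"
    "(17::int) dvd n" "\<not> (17::int) * 17 dvd n" "(173::int) dvd n" "\<not> (173::int) * 173 dvd n"
    by (simp_all add: n_eq)
  have du: "\<not> 17 dvd u" "\<not> 97 dvd u" "\<not> 79873 dvd u" using d unfolding u_def by simp_all
  have dv: "\<not> 2 dvd v" "\<not> 7 dvd v" "\<not> 17 dvd v" "\<not> 97 dvd v" "\<not> 173 dvd v" "\<not> 79873 dvd v"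
    using d' unfolding v_def b_def by simp_all
  have "v dvd 5" unfolding v_def
  proof (rule squarefree_part_dvdI)
    fix p :: int assume p: "prime p" "p dvd squarefree_part b"
    hence "p dvd 2 * n" using v_prime v_def by blast
    hence "p dvd 2 \<or> p dvd n" using p(1) by (simp add: prime_dvd_mult_iff)
    hence "p \<in> {2, 5, 7, 17, 97, 173, 79873}"
      using prime_dvd_n[OF p(1)] primes_dvd_imp_eq[OF p(1) primes(1)] by blast
    thus "p dvd 5" using dv p(2) v_def by auto
  qed simp
  hence "v \<in> {1, - 1, 5, - 5}" by (rule dvd_5_cases)
  moreover have "QuadRes 17 v" using unit(2)[OF primes(4) nd(5,6)] du dv by simp
  \<comment> \<open>5 and -5 are non-residues modulo 17.\<close>
  ultimately have v1: "v \<in> {1, - 1}" using non_residues by auto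
  \<comment> \<open>\<open>local_nonunit\<close> would make 2 or -2 a residue modulo 5; the same
    happens at 173 below.\<close>
  have "\<not> 5 dvd u"
  proof
    assume "5 dvd u"
    hence "QuadRes 5 (2 * v)" using nonunit[OF primes(2) nd(1,2)] v1 by auto
    thus False using v1 non_residues by auto
  qed
  have "\<not> 173 dvd u"
  proof
    assume "173 dvd u"
    hence "QuadRes 173 (2 * v)" using nonunit[OF primes(6) nd(7,8)] dv by auto
    thus False using v1 non_residues by auto
  qed
  have "u dvd 14" unfolding u_def
  proof (rule squarefree_part_dvdI)
    fix p :: int assume p: "prime p" "p dvd squarefree_part a"
    hence "p \<in> {5, 7, 17, 97, 173, 79873}" using u_prime u_def prime_dvd_n by blast
    thus "p dvd 14" using du \<open>\<not> 5 dvd u\<close> \<open>\<not> 173 dvd u\<close> p(2) u_def by auto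
  qed simp
  hence u14: "u \<in> {1, - 1, 2, - 2, 7, - 7, 14, - 14}" by (rule dvd_14_cases)
  have "QuadRes 17 u" using unit(1)[OF primes(4) nd(5,6)] du dv by simp
  hence u2: "u \<in> {1, - 1, 2, - 2}" using u14 non_residues by auto
  hence "\<not> 7 dvd u" by auto
  \<comment> \<open>With 7 removed from \<open>u\<close> by the condition at 17, both classes are
    units at 7, which fixes both signs; the last possibility \<open>u = 2\<close> falls at
    5.\<close>
  hence 7: "QuadRes 7 u" "QuadRes 7 v" using unit[OF primes(3) nd(3,4)] dv by simp_all
  have "\<not> 5 dvd v" using v1 by auto
  hence "QuadRes 5 u" using unit(1)[OF primes(2) nd(1,2)] \<open>\<not> 5 dvd u\<close> by simp
  with u2 7(1) have "u = 1" using non_residues by auto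
  moreover have "v = 1" using v1 7(2) non_residues by auto
  ultimately show "squarefree_part a = 1" "squarefree_part (a - n * Z\<^sup>2) = 1"
    unfolding u_def v_def b_def by simp_all
qed

text \<open>The denominator of \<open>x\<close> is coprime to the product of the three integral
  factors, so both are squares. This is the integral equation of \<open>selmer_trivial\<close>,
  which makes \<open>x\<close> and \<open>x - n\<close> squares.\<close>

lemma bits_vanish_imp_double:
  assumes on: "on_curve E P" and b: "\<And>k. k < 9 \<Longrightarrow> \<not> bit k P"
  shows "\<exists>R. on_curve E R \<and> P = point_add E R R"
proof (cases P)
  case Infinity
  then show ?thesis by (intro exI[of _ Infinity]) simp
next
  case (Affine x y)
  have y: "y \<noteq> 0" using bits_vanish_order_two on b Affine by blast
  obtain a q where aq: "x = of_int a / of_int q" "q > 0" "coprime a q" by (rule rat_quotient)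
  define c where "c = a * ((a - n * q) * (a + n * q))"
  have y2: "y\<^sup>2 = x * (x - of_int n) * (x + of_int n)" using on unfolding Affine on_curve_iff by simp
  have xc: "x - of_int n = of_int (a - n * q) / of_int q" "x + of_int n = of_int (a + n * q) / of_int q"
    using aq(1,2) by (simp_all add: field_simps)
  have "(y * (of_int q)\<^sup>2)\<^sup>2 = of_int (q * c)"
    unfolding power_mult_distrib y2 xc c_def unfolding aq(1) using aq(2) by (simp add: power2_eq_square)
  then obtain W where W: "y * (of_int q)\<^sup>2 = of_int W" "W\<^sup>2 = q * c" by (rule rat_square_int)
  have "W \<noteq> 0" using W(1) y aq(2) by auto
  \<comment> \<open>Positivity excludes the splitting of a square into two negated squares.\<close>
  hence "q * c > 0" using W(2) by (metis zero_less_power2)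
  hence c0: "c > 0" using aq(2) by (simp add: zero_less_mult_iff)
  have "coprime q (a - n * q)" "coprime q (a + n * q)"
  proof -
    have "is_unit t" if "t dvd q" "t dvd a + m * q" for t m
    proof -
      have "t dvd (a + m * q) - m * q" using that by (intro dvd_diff dvd_mult)
      thus ?thesis using coprime_common_divisor[OF aq(3), of t] that(1) by simp
    qed
    from this[of _ "- n"] this[of _ n] show "coprime q (a - n * q)" "coprime q (a + n * q)"
      by (auto intro!: coprimeI)
  qed
  hence cop: "coprime q c" unfolding c_def using aq(3) by (simp add: coprime_commute)
  obtain Z where Z: "q = Z\<^sup>2" using coprime_mult_square_int[OF aq(2) cop] W(2) by metis
  obtain Y where Y: "c = Y\<^sup>2"
    using coprime_mult_square_int[OF c0, of q W] cop W(2) by (metis coprime_commute mult.commute)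
  have Z0: "Z \<noteq> 0" using Z aq(2) by auto
  have a0: "a \<noteq> 0" "a - n * q \<noteq> 0" using c0 unfolding c_def by auto
  have x0: "x \<noteq> 0" "x - of_int n \<noteq> 0" using y y2 by auto
  have dp: "delta_point 0 P = of_int a / of_int (Z\<^sup>2)" "delta_point (of_int n) P = of_int (a - n * q) / of_int (Z\<^sup>2)"
    using x0 aq(1) xc Z unfolding Affine by (auto simp: delta_def)
  have ov: "odd_val p (delta_point 0 P) \<longleftrightarrow> p dvd squarefree_part a"
    "odd_val p (delta_point (of_int n) P) \<longleftrightarrow> p dvd squarefree_part (a - n * q)" if "prime p" for p
    unfolding dp using odd_val_squarefree_part[OF that _ Z0] a0 by blast+
  have b': "\<not> odd_val 2 (delta_point (of_int n) P)" "\<not> odd_val 17 (delta_point 0 P)" "\<not> odd_val 7 (delta_point (of_int n) P)"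
    "\<not> odd_val 17 (delta_point (of_int n) P)" "\<not> odd_val 97 (delta_point 0 P)" "\<not> odd_val 97 (delta_point (of_int n) P)"
    "\<not> odd_val 79873 (delta_point 0 P)" "\<not> odd_val 173 (delta_point (of_int n) P)" "\<not> odd_val 79873 (delta_point (of_int n) P)"
    using b[of 0] b[of 1] b[of 2] b[of 3] b[of 4] b[of 5] b[of 6] b[of 7] b[of 8] unfolding bit_def by simp_all
  have "squarefree_part a = 1 \<and> squarefree_part (a - n * Z\<^sup>2) = 1"
  proof (intro conjI)
    have cz: "coprime a (Z\<^sup>2)" "a * ((a - n * Z\<^sup>2) * (a + n * Z\<^sup>2)) = Y\<^sup>2" "a - n * Z\<^sup>2 \<noteq> 0"
      using aq(3) Y a0 unfolding c_def Z by simp_all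
    have d: "\<not> p dvd squarefree_part a" if "p \<in> {17, 97, 79873}" for p
      using that b' ov(1) primes by auto
    have d': "\<not> p dvd squarefree_part (a - n * Z\<^sup>2)" if "p \<in> {2, 7, 17, 97, 173, 79873}" for p
      using that b' ov(2) primes unfolding Z by auto
    show "squarefree_part a = 1" "squarefree_part (a - n * Z\<^sup>2) = 1"
      using selmer_trivial[OF cz d d'] by blast+
  qed
  hence "a = (square_part a)\<^sup>2" "a - n * q = (square_part (a - n * q))\<^sup>2"
    using squarefree_decompose[of a] squarefree_decompose[of "a - n * q"] unfolding Z by simp_all
  hence "delta_point 0 P = (of_int (square_part a) / of_int Z)\<^sup>2"
    "delta_point (of_int n) P = (of_int (square_part (a - n * q)) / of_int Z)\<^sup>2"
    unfolding dp by (metis of_int_power power_divide)+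
  thus ?thesis using delta_squares_imp_double[OF on] by blast
qed

text \<open>The seven points of infinite order come from a search on the 2-coverings of the curve. The lists
  \<open>class0\<close> and \<open>class_n\<close> contain \<open>x\<close> and \<open>x - n\<close> modulo squares.\<close>

definition basis_point :: "nat \<Rightarrow> rat point" where
  "basis_point k = [Affine (of_int n) 0,
    Affine (-4904454015541204775 / 102537005796) (181096794785446932643740841028075 / 32833784773960344),
    Affine 0 0,
    Affine (2349199039600) (3386809128504045300),
    Affine (41883387252225625 / 50176) (2531093164311743323699875 / 11239424),
    Affine (30950527816902400 / 27889) (3786502295899040518760400 / 4657463),
    Affine (2318984065560819034225 / 825757696) (107075025194291064459301063709175 / 23728973152256),
    Affine (190937925444841 / 196) (1515202991463645897939 / 2744),
    Affine (2128331861027319025 / 2316484) (1541768050897758609586080225 / 3525688648)] ! k"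

definition class0 :: "int list" where
  "class0 = [n, -921974039, - 1, 679, 7747681, 559111, 1, 1, 1]"

definition class_n :: "int list" where
  "class_n = [2, -35, - n, 1426385, 1174532465, 1174532465, 1174532465, 13818029, 399365]"

text \<open>Explicit square roots \<open>s\<close> and \<open>t\<close> reduce membership in the
  curve and both descent classes to arithmetic with fractions.\<close>

lemma affine_class:
  fixes x y s t :: rat and d0 dn :: int
  assumes x: "x = of_int d0 * s\<^sup>2" "x - of_int n = of_int dn * t\<^sup>2"
    and y: "y\<^sup>2 = x * (x - of_int n) * (x + of_int n)"
    and nz: "s \<noteq> 0" "t \<noteq> 0" "d0 \<noteq> 0" "dn \<noteq> 0"
  shows "on_curve E (Affine x y) \<and> (\<exists>s\<noteq>0. delta_point 0 (Affine x y) = of_int d0 * s\<^sup>2) \<and>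
    (\<exists>s\<noteq>0. delta_point (of_int n) (Affine x y) = of_int dn * s\<^sup>2)"
proof -
  have "x \<noteq> 0" "x \<noteq> of_int n" using x nz by auto
  hence "delta_point 0 (Affine x y) = of_int d0 * s\<^sup>2" "delta_point (of_int n) (Affine x y) = of_int dn * t\<^sup>2"
    using x by (simp_all add: delta_def)
  moreover have "on_curve E (Affine x y)" unfolding on_curve_iff using y by simp
  ultimately show ?thesis using nz by blast
qed

lemma basis_point_class:
  assumes "k < 9"
  shows "on_curve E (basis_point k) \<and>
    (\<exists>s\<noteq>0. delta_point 0 (basis_point k) = of_int (class0 ! k) * s\<^sup>2) \<and>
    (\<exists>s\<noteq>0. delta_point (of_int n) (basis_point k) = of_int (class_n ! k) * s\<^sup>2)"
proof -
  consider "k = 0" | "k = 1" | "k = 2" | "k = 3" | "k = 4" | "k = 5" | "k = 6" | "k = 7" | "k = 8"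
    using assms unfolding less_9 by blast
  then show ?thesis
  proof cases
    \<comment> \<open>Case numbers exceed \<open>k\<close> by one. Cases 1 and 3 are points of order
      two, where the derivative branch of \<open>delta\<close> applies and
      \<open>affine_class\<close> does not.\<close>
    case 1
    have "delta_point 0 (basis_point k) = of_int (class0 ! k) * 1\<^sup>2"
      "delta_point (of_int n) (basis_point k) = of_int (class_n ! k) * (of_int n)\<^sup>2" "on_curve E (basis_point k)"
      using n_nonzero unfolding basis_point_def class0_def class_n_def 1
      by (simp_all add: delta_def pderiv_f power2_eq_square power3_eq_cube)
    then show ?thesis using n_nonzero one_neq_zero by blast
  next
    case 3
    have "delta_point 0 (basis_point k) = of_int (class0 ! k) * (of_int n)\<^sup>2"
      "delta_point (of_int n) (basis_point k) = of_int (class_n ! k) * 1\<^sup>2" "on_curve E (basis_point k)"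
      using n_nonzero unfolding basis_point_def class0_def class_n_def 3
      by (simp_all add: delta_def pderiv_f power2_eq_square power3_eq_cube)
    then show ?thesis using n_nonzero one_neq_zero by blast
  next
    case 2
    have eqs: "basis_point k = Affine (-4904454015541204775 / 102537005796) (181096794785446932643740841028075 / 32833784773960344)"
      "class0 ! k = -921974039" "class_n ! k = -35"
      unfolding basis_point_def class0_def class_n_def 2 by simp_all
    show ?thesis unfolding eqs
      by (rule affine_class[where s = "72935 / 320214" and t = "48337781759 / 320214"]) (simp_all add: n_eq power2_eq_square)
  next
    case 4
    have eqs: "basis_point k = Affine (2349199039600) (3386809128504045300)"
      "class0 ! k = 679" "class_n ! k = 1426385"
      unfolding basis_point_def class0_def class_n_def 4 by simp_all
    show ?thesis unfolding eqs
      by (rule affine_class[where s = "58820" and t = "1043"]) (simp_all add: n_eq power2_eq_square)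
  next
    case 5
    have eqs: "basis_point k = Affine (41883387252225625 / 50176) (2531093164311743323699875 / 11239424)"
      "class0 ! k = 7747681" "class_n ! k = 1174532465"
      unfolding basis_point_def class0_def class_n_def 5 by simp_all
    show ?thesis unfolding eqs
      by (rule affine_class[where s = "73525 / 224" and t = "1261 / 224"]) (simp_all add: n_eq power2_eq_square)
  next
    case 6
    have eqs: "basis_point k = Affine (30950527816902400 / 27889) (3786502295899040518760400 / 4657463)"
      "class0 ! k = 559111" "class_n ! k = 1174532465"
      unfolding basis_point_def class0_def class_n_def 6 by simp_all
    show ?thesis unfolding eqs
      by (rule affine_class[where s = "235280 / 167" and t = "2723 / 167"]) (simp_all add: n_eq power2_eq_square)
  next
    case 7
    have eqs: "basis_point k = Affine (2318984065560819034225 / 825757696) (107075025194291064459301063709175 / 23728973152256)"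
      "class0 ! k = 1" "class_n ! k = 1174532465"
      unfolding basis_point_def class0_def class_n_def 7 by simp_all
    show ?thesis unfolding eqs
      by (rule affine_class[where s = "48155831065 / 28736" and t = "1188991 / 28736"]) (simp_all add: n_eq power2_eq_square)
  next
    case 8
    have eqs: "basis_point k = Affine (190937925444841 / 196) (1515202991463645897939 / 2744)"
      "class0 ! k = 1" "class_n ! k = 13818029"
      unfolding basis_point_def class0_def class_n_def 8 by simp_all
    show ?thesis unfolding eqs
      by (rule affine_class[where s = "13818029 / 14" and t = "1583 / 14"]) (simp_all add: n_eq power2_eq_square)
  next
    case 9
    have eqs: "basis_point k = Affine (2128331861027319025 / 2316484) (1541768050897758609586080225 / 3525688648)"
      "class0 ! k = 1" "class_n ! k = 399365"
      unfolding basis_point_def class0_def class_n_def 9 by simp_all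
    show ?thesis unfolding eqs
      by (rule affine_class[where s = "1458880345 / 1522" and t = "838697 / 1522"]) (simp_all add: n_eq power2_eq_square)
  qed
qed

text \<open>The positions 1, 4, 5 are those at which \<open>bit\<close> inspects \<open>x\<close>;
  the others inspect \<open>x - n\<close>.\<close>

lemma bit_basis_point:
  assumes "j < 9" "k < 9"
  shows "bit j (basis_point k) \<longleftrightarrow>
    odd (multiplicity ([2, 17, 7, 97, 97, 79873, 17, 173, 79873] ! j)
      ((if j \<in> {1, 4, 5} then class0 else class_n) ! k))"
proof -
  have nz: "class0 ! k \<noteq> 0" "class_n ! k \<noteq> 0"
    using assms(2) n_nonzero unfolding less_9 class0_def class_n_def by auto
  have p: "prime ([2, 17, 7, 97, 97, 79873, 17, 173, 79873 :: int] ! j)"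
    using assms(1) primes unfolding less_9 by auto
  obtain s t where st: "s \<noteq> 0" "delta_point 0 (basis_point k) = of_int (class0 ! k) * s\<^sup>2"
    "t \<noteq> 0" "delta_point (of_int n) (basis_point k) = of_int (class_n ! k) * t\<^sup>2"
    using basis_point_class[OF assms(2)] by blast
  have "[of_int n, 0, of_int n, of_int n, 0, 0, of_int n, of_int n, of_int n :: rat] ! j = (if j \<in> {1, 4, 5} then 0 else of_int n)"
    using assms(1) unfolding less_9 by auto
  thus ?thesis unfolding bit_def using odd_val_int_square[OF p] st nz by auto
qed

text \<open>The diagonal entries can be read off the factorizations 2,
  \<open>- 7 * 17 * 97 * 79873\<close>, \<open>- n\<close>, \<open>5 * 17 * 97 * 173\<close>,
  \<open>97 * 79873\<close>, \<open>7 * 79873\<close>, \<open>5 * 17 * 173 * 79873\<close>,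
  \<open>173 * 79873\<close>, \<open>5 * 79873\<close>, each containing the prime of its position
  exactly once.\<close>

lemma bit_triangular:
  assumes "k < 9"
  shows "bit k (basis_point k)" and "j < k \<Longrightarrow> \<not> bit j (basis_point k)"
proof -
  have "\<forall>k\<in>{0, 1, 2, 3, 4, 5, 6, 7, 8::nat}.
      ([2, 17, 7, 97, 97, 79873, 17, 173, 79873] ! k) dvd ((if k \<in> {1, 4, 5} then class0 else class_n) ! k) \<and>
      \<not> ([2, 17, 7, 97, 97, 79873, 17, 173, 79873] ! k) * ([2, 17, 7, 97, 97, 79873, 17, 173, 79873] ! k)
         dvd ((if k \<in> {1, 4, 5} then class0 else class_n) ! k)"
    unfolding class0_def class_n_def unfolding n_eq by simp
  thus "bit k (basis_point k)"
    using assms odd_multiplicity_once unfolding bit_basis_point[OF assms assms] less_9 by blast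
next
  assume j: "j < k"
  have "\<forall>k\<in>{0, 1, 2, 3, 4, 5, 6, 7, 8::nat}. \<forall>j\<in>{0, 1, 2, 3, 4, 5, 6, 7, 8::nat}. j < k \<longrightarrow>
      \<not> ([2, 17, 7, 97, 97, 79873, 17, 173, 79873] ! j) dvd ((if j \<in> {1, 4, 5} then class0 else class_n) ! k)"
    unfolding class0_def class_n_def unfolding n_eq by simp
  moreover have j9: "j < 9" using j assms by simp
  ultimately have "\<not> ([2, 17, 7, 97, 97, 79873, 17, 173, 79873] ! j) dvd ((if j \<in> {1, 4, 5} then class0 else class_n) ! k)"
    using j assms unfolding less_9 by blast
  thus "\<not> bit j (basis_point k)" unfolding bit_basis_point[OF j9 assms] by (simp add: not_dvd_imp_multiplicity_0)
qed

section \<open>Finite generation and the rank\<close>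

lemma bits_surjective: "\<exists>x\<in>carrier G. \<forall>k<9. bit k x \<longleftrightarrow> k \<in> A"
  by (rule G.surj_triangular[where p = basis_point])
     (use bit_add bit_triangular basis_point_class in simp_all)

text \<open>The weak Mordell-Weil theorem is read off the parities: adding the representative with
  the same nine parities as \<open>x\<close> makes all of them vanish, so the sum is a
  double.\<close>

lemma finitely_generated: "\<exists>S. finite S \<and> S \<subseteq> carrier G \<and> carrier G \<subseteq> generate G S"
proof -
  obtain K where K: "\<And>P. on_curve E P \<Longrightarrow> height P ^ 4 \<le> K * height (point_add E P P)"
    using height_double by metis
  have "\<forall>Q. \<exists>C. on_curve E Q \<longrightarrow> (\<forall>P. on_curve E P \<longrightarrow> height (point_add E P Q) \<le> C * (height P)\<^sup>2)"
    using height_add by metis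
  then obtain C where C: "\<And>P Q. on_curve E Q \<Longrightarrow> on_curve E P \<Longrightarrow> height (point_add E P Q) \<le> C Q * (height P)\<^sup>2"
    by metis
  obtain rep where rep: "\<And>A. on_curve E (rep A)" "\<And>A k. k < 9 \<Longrightarrow> bit k (rep A) \<longleftrightarrow> k \<in> A"
    using bits_surjective by (metis carrier_point_group)
  show ?thesis
  proof (rule G.generate_descent[where H = height and C = C and D = K and F = "rep ` Pow {..<9}"])
    show "finite {x \<in> carrier G. height x \<le> B}" for B using finite_height[of B] by simp
    show "\<exists>q\<in>rep ` Pow {..<9}. \<exists>r\<in>carrier G. x \<otimes>\<^bsub>G\<^esub> q = r \<otimes>\<^bsub>G\<^esub> r" if x: "x \<in> carrier G" for x
    proof -
      define A where "A = {k. k < 9 \<and> bit k x}"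
      have on: "on_curve E x" using x by simp
      have "\<not> bit k (point_add E x (rep A))" if "k < 9" for k
        using that rep on by (simp add: bit_add A_def)
      then obtain R where "on_curve E R" "point_add E x (rep A) = point_add E R R"
        using bits_vanish_imp_double add_closed on rep(1) by blast
      hence "x \<otimes>\<^bsub>G\<^esub> rep A = R \<otimes>\<^bsub>G\<^esub> R" "R \<in> carrier G" by simp_all
      moreover have "rep A \<in> rep ` Pow {..<9}" by (auto simp: A_def)
      ultimately show ?thesis by blast
    qed
  qed (use height_pos C K rep in auto)
qed

lemma rank: "has_mordell_weil_rank E 7"
proof -
  obtain S where S: "finite S" "S \<subseteq> carrier G" "carrier G \<subseteq> generate G S" using finitely_generated by blast
  obtain I :: "rat point set" and g where I: "G.spans I g" "G.indep I g"
    using G.exists_basis[OF G.spans_generate[OF S]] by blast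
  have "card G.torsion * 2 ^ card I = 2 ^ card {..<9::nat}"
  proof (rule G.card_basis[OF I, where b = bit])
    show "t \<otimes>\<^bsub>G\<^esub> t = \<one>\<^bsub>G\<^esub>" if "t \<in> G.torsion" for t
      using that double_eq_Infinity_iff[of t] unfolding torsion_eq by simp
    show "\<exists>y\<in>carrier G. x = y \<otimes>\<^bsub>G\<^esub> y" if "x \<in> carrier G" "\<And>k. k \<in> {..<9} \<Longrightarrow> \<not> bit k x" for x
      using bits_vanish_imp_double[of x] that by auto
    show "\<exists>x\<in>carrier G. \<forall>k\<in>{..<9}. bit k x \<longleftrightarrow> k \<in> A" if "A \<subseteq> {..<9}" for A
      using bits_surjective[of A] by auto
  qed (simp_all add: bit_add)
  \<comment> \<open>The four torsion points account for two of the nine factors 2.\<close>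
  hence "(2::nat) ^ card I = 2 ^ 7" by (simp add: card_torsion)
  hence "card I = 7" by (rule power_inject_exp[THEN iffD1, rotated]) simp
  thus ?thesis using G.iso_torsion_free[OF I] unfolding has_mordell_weil_rank_def by simp
qed

lemma elliptic_curve_E: "elliptic_curve E"
  using n_nonzero by (simp add: elliptic_curve_def discriminant_def Let_def)

end

theorem theorem2:
  shows "\<exists>E :: rat weierstrass.
           elliptic_curve E \<and>
           torsion_part (point_group E) \<cong> integer_mod_group 2 \<times>\<times> integer_mod_group 2 \<and>
           has_mordell_weil_rank E 7"
proof -
  interpret rank_seven_curve 797507543735 by unfold_locales simp_all
  show ?thesis using elliptic_curve_E torsion_iso rank by blast
qed

end
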